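(* Let $F$ be a countable field and let $\{A_u\}_{u\in\mathbb{Z}_{>0}}$ be a sequence of countable subsets of $F$. Let $M$ be a countable field of transcendence degree at least one over $F$ and let $t \in M$ be transcendental over $F$. Let $\{q_u\}_{u\in\mathbb{Z}_{>0}}$ be a sequence of distinct prime numbers not equal to the characteristic of $M$. For each $u\in\mathbb{Z}_{>0}$ let $R_u(S)=C_u(S)/B_u(S)\in F(S)$, where $$C_u(S)=\prod_{i=1}^{m_u}(S-c_{u,i})^{n_{u,i}},\qquad B_u(S)=\prod_{i=1}^{k_u}(S-b_{u,i})^{j_{u,i}},$$ the elements $c_{u,i}, b_{u,i}\in F$ are all distinct, all $n_{u,i}, j_{u,i}$ are positive integers, $n_{u,1}\not\equiv 0 \bmod q_u$, and $0<\deg C_u-\deg B_u\not\equiv 0 \bmod q_u$. Assume that for all $u \in \mathbb{Z}_{>0}$ and all $x\in M$ (not a pole of $R_u$) the field $M$ contains a $q_u$-th root of $R_u(x)$. Assume also that for all $u\in \mathbb{Z}_{>0}$ and every finite set $B$ (of elements of $F$) the complement in $F$ of the set $$\{x\in F:\ x=a+b \text{ for some } a\in A_u,\ b\in B\}$$ is infinite. Then there exists a field $K\subset M$ of infinite algebraic degree over $F(t)$ such that each $A_u$, $u\in\mathbb{Z}_{>0}$, is (first-order) definable over $K$.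
   Context: "$K$ of infinite algebraic degree over $F(t)$" means that $K$ is an algebraic extension of $F(t)$ of infinite degree. A set $A\subseteq K$ is first-order definable over $K$ if it is the set of elements of $K$ satisfying some first-order formula in the language of rings, where parameters from $K$ are allowed. *)

theory Defs
  imports
    "HOL-Algebra.Finite_Extensions"
    "HOL-Algebra.Generated_Fields"
    "HOL-Computational_Algebra.Primes"
    "HOL-Library.Countable_Set"
    "HOL-Number_Theory.Cong"
begin

text \<open>First-order logic in the language of rings, with named variables indexed by \<open>nat\<close>.
  Disjunction, implication and the universal quantifier are expressible as usual.\<close>

datatype rterm =
    Var nat
  | Zero
  | One
  | Plus rterm rterm
  | Minus rterm
  | Times rterm rterm

datatype rformula =
    Equal rterm rterm
  | Neg rformula
  | Conj rformula rformula
  | Exists nat rformula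

primrec rterm_val :: "('a, 'b) ring_scheme \<Rightarrow> (nat \<Rightarrow> 'a) \<Rightarrow> rterm \<Rightarrow> 'a" where
  "rterm_val R e (Var i) = e i"
| "rterm_val R e Zero = \<zero>\<^bsub>R\<^esub>"
| "rterm_val R e One = \<one>\<^bsub>R\<^esub>"
| "rterm_val R e (Plus s r) = rterm_val R e s \<oplus>\<^bsub>R\<^esub> rterm_val R e r"
| "rterm_val R e (Minus s) = \<ominus>\<^bsub>R\<^esub> rterm_val R e s"
| "rterm_val R e (Times s r) = rterm_val R e s \<otimes>\<^bsub>R\<^esub> rterm_val R e r"

primrec satisfies :: "('a, 'b) ring_scheme \<Rightarrow> (nat \<Rightarrow> 'a) \<Rightarrow> rformula \<Rightarrow> bool" where
  "satisfies R e (Equal s r) \<longleftrightarrow> rterm_val R e s = rterm_val R e r"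
| "satisfies R e (Neg \<phi>) \<longleftrightarrow> \<not> satisfies R e \<phi>"
| "satisfies R e (Conj \<phi> \<psi>) \<longleftrightarrow> satisfies R e \<phi> \<and> satisfies R e \<psi>"
| "satisfies R e (Exists i \<phi>) \<longleftrightarrow> (\<exists>a\<in>carrier R. satisfies R (e(i := a)) \<phi>)"

text \<open>Variable 0 stands for the element being tested; the other free variables of \<open>\<phi>\<close>, of which
  there are finitely many, are the parameters, and their values in \<open>R\<close> are supplied by \<open>p\<close>.\<close>

definition definable_over :: "('a, 'b) ring_scheme \<Rightarrow> 'a set \<Rightarrow> bool" where
  "definable_over R A \<longleftrightarrow>
     (\<exists>\<phi> p. (\<forall>i. p i \<in> carrier R) \<and> A = {x \<in> carrier R. satisfies R (p(0 := x)) \<phi>})"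

definition field_char :: "('a, 'b) ring_scheme \<Rightarrow> nat" where
  "field_char R =
     (if \<exists>n::nat. n > 0 \<and> [n] \<cdot>\<^bsub>R\<^esub> \<one>\<^bsub>R\<^esub> = \<zero>\<^bsub>R\<^esub>
      then LEAST n::nat. n > 0 \<and> [n] \<cdot>\<^bsub>R\<^esub> \<one>\<^bsub>R\<^esub> = \<zero>\<^bsub>R\<^esub> else 0)"

text \<open>The polynomial \<open>(S - c 1)^(n 1) \<cdots> (S - c m)^(n m)\<close> in \<open>F[S]\<close>; polynomials over \<open>F\<close> are
  coefficient lists with the leading coefficient first.\<close>

definition linear_factors_poly ::
    "('a, 'b) ring_scheme \<Rightarrow> 'a set \<Rightarrow> nat \<Rightarrow> (nat \<Rightarrow> 'a) \<Rightarrow> (nat \<Rightarrow> nat) \<Rightarrow> 'a list" where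
  "linear_factors_poly M F m c n =
     (\<Otimes>\<^bsub>univ_poly M F\<^esub> i\<in>{1..m}. [\<one>\<^bsub>M\<^esub>, \<ominus>\<^bsub>M\<^esub> c i] [^]\<^bsub>univ_poly M F\<^esub> n i)"

definition infinite_algebraic_extension ::
    "('a, 'b) ring_scheme \<Rightarrow> 'a set \<Rightarrow> 'a set \<Rightarrow> bool" where
  "infinite_algebraic_extension M L K \<longleftrightarrow>
     subfield L M \<and> subfield K M \<and> L \<subseteq> K \<and>
     (\<forall>x\<in>K. ring.algebraic M L x) \<and> ring.infinite_dimension M L K"

end

theory Submission
  imports Defs "HOL-Decision_Procs.Algebra_Aux"
begin

text \<open>Only elements algebraic over \<open>F(t)\<close> matter. On the field of these, call \<open>x\<close> a pole of index \<open>u\<close> if for some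
  \<open>s\<close> the element \<open>R\<^sub>u(s + e\<^sub>u)\<close> is a \<open>q\<^sub>u\<close>-th power in \<open>K\<close>, while \<open>R\<^sub>u(s (x\<^sup>n + s\<^sup>q w\<^sup>n) + e\<^sub>u)\<close> with \<open>q = q\<^sub>u\<close>, \<open>n = q\<^sup>2\<close> is not
  one for any \<open>w\<close> in \<open>K\<close>; here \<open>e\<^sub>u\<close> is a fixed element of \<open>F\<close> that is neither a zero nor a pole of \<open>R\<^sub>u\<close>. The field
  \<open>K\<close> is the union of a chain of fields obtained from \<open>F(t)\<close> by successively adjoining \<open>q\<^sub>u\<close>-th roots of values of
  the \<open>R\<^sub>u\<close>, chosen by a finite-condition (generic) argument so that, for a given set \<open>Y\<^sub>u\<close>, no element of \<open>Y\<^sub>u\<close> is a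
  pole of index \<open>u\<close>, whereas every \<open>x\<close> in \<open>K\<close> is one if some place trivial on \<open>F\<close> is a pole of \<open>x\<close> but not of any
  element of \<open>Y\<^sub>u\<close>. If \<open>v(s) > 0\<close> is not divisible by \<open>q\<close> in the value group of \<open>K\<close> and \<open>v(x) \<le> -v(s)\<close>, then no \<open>w\<close> can
  cancel the pole, as the values of \<open>x\<^sup>n\<close> and \<open>s\<^sup>q w\<^sup>n\<close> differ; and such a condition survives the adjunction of a \<open>q\<^sub>u\<close>-th
  root if the radicand has value divisible by \<open>q\<^sub>u\<close>, since then the value group does not grow. For \<open>y\<close> in \<open>Y\<^sub>u\<close>
  a generic \<open>w\<close> in \<open>F\<close> makes the values at the finitely many recorded places divisible.

  One index is used with \<open>Y = F\<close>, where the elements that are not poles are algebraic over \<open>F\<close>. Taking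
  \<open>Y\<^sub>u = {1/(t - a) | a \<in> A\<^sub>u}\<close> for the other ones, \<open>A\<^sub>u\<close> consists of those \<open>x\<close> among them for which \<open>1/(t - x)\<close>
  is not a pole of index \<open>u\<close>.\<close>

section \<open>Valuations\<close>

text \<open>Two opposing demands dictate the formula for poles. Let \<open>v(s)\<close> be positive
  and not divisible by \<open>q\<close>. The value of \<open>x^n\<close> is \<open>q^2\<close> times
  a value, that of \<open>s^q w^n\<close> is \<open>q v(s)\<close> modulo such multiples; so they
  differ, the sum has value divisible by \<open>q\<close>, and the factor \<open>s\<close> in front
  destroys this divisibility. As the degree of \<open>R_u\<close> is prime to \<open>q\<close>, no
  \<open>q\<close>-th root exists. An element integral at the recorded places has to escape instead.
  Where \<open>s\<close> is small, the argument of \<open>R_u\<close> is close to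
  \<open>e_u\<close>; where \<open>s\<close> is a unit, a generic \<open>w\<close> keeps away from
  zeros and poles of \<open>R_u\<close>; where \<open>s\<close> has a pole,
  \<open>s^(q+1) w^n\<close> dominates, and its value is divisible by \<open>q\<close> because
  \<open>R_u(s + e_u)\<close> is a \<open>q\<close>-th power: this is why that condition is part of
  the formula. The primes are distinct so that roots adjoined for one index cannot make a recorded
  \<open>v(s)\<close> divisible by the prime of another. At each stage of the chain the value groups
  are discrete, so \<open>s\<close> can have least positive value, and then
  \<open>v(x) \<le> - v(s)\<close> holds wherever \<open>x\<close> has a pole.\<close>

locale valuation = field R for R (structure) +
  fixes v :: "'a \<Rightarrow> real"
  assumes v_mult: "\<lbrakk>x \<in> carrier R; y \<in> carrier R; x \<noteq> \<zero>; y \<noteq> \<zero>\<rbrakk> \<Longrightarrow> v (x \<otimes> y) = v x + v y"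
    and v_add: "\<lbrakk>x \<in> carrier R; y \<in> carrier R; x \<noteq> \<zero>; y \<noteq> \<zero>; x \<oplus> y \<noteq> \<zero>\<rbrakk>
      \<Longrightarrow> min (v x) (v y) \<le> v (x \<oplus> y)"
begin

lemma v_one: "v \<one> = 0"
  using v_mult[of \<one> \<one>] by simp

lemma v_minus_one: "v (\<ominus> \<one>) = 0"
proof -
  have "\<ominus> \<one> \<noteq> \<zero>" using add.inv_eq_1_iff by fastforce
  moreover have "\<ominus> \<one> \<otimes> \<ominus> \<one> = \<one>" by (simp add: l_minus r_minus)
  ultimately show ?thesis using v_mult[of "\<ominus> \<one>" "\<ominus> \<one>"] v_one by simp
qed

lemma v_minus:
  assumes "x \<in> carrier R" "x \<noteq> \<zero>"
  shows "v (\<ominus> x) = v x"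
proof -
  have "\<ominus> \<one> \<noteq> \<zero>" using add.inv_eq_1_iff by fastforce
  moreover have "\<ominus> x = \<ominus> \<one> \<otimes> x" using assms by (simp add: l_minus)
  ultimately show ?thesis using v_mult[of "\<ominus> \<one>" x] v_minus_one assms by simp
qed

lemma v_inv:
  assumes "x \<in> carrier R" "x \<noteq> \<zero>"
  shows "v (inv x) = - v x"
  using v_mult[of x "inv x"] assms v_one nonzero_imp_inverse_nonzero by simp

lemma v_pow:
  assumes "x \<in> carrier R" "x \<noteq> \<zero>"
  shows "v (x [^] (n::nat)) = n * v x"
  using assms by (induction n) (auto simp: v_one v_mult algebra_simps)

text \<open>The case \<open>y = \<zero>\<close> is listed separately because \<open>v\<close> says
  nothing about zero.\<close>

lemma v_add_eq:
  assumes "x \<in> carrier R" "x \<noteq> \<zero>" "y \<in> carrier R" "y = \<zero> \<or> v x < v y"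
  shows "x \<oplus> y \<noteq> \<zero>" "v (x \<oplus> y) = v x"
proof -
  show nz: "x \<oplus> y \<noteq> \<zero>"
  proof
    assume "x \<oplus> y = \<zero>"
    hence "y = \<ominus> x" using assms by (metis minus_equality add.m_comm)
    thus False using assms v_minus[of x] by auto
  qed
  show "v (x \<oplus> y) = v x"
  proof (cases "y = \<zero>")
    case False
    hence lt: "v x < v y" using assms by simp
    have a: "v x \<le> v (x \<oplus> y)" using v_add[of x y] nz assms False lt by auto
    have ny: "\<ominus> y \<noteq> \<zero>" using False assms add.inv_eq_1_iff by fastforce
    have "(x \<oplus> y) \<oplus> \<ominus> y = x" using assms by algebra
    hence "min (v (x \<oplus> y)) (v (\<ominus> y)) \<le> v x" using v_add[of "x \<oplus> y" "\<ominus> y"] nz assms ny by auto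
    thus ?thesis using a lt v_minus[of y] assms False by auto
  qed (use assms in simp)
qed

text \<open>\<open>v\<close> is unconstrained at zero, so zero is added by hand.
  \<open>vge 0\<close> is the valuation ring and \<open>vgt 0\<close> its maximal ideal.\<close>

definition vge :: "real \<Rightarrow> 'a set" where
  "vge B = {x \<in> carrier R. x = \<zero> \<or> B \<le> v x}"

definition vgt :: "real \<Rightarrow> 'a set" where
  "vgt B = {x \<in> carrier R. x = \<zero> \<or> B < v x}"

lemma vge_carrier: "x \<in> vge B \<Longrightarrow> x \<in> carrier R" by (simp add: vge_def)
lemma vge_mono: "x \<in> vge B \<Longrightarrow> C \<le> B \<Longrightarrow> x \<in> vge C" by (auto simp: vge_def)
lemma vge_vgt: "x \<in> vge B \<Longrightarrow> C < B \<Longrightarrow> x \<in> vgt C" by (auto simp: vge_def vgt_def)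
lemma zero_vge: "\<zero> \<in> vge B" "\<zero> \<in> vgt B" by (auto simp: vge_def vgt_def)

lemma vge_add: "x \<in> vge B \<Longrightarrow> y \<in> vge B \<Longrightarrow> x \<oplus> y \<in> vge B"
  using v_add[of x y] by (fastforce simp: vge_def)

lemma vgt_add: "x \<in> vgt B \<Longrightarrow> y \<in> vgt B \<Longrightarrow> x \<oplus> y \<in> vgt B"
  using v_add[of x y] by (fastforce simp: vgt_def)

lemma vge_minus: "x \<in> vge B \<Longrightarrow> \<ominus> x \<in> vge B"
  using v_minus[of x] by (cases "x = \<zero>") (auto simp: vge_def)

lemma vgt_minus: "x \<in> vgt B \<Longrightarrow> \<ominus> x \<in> vgt B"
  using v_minus[of x] by (cases "x = \<zero>") (auto simp: vgt_def)

lemma vge_mult: "x \<in> vge B \<Longrightarrow> y \<in> vge C \<Longrightarrow> x \<otimes> y \<in> vge (B + C)"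
  using v_mult[of x y] by (cases "x = \<zero> \<or> y = \<zero>") (auto simp: vge_def)

lemma vgt_mult: "x \<in> vgt B \<Longrightarrow> y \<in> vge C \<Longrightarrow> x \<otimes> y \<in> vgt (B + C)"
  using v_mult[of x y] by (cases "x = \<zero> \<or> y = \<zero>") (auto simp: vge_def vgt_def)

lemma vgt0_mult: "x \<in> vgt 0 \<Longrightarrow> y \<in> vge 0 \<Longrightarrow> x \<otimes> y \<in> vgt 0"
  using vgt_mult[of x 0 y 0] by simp

lemma vge0_mult: "x \<in> vge 0 \<Longrightarrow> y \<in> vge 0 \<Longrightarrow> x \<otimes> y \<in> vge 0"
  using vge_mult[of x 0 y 0] by simp

lemma one_vge: "\<one> \<in> vge 0" "\<one> \<notin> vgt 0"
  by (auto simp: vge_def vgt_def v_one)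

lemma vge_subring: "subring (vge 0) R"
  by (rule subringI) (auto simp: vge_carrier one_vge vge_minus vge_add vge0_mult)

text \<open>By the last hypothesis nonzero terms of different degree have different values, so the
  term of least value prevails; the induction adds the leading term to a sum that already has the
  value of one of its own terms. This serves both for radicals whose value is new and for elements
  algebraic over a field of constants.\<close>

lemma eval_no_cancellation:
  assumes K: "K \<subseteq> carrier R" and z: "z \<in> carrier R" "z \<noteq> \<zero>"
    and "set p \<subseteq> K" "\<exists>a\<in>set p. a \<noteq> \<zero>"
    and "\<And>a b i j. \<lbrakk>a \<in> K; b \<in> K; a \<noteq> \<zero>; b \<noteq> \<zero>; i < j; j < length p\<rbrakk>
        \<Longrightarrow> v a + real i * v z \<noteq> v b + real j * v z"
  shows "eval p z \<noteq> \<zero> \<and> (\<exists>a\<in>K. a \<noteq> \<zero> \<and> (\<exists>i<length p. v (eval p z) = v a + real i * v z))"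
  using assms(4-)
proof (induction p)
  case (Cons a p)
  have a: "a \<in> K" "a \<in> carrier R" and p: "set p \<subseteq> K" "set p \<subseteq> carrier R" using Cons.prems K by auto
  have ev: "eval (a # p) z = a \<otimes> z [^] length p \<oplus> eval p z" by simp
  have evc: "eval p z \<in> carrier R" using eval_in_carrier p z by blast
  show ?case
  proof (cases "\<exists>b\<in>set p. b \<noteq> \<zero>")
    case False
    have "eval p z = \<zero>" using False z by (induction p) auto
    moreover have "a \<noteq> \<zero>" using False Cons.prems by auto
    ultimately have "eval (a # p) z = a \<otimes> z [^] length p" using ev a z by simp
    moreover have "v (a \<otimes> z [^] length p) = v a + real (length p) * v z"
      using v_mult[of a "z [^] length p"] v_pow a \<open>a \<noteq> \<zero>\<close> z by simp
    moreover have "a \<otimes> z [^] length p \<noteq> \<zero>" using a z \<open>a \<noteq> \<zero>\<close> by (simp add: integral_iff)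
    ultimately show ?thesis using a \<open>a \<noteq> \<zero>\<close> by auto
  next
    case True
    from Cons.IH[OF p(1) True] Cons.prems(3)
    obtain b i where b: "eval p z \<noteq> \<zero>" "b \<in> K" "b \<noteq> \<zero>" "i < length p"
      "v (eval p z) = v b + real i * v z" by force
    show ?thesis
    proof (cases "a = \<zero>")
      case True
      hence "eval (a # p) z = eval p z" using ev z evc by simp
      thus ?thesis using b by (metis length_Cons less_SucI)
    next
      case False
      have va: "v (a \<otimes> z [^] length p) = v a + real (length p) * v z"
        using v_mult[of a "z [^] length p"] v_pow a \<open>a \<noteq> \<zero>\<close> z by simp
      have nz: "a \<otimes> z [^] length p \<noteq> \<zero>" using a z \<open>a \<noteq> \<zero>\<close> by (simp add: integral_iff)
      have "v b + real i * v z \<noteq> v a + real (length p) * v z"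
        using Cons.prems(3)[of b a i "length p"] b a False by simp
      then consider "v (a \<otimes> z [^] length p) < v (eval p z)" | "v (eval p z) < v (a \<otimes> z [^] length p)"
        using va b by linarith
      thus ?thesis
      proof cases
        case 1
        thus ?thesis using v_add_eq[OF _ nz evc] a z ev va a False by (metis length_Cons lessI m_closed nat_pow_closed)
      next
        case 2
        have "eval (a # p) z = eval p z \<oplus> a \<otimes> z [^] length p" using ev evc a z by (simp add: add.m_comm)
        thus ?thesis using v_add_eq[OF evc b(1) _] 2 a z b by (metis length_Cons less_SucI m_closed nat_pow_closed)
      qed
    qed
  qed
qed simp

end

section \<open>First-order expansions and contents of polynomials\<close>

lemma (in cring) eval_taylor:
  assumes S: "subring S R" and "set p \<subseteq> S" and y: "y \<in> S" and h: "h \<in> S"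
  shows "\<exists>c\<in>S. eval p (y \<oplus> h) = eval p y \<oplus> h \<otimes> c"
  using assms(2)
proof (induction p)
  case Nil
  show ?case using subringE(1,2)[OF S] h by (intro bexI[of _ \<zero>]) auto
next
  case (Cons a p)
  note Sc = subringE(1)[OF S] note Sr = subringE(2,3,6,7)[OF S]
  have yc: "y \<in> carrier R" "h \<in> carrier R" using Sc y h by auto
  have pow: "\<exists>c\<in>S. (y \<oplus> h) [^] n = y [^] n \<oplus> h \<otimes> c" for n :: nat
  proof (induction n)
    case 0 show ?case using Sr yc by (intro bexI[of _ \<zero>]) auto
  next
    case (Suc n)
    then obtain c where c: "c \<in> S" "(y \<oplus> h) [^] n = y [^] n \<oplus> h \<otimes> c" by blast
    have yn: "y [^] n \<in> S" by (induction n) (use Sr y in auto)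
    have "(y \<oplus> h) [^] Suc n = (y [^] n \<oplus> h \<otimes> c) \<otimes> (y \<oplus> h)" using c by simp
    also have "\<dots> = y [^] n \<otimes> y \<oplus> h \<otimes> (y [^] n \<oplus> c \<otimes> y \<oplus> h \<otimes> c)"
      using yn c Sc yc by (subst (asm) subset_iff) algebra
    finally show ?case using yn c y h Sr by (intro bexI[of _ "y [^] n \<oplus> c \<otimes> y \<oplus> h \<otimes> c"]) auto
  qed
  from Cons obtain c where c: "c \<in> S" "eval p (y \<oplus> h) = eval p y \<oplus> h \<otimes> c" by auto
  obtain d where d: "d \<in> S" "(y \<oplus> h) [^] length p = y [^] length p \<oplus> h \<otimes> d" using pow by blast
  have a: "a \<in> S" "set p \<subseteq> S" using Cons.prems by auto
  have car: "a \<in> carrier R" "c \<in> carrier R" "d \<in> carrier R" "eval p y \<in> carrier R" "y [^] length p \<in> carrier R"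
    using a c d Sc yc eval_in_carrier[of p y] by auto
  have "eval (a # p) (y \<oplus> h) = eval (a # p) y \<oplus> h \<otimes> (a \<otimes> d \<oplus> c)"
    using car yc c d by (simp, algebra)
  thus ?case using a c d Sr by (intro bexI[of _ "a \<otimes> d \<oplus> c"]) auto
qed

context cring begin

lemma cancel_right_neg: "a \<in> carrier R \<Longrightarrow> b \<in> carrier R \<Longrightarrow> (a \<oplus> b) \<oplus> \<ominus> a = b"
  by algebra

lemma add_pow_nat_Suc: "a \<in> carrier R \<Longrightarrow> [Suc n] \<cdot> a = [n] \<cdot> a \<oplus> a"
  by (rule add.nat_pow_Suc)

lemma subring_nat_mult: "subring S R \<Longrightarrow> [(n::nat)] \<cdot> \<one> \<in> S"
proof (induction n)
  case 0 show ?case using subringE(2)[OF 0] by simp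
next
  case (Suc n) show ?case
    unfolding add_pow_nat_Suc[OF one_closed]
    using subringE(7)[OF Suc(2) Suc(1)[OF Suc(2)] subringE(3)[OF Suc(2)]] .
qed

lemma subring_pow: "subring S R \<Longrightarrow> x \<in> S \<Longrightarrow> x [^] (n::nat) \<in> S"
proof (induction n)
  case 0 show ?case using subringE(3)[OF 0(1)] unfolding nat_pow_0 .
next
  case (Suc n) show ?case unfolding nat_pow_Suc using subringE(6)[OF Suc(2) Suc(1)[OF Suc(2,3)] Suc(3)] .
qed

text \<open>Unlike in \<open>eval_taylor\<close> the linear coefficient has to be explicit: it is
  the derivative of the power, and its being a unit is what separability contributes later.\<close>

lemma pow_taylor2:
  assumes S: "subring S R" and y: "y \<in> S" and h: "h \<in> S"
  shows "\<exists>d\<in>S. (y \<oplus> h) [^] Suc n = y [^] Suc n \<oplus> h \<otimes> ([Suc n] \<cdot> \<one> \<otimes> y [^] n \<oplus> h \<otimes> d)"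
proof (induction n)
  case 0
  have "y \<in> carrier R" "h \<in> carrier R" using subringE(1)[OF S] y h by auto
  hence "(y \<oplus> h) [^] Suc 0 = y [^] Suc 0 \<oplus> h \<otimes> ([Suc 0] \<cdot> \<one> \<otimes> y [^] (0::nat) \<oplus> h \<otimes> \<zero>)" by simp
  thus ?case using subringE(2)[OF S] by (rule bexI)
next
  case (Suc n)
  then obtain d where d: "d \<in> S"
    "(y \<oplus> h) [^] Suc n = y [^] Suc n \<oplus> h \<otimes> ([Suc n] \<cdot> \<one> \<otimes> y [^] n \<oplus> h \<otimes> d)" by (rule bexE)
  define Y Q where "Y = y [^] n" and "Q = [Suc n] \<cdot> \<one>"
  have YQ: "Y \<in> S" "Q \<in> S" unfolding Y_def Q_def by (rule subring_pow[OF S y], rule subring_nat_mult[OF S])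
  have car: "Y \<in> carrier R" "Q \<in> carrier R" "d \<in> carrier R" "y \<in> carrier R" "h \<in> carrier R"
    using YQ d(1) y h subringE(1)[OF S] by auto
  let ?e = "Q \<otimes> Y \<oplus> d \<otimes> y \<oplus> h \<otimes> d"
  have "(y \<oplus> h) [^] Suc (Suc n) = (Y \<otimes> y \<oplus> h \<otimes> (Q \<otimes> Y \<oplus> h \<otimes> d)) \<otimes> (y \<oplus> h)"
    unfolding nat_pow_Suc[of _ "Suc n"] d(2) unfolding Y_def Q_def nat_pow_Suc[of y n] by (rule refl)
  also have "\<dots> = Y \<otimes> y \<otimes> y \<oplus> h \<otimes> ((Q \<oplus> \<one>) \<otimes> (Y \<otimes> y) \<oplus> h \<otimes> ?e)"
    using car by algebra
  also have "\<dots> = y [^] Suc (Suc n) \<oplus> h \<otimes> ([Suc (Suc n)] \<cdot> \<one> \<otimes> y [^] Suc n \<oplus> h \<otimes> ?e)"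
    unfolding Y_def Q_def nat_pow_Suc add_pow_nat_Suc[OF one_closed, of "Suc n"] by (rule refl)
  finally have "(y \<oplus> h) [^] Suc (Suc n) = y [^] Suc (Suc n) \<oplus> h \<otimes> ([Suc (Suc n)] \<cdot> \<one> \<otimes> y [^] Suc n \<oplus> h \<otimes> ?e)" .
  moreover have "?e \<in> S" by (intro subringE(6,7)[OF S] YQ d(1) y h)
  ultimately show ?case by (rule bexI)
qed

end

lemma (in ring) eval_smult:
  assumes "set p \<subseteq> carrier R" "c \<in> carrier R" "x \<in> carrier R"
  shows "eval (map (\<lambda>a. c \<otimes> a) p) x = c \<otimes> eval p x"
  using assms(1)
proof (induction p)
  case (Cons a p)
  thus ?case using assms eval_in_carrier[of p x] by (simp add: r_distr m_assoc)
qed (use assms in simp)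

lemma (in ring) eval_all_zero: "\<forall>a\<in>set p. a = \<zero> \<Longrightarrow> x \<in> carrier R \<Longrightarrow> eval p x = \<zero>"
  by (induction p) auto

context valuation begin

text \<open>Division by a coefficient \<open>c\<close> of least value, the content as in Gauss's
  lemma. That 1 remains among the coefficients makes \<open>p'\<close> primitive, and
  \<open>c \<in> set p\<close> lets bounds on the coefficients of \<open>p\<close> pass to
  \<open>c\<close>.\<close>

lemma factor_min_value:
  assumes K: "subfield K R" and p: "set p \<subseteq> K" and nz: "\<exists>a\<in>set p. a \<noteq> \<zero>"
  obtains c p' where "c \<in> K" "c \<noteq> \<zero>" "c \<in> set p" "set p' \<subseteq> K \<inter> vge 0" "length p' = length p"
    "\<one> \<in> set p'" "\<And>x. x \<in> carrier R \<Longrightarrow> eval p x = c \<otimes> eval p' x"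
proof -
  note Kc = subfieldE(3)[OF K]
  have fin: "finite (set p - {\<zero>})" "set p - {\<zero>} \<noteq> {}" using nz by auto
  define c where "c = arg_min_on v (set p - {\<zero>})"
  have c: "c \<in> set p" "c \<noteq> \<zero>" using arg_min_if_finite(1)[OF fin, of v] c_def by auto
  have cmin: "v c \<le> v a" if "a \<in> set p" "a \<noteq> \<zero>" for a
    using arg_min_least[OF fin, of a v] that c_def by auto
  have cK: "c \<in> K" "c \<in> carrier R" using c p Kc by auto
  have ic: "inv c \<in> K" "inv c \<in> carrier R" using subfield_m_inv(1)[OF K, of c] cK c Kc by auto
  define p' where "p' = map (\<lambda>a. inv c \<otimes> a) p"
  have pc: "set p \<subseteq> carrier R" using p Kc by auto
  have ev: "eval p x = c \<otimes> eval p' x" if x: "x \<in> carrier R" for x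
  proof -
    have "c \<otimes> (inv c \<otimes> e) = e" if "e \<in> carrier R" for e
      unfolding m_assoc[OF cK(2) ic(2) that, symmetric] using that cK(2) c(2) by simp
    thus ?thesis using eval_smult[OF pc ic(2) x] eval_in_carrier[OF pc x] unfolding p'_def by metis
  qed
  have sub: "set p' \<subseteq> K \<inter> vge 0"
  proof
    fix b assume "b \<in> set p'"
    then obtain a where a: "a \<in> set p" "b = inv c \<otimes> a" unfolding p'_def by auto
    have ac: "a \<in> K" "a \<in> carrier R" using a p Kc by auto
    have bK: "b \<in> K" unfolding a(2) using subringE(6)[OF subfieldE(1)[OF K] ic(1) ac(1)] .
    have "b \<in> vge 0"
    proof (cases "a = \<zero>")
      case True thus ?thesis using a(2) ic(2) zero_vge(1) by simp
    next
      case False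
      have "v b = v a - v c"
        using v_mult[OF ic(2) ac(2) nonzero_imp_inverse_nonzero[OF cK(2) c(2)] False] v_inv[OF cK(2) c(2)] a(2) by simp
      thus ?thesis using cmin[OF a(1) False] bK Kc unfolding vge_def by auto
    qed
    thus "b \<in> K \<inter> vge 0" using bK by simp
  qed
  have one: "\<one> \<in> set p'" unfolding p'_def set_map
    using image_eqI[OF _ c(1), of \<one> "\<lambda>a. inv c \<otimes> a"] l_inv[OF cK(2) c(2)] by simp
  show ?thesis by (rule that[OF cK(1) c(2,1) sub _ one ev]) (simp_all add: p'_def)
qed

end

section \<open>Value groups of radical extensions\<close>

text \<open>The normalised situation: both the radical \<open>y\<close> and the exponent
  \<open>q\<close> are units at \<open>v\<close>, so no ramification is expected. A nontrivial value
  group on \<open>K\<close> supplies a small increment \<open>h\<close>, in powers of which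
  polynomials in \<open>y + h\<close> are expanded.\<close>

locale unramified = valuation +
  fixes K y q
  assumes K: "subfield K R" and y: "y \<in> carrier R" "y \<noteq> \<zero>" "v y = 0"
    and q: "0 < q" "[q] \<cdot> \<one> \<noteq> \<zero>" "v ([q] \<cdot> \<one>) = 0" and yq: "y [^] (q::nat) \<in> K"
    and nontriv: "\<exists>h\<in>K. h \<noteq> \<zero> \<and> v h \<noteq> 0"
begin

text \<open>\<open>A\<close> is the valuation ring of \<open>K\<close>. The ring
  \<open>S = A[y]\<close> lies in the valuation ring of \<open>v\<close> but need not contain every
  integral element of \<open>K(y)\<close>; values are computed on \<open>S\<close> first, and
  denominators are dealt with afterwards.\<close>

definition "A = K \<inter> vge 0"
definition "S = simple_extension A y"

lemma Kc: "K \<subseteq> carrier R" and Kr: "subring K R" using subfieldE[OF K] by auto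
lemma A_subring: "subring A R" using subring_inter[OF Kr vge_subring] unfolding A_def .
lemma Ac: "A \<subseteq> carrier R" using subringE(1)[OF A_subring] .
lemma S_subring: "subring S R" using simple_extension_is_subring[OF A_subring y(1)] unfolding S_def .
lemma Sc: "S \<subseteq> carrier R" using subringE(1)[OF S_subring] .
lemma y_vge: "y \<in> vge 0" using y by (simp add: vge_def)
lemma A_S: "A \<subseteq> S" using simple_extension_incl[OF Ac y(1)] unfolding S_def .
lemma y_S: "y \<in> S" using simple_extension_mem[OF A_subring y(1)] unfolding S_def .
lemma A_K: "a \<in> A \<Longrightarrow> a \<in> K" and A_vge: "a \<in> A \<Longrightarrow> a \<in> vge 0" and A_c: "a \<in> A \<Longrightarrow> a \<in> carrier R"
  using Kc by (auto simp: A_def)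
lemma S_vge: "S \<subseteq> vge 0" using simple_extension_subring_incl[OF vge_subring _ y_vge, of A] unfolding S_def A_def by auto

lemma inv_A: "a \<in> K \<Longrightarrow> a \<noteq> \<zero> \<Longrightarrow> v a = 0 \<Longrightarrow> inv a \<in> A"
  using subfield_m_inv(1)[OF K, of a] v_inv[of a] Kc by (auto simp: vge_def A_def)

lemma q_A: "[q] \<cdot> \<one> \<in> A" using subring_nat_mult[OF A_subring] .

lemma S_pow: "x \<in> S \<Longrightarrow> x [^] (n::nat) \<in> S" using subring_pow[OF S_subring] .

lemma eval_S: "set p \<subseteq> A \<Longrightarrow> eval p y \<in> S"
proof (induction p)
  case Nil show ?case using subringE(2)[OF S_subring] by simp
next
  case (Cons a p)
  hence a: "a \<in> S" and p: "eval p y \<in> S" using A_S by auto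
  have "a \<otimes> y [^] length p \<in> S" using subringE(6)[OF S_subring a S_pow[OF y_S]] .
  thus ?case using subringE(7)[OF S_subring _ p] by simp
qed

text \<open>\<open>f\<close> is the degree of the residue of \<open>y\<close> over the residue field of \<open>K\<close>, and \<open>\<phi>\<close> lifts its minimal
  polynomial.\<close>

definition "monic_rel p \<longleftrightarrow> set p \<subseteq> A \<and> y [^] length p \<oplus> eval p y \<in> vgt 0"
definition "f = (LEAST n. \<exists>p. monic_rel p \<and> length p = n)"

text \<open>The polynomial \<open>X^q - y^q\<close> vanishes at \<open>y\<close>, so the minimum
  that defines \<open>f\<close> exists.\<close>

lemma monic_rel_ex: "\<exists>p. monic_rel p \<and> length p = q"
proof -
  obtain n where n: "q = Suc n" using gr0_implies_Suc[OF q(1)] by blast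
  define r where "r = y [^] q"
  have r: "r \<in> carrier R" "v r = 0" "r \<noteq> \<zero>" "r \<in> K" using y v_pow yq unfolding r_def by auto
  let ?p = "replicate n \<zero> @ [\<ominus> r]"
  have "r \<in> vge 0" using r by (simp add: vge_def)
  hence "\<ominus> r \<in> A" using subringE(5)[OF Kr r(4)] vge_minus by (simp add: A_def)
  hence "set ?p \<subseteq> A" using subringE(2)[OF A_subring] by auto
  moreover have "eval ?p y = \<ominus> r"
    using y(1) r(1) by (induction n) auto
  moreover have "length ?p = q" using n by simp
  ultimately have "monic_rel ?p" unfolding monic_rel_def using r
    by (simp only: r_def[symmetric] r_neg zero_vge simp_thms)
  thus ?thesis using \<open>length ?p = q\<close> by blast
qed

lemma phi_ex: "\<exists>p. monic_rel p \<and> length p = f"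
  unfolding f_def using monic_rel_ex by (rule LeastI_ex[OF exI])

lemma f_min: "monic_rel p \<Longrightarrow> f \<le> length p"
  unfolding f_def by (rule Least_le) blast

lemma orthonormal:
  assumes "set p \<subseteq> A" "length p \<le> f" "eval p y \<in> vgt 0"
  shows "set p \<subseteq> vgt 0"
  using assms
proof (induction p)
  case (Cons a p)
  have a: "a \<in> A" "a \<in> carrier R" and p: "set p \<subseteq> A" using Cons.prems Ac by auto
  have ev: "eval p y \<in> carrier R" "y [^] length p \<in> carrier R" using eval_S[OF p] Sc y by auto
  have e: "a \<otimes> y [^] length p \<oplus> eval p y \<in> vgt 0" using Cons.prems by simp
  have aM: "a \<in> vgt 0"
  proof (rule ccontr)
    assume "a \<notin> vgt 0"
    hence a0: "a \<noteq> \<zero>" "v a = 0" using a(2) A_vge[OF a(1)] unfolding vgt_def vge_def by auto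
    have ia: "inv a \<in> A" "inv a \<in> carrier R" using inv_A[OF A_K a0] A_c a(1) by blast+
    have pc: "set p \<subseteq> carrier R" using p Ac by auto
    let ?p = "map (\<lambda>b. inv a \<otimes> b) p"
    have "inv a \<otimes> b \<in> A" if "b \<in> set p" for b using subringE(6)[OF A_subring ia(1), of b] p that by blast
    hence "set ?p \<subseteq> A" unfolding set_map by blast
    moreover have "(a \<otimes> y [^] length p \<oplus> eval p y) \<otimes> inv a = y [^] length p \<oplus> inv a \<otimes> eval p y"
    proof -
      have "(a \<otimes> Y \<oplus> E) \<otimes> inv a = Y \<otimes> (a \<otimes> inv a) \<oplus> inv a \<otimes> E"
        if "Y \<in> carrier R" "E \<in> carrier R" for Y E
        using a ia that by algebra
      from this[OF ev(2,1)] show ?thesis using a a0 ev by simp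
    qed
    moreover have "(a \<otimes> y [^] length p \<oplus> eval p y) \<otimes> inv a \<in> vgt 0"
      using vgt0_mult[OF e A_vge[OF ia(1)]] .
    ultimately have "monic_rel ?p" unfolding monic_rel_def length_map eval_smult[OF pc ia(2) y(1)] by simp
    thus False using f_min[of ?p] Cons.prems by simp
  qed
  have "y [^] length p \<in> vge 0" using y v_pow[OF y(1,2), of "length p"] by (simp add: vge_def)
  from vgt_add[OF e vgt_minus[OF vgt0_mult[OF aM this]]] have "eval p y \<in> vgt 0"
    unfolding cancel_right_neg[OF m_closed[OF a(2) ev(2)] ev(1)] .
  hence "set p \<subseteq> vgt 0" using Cons.IH[OF p] Cons.prems(2) by simp
  thus ?case using aM by simp
qed (simp only: list.set empty_subsetI)

end

lemma (in ring) set_univ_poly: "P \<in> carrier (K[X]) \<Longrightarrow> set P \<subseteq> K"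
  by (auto simp: univ_poly_def polynomial_def)

text \<open>The divisor is monic, so division works over the ring \<open>A\<close>. Comparing values
  at points instead of coefficient lists avoids normal forms; the bound on \<open>length r\<close>
  says that the remainder has smaller degree than the divisor.\<close>

lemma (in domain) eval_monic_division:
  assumes A: "subring A R" and P: "set P \<subseteq> A" and p0: "set p0 \<subseteq> A"
  shows "\<exists>Q r. set Q \<subseteq> A \<and> set r \<subseteq> A \<and> length r \<le> length p0 \<and>
    (\<forall>x\<in>carrier R. eval P x = eval (\<one> # p0) x \<otimes> eval Q x \<oplus> eval r x)"
proof -
  note Ac = subringE(1)[OF A]
  have P': "polynomial A (normalize P)" using normalize_gives_polynomial[OF P] .
  have phi: "polynomial A (\<one> # p0)" using p0 subringE(3)[OF A] by (auto simp: polynomial_def)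
  have "lead_coeff (\<one> # p0) \<in> Units (R\<lparr>carrier := A\<rparr>)"
    using subringE(1,3)[OF A] by (auto simp: Units_def intro!: bexI[of _ \<one>])
  from long_division_theorem[OF A P' phi _ this] obtain Q r where
    Q: "polynomial A Q" "polynomial A r" and eq: "normalize P = (\<one> # p0) \<otimes>\<^bsub>A[X]\<^esub> Q \<oplus>\<^bsub>A[X]\<^esub> r"
    and deg: "r = [] \<or> degree r < degree (\<one> # p0)" by blast
  have sets: "set Q \<subseteq> A" "set r \<subseteq> A" using polynomial_incl Q by blast+
  hence c: "set Q \<subseteq> carrier R" "set r \<subseteq> carrier R" "set (\<one> # p0) \<subseteq> carrier R" "set P \<subseteq> carrier R"
    using Ac p0 P by auto
  have "eval P x = eval (\<one> # p0) x \<otimes> eval Q x \<oplus> eval r x" if x: "x \<in> carrier R" for x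
  proof -
    have "eval P x = eval (normalize P) x" using eval_normalize[OF c(4) x] by simp
    also have "\<dots> = eval (poly_mult (\<one> # p0) Q) x \<oplus> eval r x"
      unfolding eq univ_poly_mult univ_poly_add
      by (rule eval_poly_add[OF poly_mult_in_carrier[OF c(3,1)] c(2) x])
    also have "eval (poly_mult (\<one> # p0) Q) x = eval (\<one> # p0) x \<otimes> eval Q x"
      by (rule eval_poly_mult[OF c(3,1) x])
    finally show ?thesis .
  qed
  moreover have "length r \<le> length p0" using deg by auto
  ultimately show ?thesis using sets by blast
qed

lemma (in ring) eval_pure:
  assumes "r \<in> carrier R" "x \<in> carrier R"
  shows "eval (\<one> # replicate n \<zero> @ [r]) x = x [^] Suc n \<oplus> r"
proof -
  have "eval (replicate n \<zero> @ [r]) x = r" using assms by (induction n) simp_all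
  thus ?thesis using assms by simp
qed

context unramified begin

lemma S_carrier: "s \<in> S \<Longrightarrow> s \<in> carrier R" using Sc by blast
lemma S_vge0: "s \<in> S \<Longrightarrow> s \<in> vge 0" using S_vge by blast
lemmas S_closed = subringE(5-7)[OF S_subring]
lemma A_in_S: "a \<in> A \<Longrightarrow> a \<in> S" using A_S by blast

lemma small_element: "\<exists>h\<in>A. h \<noteq> \<zero> \<and> 0 < v h"
proof -
  obtain h where h: "h \<in> K" "h \<noteq> \<zero>" "v h \<noteq> 0" using nontriv by blast
  have hc: "h \<in> carrier R" using h(1) Kc by blast
  show ?thesis
  proof (cases "0 < v h")
    case True thus ?thesis using h hc by (intro bexI[of _ h]) (auto simp: A_def vge_def)
  next
    case False
    have "inv h \<in> K - {\<zero>}" using subfield_m_inv(1)[OF K, of h] h by simp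
    thus ?thesis using v_inv[OF hc h(2)] False h(3) Kc by (intro bexI[of _ "inv h"]) (auto simp: A_def vge_def)
  qed
qed

text \<open>A quantitative form of Hensel's lemma: separability of \<open>X^q - y^q\<close> forces the value \<open>\<theta>\<close> of the lifted
  minimal polynomial at \<open>y\<close> to be divisible by an element of positive value in \<open>K\<close>, up to higher order.\<close>

lemma improve:
  assumes p0: "monic_rel p0" "length p0 = f" and \<theta>: "\<theta> = y [^] f \<oplus> eval p0 y"
  shows "\<exists>\<mu>\<in>A. \<mu> \<noteq> \<zero> \<and> 0 < v \<mu> \<and> (\<exists>s\<in>S. \<exists>\<kappa>\<in>S. \<kappa> \<in> vgt 0 \<and> \<theta> = \<mu> \<otimes> s \<oplus> \<kappa> \<otimes> \<theta>)"
proof -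
  obtain h where h: "h \<in> A" "h \<noteq> \<zero>" "0 < v h" using small_element by blast
  have p0A: "set p0 \<subseteq> A" using p0 by (simp add: monic_rel_def)
  obtain m where m: "q = Suc m" using gr0_implies_Suc[OF q(1)] by blast
  define r where "r = y [^] q"
  have r: "r \<in> carrier R" "v r = 0" "r \<noteq> \<zero>" "r \<in> K" using y v_pow yq unfolding r_def by auto
  have "r \<in> vge 0" using r by (simp add: vge_def)
  hence rA: "r \<in> A" using r(4) by (simp add: A_def)
  have mr: "\<ominus> r \<in> A" using subringE(5)[OF A_subring rA] .
  have one: "\<one> \<in> A" "\<zero> \<in> A" using subringE(2,3)[OF A_subring] by auto
  have "set (\<one> # replicate m \<zero> @ [\<ominus> r]) \<subseteq> A" using mr one by auto
  from eval_monic_division[OF A_subring this p0A] obtain Q \<rho> where Q: "set Q \<subseteq> A" and \<rho>: "set \<rho> \<subseteq> A" "length \<rho> \<le> f"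
    and div: "\<And>x. x \<in> carrier R \<Longrightarrow> x [^] q \<oplus> \<ominus> r = eval (\<one> # p0) x \<otimes> eval Q x \<oplus> eval \<rho> x"
    using eval_pure[of "\<ominus> r" _ m] r(1) m p0(2) by force
  have \<theta>e: "\<theta> = eval (\<one> # p0) y" using \<theta> p0(2) y by simp
  have \<theta>M: "\<theta> \<in> vgt 0" using p0 \<theta> by (simp add: monic_rel_def)
  have phiA: "set (\<one> # p0) \<subseteq> A" using p0A one by auto
  have \<theta>S: "\<theta> \<in> S" unfolding \<theta>e by (rule eval_S[OF phiA])
  define \<psi> where "\<psi> = eval Q y"
  have \<psi>S: "\<psi> \<in> S" unfolding \<psi>_def by (rule eval_S[OF Q])
  have \<rho>S: "eval \<rho> y \<in> S" by (rule eval_S[OF \<rho>(1)])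
  have rel0: "\<theta> \<otimes> \<psi> \<oplus> eval \<rho> y = \<zero>"
    unfolding \<theta>e \<psi>_def div[OF y(1), symmetric] r_def[symmetric] by (rule r_neg[OF r(1)])
  \<comment> \<open>\<open>\<theta> \<psi>\<close> is small, hence so is the remainder at
    \<open>y\<close>; by its length, orthonormality makes all its coefficients small, and the
    content \<open>\<mu>\<close> gets positive value. If the remainder vanishes, any small element
    serves.\<close>
  have "\<exists>\<mu> \<rho>'. \<mu> \<in> A \<and> \<mu> \<noteq> \<zero> \<and> 0 < v \<mu> \<and> set \<rho>' \<subseteq> A \<and> (\<forall>x\<in>carrier R. eval \<rho> x = \<mu> \<otimes> eval \<rho>' x)"
  proof (cases "\<forall>a\<in>set \<rho>. a = \<zero>")
    case True
    have "eval \<rho> x = h \<otimes> eval [] x" if "x \<in> carrier R" for x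
      using eval_all_zero[OF True that] A_c[OF h(1)] by simp
    thus ?thesis using h by (intro exI[of _ h] exI[of _ "[]"]) auto
  next
    case False
    hence ex: "\<exists>a\<in>set \<rho>. a \<noteq> \<zero>" by blast
    have \<rho>K: "set \<rho> \<subseteq> K" using \<rho>(1) A_K by blast
    obtain \<mu> \<rho>' where \<mu>: "\<mu> \<in> K" "\<mu> \<noteq> \<zero>" "\<mu> \<in> set \<rho>" "set \<rho>' \<subseteq> K \<inter> vge 0"
      "\<And>x. x \<in> carrier R \<Longrightarrow> eval \<rho> x = \<mu> \<otimes> eval \<rho>' x" using factor_min_value[OF K \<rho>K ex] by metis
    have "\<ominus> (\<theta> \<otimes> \<psi>) = eval \<rho> y"
      using rel0 S_carrier[OF \<rho>S] m_closed[OF S_carrier[OF \<theta>S] S_carrier[OF \<psi>S]]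
      by (metis minus_equality add.m_comm)
    moreover have "\<ominus> (\<theta> \<otimes> \<psi>) \<in> vgt 0" by (rule vgt_minus[OF vgt0_mult[OF \<theta>M S_vge0[OF \<psi>S]]])
    ultimately have "eval \<rho> y \<in> vgt 0" by simp
    from orthonormal[OF \<rho>(1,2) this] \<mu>(2,3) have "0 < v \<mu>" by (auto simp: vgt_def)
    moreover have "\<mu> \<in> A" using \<mu>(3) \<rho>(1) by blast
    ultimately show ?thesis using \<mu> unfolding A_def by blast
  qed
  then obtain \<mu> \<rho>' where \<mu>: "\<mu> \<in> A" "\<mu> \<noteq> \<zero>" "0 < v \<mu>" and \<rho>': "set \<rho>' \<subseteq> A"
    and \<rho>eq: "\<And>x. x \<in> carrier R \<Longrightarrow> eval \<rho> x = \<mu> \<otimes> eval \<rho>' x" by blast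
  define \<rho>y where "\<rho>y = eval \<rho>' y"
  have \<rho>yS: "\<rho>y \<in> S" unfolding \<rho>y_def by (rule eval_S[OF \<rho>'])
  have inS: "set (\<one> # p0) \<subseteq> S" "set Q \<subseteq> S" "set \<rho>' \<subseteq> S" using phiA Q \<rho>' A_S by blast+
  have hS: "h \<in> S" using A_in_S[OF h(1)] .
  obtain c1 where c1: "c1 \<in> S" "eval (\<one> # p0) (y \<oplus> h) = \<theta> \<oplus> h \<otimes> c1"
    using eval_taylor[OF S_subring inS(1) y_S hS] unfolding \<theta>e by (rule bexE)
  obtain c2 where c2: "c2 \<in> S" "eval Q (y \<oplus> h) = \<psi> \<oplus> h \<otimes> c2"
    using eval_taylor[OF S_subring inS(2) y_S hS] unfolding \<psi>_def by (rule bexE)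
  obtain c3 where c3: "c3 \<in> S" "eval \<rho>' (y \<oplus> h) = \<rho>y \<oplus> h \<otimes> c3"
    using eval_taylor[OF S_subring inS(3) y_S hS] unfolding \<rho>y_def by (rule bexE)
  define N where "N = [q] \<cdot> \<one> \<otimes> y [^] m"
  obtain d where d: "d \<in> S" "(y \<oplus> h) [^] q = r \<oplus> h \<otimes> (N \<oplus> h \<otimes> d)"
    using pow_taylor2[OF S_subring y_S hS, of m] unfolding N_def r_def m by (rule bexE)
  have NS: "N \<in> S" unfolding N_def by (rule S_closed(2)[OF A_in_S[OF q_A] S_pow[OF y_S]])
  note inSs = \<theta>S \<psi>S \<rho>yS c1(1) c2(1) c3(1) d(1) NS hS A_in_S[OF \<mu>(1)]
  note car = S_carrier[OF \<theta>S] S_carrier[OF \<psi>S] S_carrier[OF \<rho>yS] S_carrier[OF c1(1)] S_carrier[OF c2(1)]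
    S_carrier[OF c3(1)] S_carrier[OF d(1)] S_carrier[OF NS] A_c[OF h(1)] A_c[OF \<mu>(1)]
  have yh: "y \<oplus> h \<in> carrier R" using y(1) A_c[OF h(1)] by simp
  have rel0': "\<theta> \<otimes> \<psi> \<oplus> \<mu> \<otimes> \<rho>y = \<zero>" using rel0 unfolding \<rho>y_def \<rho>eq[OF y(1)] .
  define T where "T = \<theta> \<otimes> c2 \<oplus> \<psi> \<otimes> c1 \<oplus> h \<otimes> c1 \<otimes> c2 \<oplus> \<mu> \<otimes> c3"
  have Tc: "T \<in> carrier R" unfolding T_def using car by simp
  \<comment> \<open>The division identity for \<open>X^q - r\<close> is taken at
    \<open>y + h\<close> and compared with its form at \<open>y\<close>. Cancelling \<open>h\<close>
    leaves a difference quotient, which stands in for the derivative: all terms but \<open>N\<close>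
    and \<open>\<psi> c1\<close> have positive value.\<close>
  have "h \<otimes> (N \<oplus> h \<otimes> d) = (r \<oplus> h \<otimes> (N \<oplus> h \<otimes> d)) \<oplus> \<ominus> r"
    using car r(1) by algebra
  also have "\<dots> = (\<theta> \<oplus> h \<otimes> c1) \<otimes> (\<psi> \<oplus> h \<otimes> c2) \<oplus> \<mu> \<otimes> (\<rho>y \<oplus> h \<otimes> c3)"
    using div[OF yh] \<rho>eq[OF yh] unfolding d(2) c1(2) c2(2) c3(2) by (simp only:)
  also have "\<dots> = (\<theta> \<otimes> \<psi> \<oplus> \<mu> \<otimes> \<rho>y) \<oplus> h \<otimes> T"
    unfolding T_def using car by algebra
  also have "\<dots> = h \<otimes> T" unfolding rel0' using car(9) Tc by simp
  finally have "h \<otimes> (N \<oplus> h \<otimes> d) = h \<otimes> T" .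
  hence NT: "N \<oplus> h \<otimes> d = T" using m_lcancel[OF h(2) car(9) _ Tc] car by simp
  define \<kappa>' where "\<kappa>' = h \<otimes> d \<oplus> \<ominus> (\<theta> \<otimes> c2) \<oplus> \<ominus> (h \<otimes> (c1 \<otimes> c2)) \<oplus> \<ominus> (\<mu> \<otimes> c3)"
  have hM: "h \<in> vgt 0" and \<mu>M: "\<mu> \<in> vgt 0" using h(3) \<mu>(3) car(9,10) by (auto simp: vgt_def)
  have \<kappa>'S: "\<kappa>' \<in> S" unfolding \<kappa>'_def by (intro S_closed inSs)
  have \<kappa>'M: "\<kappa>' \<in> vgt 0" unfolding \<kappa>'_def
    by (intro vgt_add vgt_minus vgt0_mult hM \<theta>M \<mu>M S_vge0 S_closed inSs)
  have "\<psi> \<otimes> c1 = T \<oplus> \<ominus> (\<theta> \<otimes> c2) \<oplus> \<ominus> (h \<otimes> (c1 \<otimes> c2)) \<oplus> \<ominus> (\<mu> \<otimes> c3)"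
    unfolding T_def using car by algebra
  also have "\<dots> = N \<oplus> \<kappa>'" unfolding NT[symmetric] \<kappa>'_def using car by algebra
  finally have \<psi>c1: "\<psi> \<otimes> c1 = N \<oplus> \<kappa>'" .
  define Q0 where "Q0 = [q] \<cdot> \<one>"
  have Q0: "Q0 \<in> carrier R" "Q0 \<noteq> \<zero>" "v Q0 = 0" "Q0 \<in> K" using q(2,3) q_A A_K unfolding Q0_def by auto
  define i where "i = inv (Q0 \<otimes> r)"
  have Q0r: "Q0 \<otimes> r \<in> carrier R" "Q0 \<otimes> r \<noteq> \<zero>" "v (Q0 \<otimes> r) = 0" "Q0 \<otimes> r \<in> K"
    using Q0 r v_mult[of Q0 r] subringE(6)[OF Kr] by (auto simp: integral_iff)
  have iA: "i \<in> A" unfolding i_def by (rule inv_A[OF Q0r(4,2,3)])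
  \<comment> \<open>\<open>e\<close> inverts \<open>N = q y^(q-1)\<close>, because
    \<open>N y = q r\<close> is a unit of \<open>A\<close>.\<close>
  define e where "e = y \<otimes> i"
  have eS: "e \<in> S" unfolding e_def by (rule S_closed(2)[OF y_S A_in_S[OF iA]])
  have ec: "e \<in> carrier R" using S_carrier[OF eS] .
  have "N \<otimes> e = (Q0 \<otimes> (y [^] m \<otimes> y)) \<otimes> i"
    unfolding N_def e_def Q0_def[symmetric] using Q0(1) A_c[OF iA] y(1) nat_pow_closed[OF y(1), of m] by algebra
  also have "y [^] m \<otimes> y = r" unfolding r_def m by simp
  also have "(Q0 \<otimes> r) \<otimes> i = \<one>" unfolding i_def using Q0r by simp
  finally have Ne: "N \<otimes> e = \<one>" .
  define \<alpha> \<kappa> s where "\<alpha> = c1 \<otimes> e" and "\<kappa> = \<ominus> (\<kappa>' \<otimes> e)" and "s = \<ominus> (\<rho>y \<otimes> (c1 \<otimes> e))"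
  have \<kappa>S: "\<kappa> \<in> S" and sS: "s \<in> S" unfolding \<kappa>_def s_def by (intro S_closed \<kappa>'S eS inSs)+
  have \<kappa>M: "\<kappa> \<in> vgt 0" unfolding \<kappa>_def by (rule vgt_minus[OF vgt0_mult[OF \<kappa>'M S_vge0[OF eS]]])
  note car' = car ec S_carrier[OF \<kappa>'S]
  \<comment> \<open>Multiplying the relation between \<open>\<theta> \<psi>\<close> and
    \<open>\<mu>\<close> by \<open>c1 e\<close> turns the cofactor \<open>\<psi>\<close> of
    \<open>\<theta>\<close> into \<open>1 + \<kappa>' e\<close>.\<close>
  have "\<mu> \<otimes> s = \<ominus> ((\<theta> \<otimes> \<psi> \<oplus> \<mu> \<otimes> \<rho>y) \<otimes> (c1 \<otimes> e)) \<oplus> \<theta> \<otimes> ((\<psi> \<otimes> c1) \<otimes> e)"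
    unfolding s_def using car' by algebra
  also have "\<dots> = \<theta> \<otimes> ((N \<oplus> \<kappa>') \<otimes> e)" unfolding rel0' \<psi>c1 using car' by simp
  also have "\<dots> = \<theta> \<otimes> (N \<otimes> e) \<oplus> \<theta> \<otimes> (\<kappa>' \<otimes> e)" using car' by algebra
  finally have "\<mu> \<otimes> s = \<theta> \<oplus> \<theta> \<otimes> (\<kappa>' \<otimes> e)" unfolding Ne using car'(1) by simp
  moreover have "\<theta> = (\<theta> \<oplus> \<theta> \<otimes> (\<kappa>' \<otimes> e)) \<oplus> \<kappa> \<otimes> \<theta>" unfolding \<kappa>_def using car' by algebra
  ultimately have "\<theta> = \<mu> \<otimes> s \<oplus> \<kappa> \<otimes> \<theta>" by (simp only:)
  thus ?thesis using \<mu> sS \<kappa>S \<kappa>M by blast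
qed

text \<open>The relation is substituted into its own last term. This replaces division by
  \<open>1 - \<kappa>\<close>, whose inverse need not lie in \<open>S\<close>; for
  \<open>\<kappa>\<close> of positive value the error becomes arbitrarily small.\<close>

lemma approx:
  assumes "\<mu> \<in> A" "s \<in> S" "\<kappa> \<in> S" "\<theta> \<in> S" and eq: "\<theta> = \<mu> \<otimes> s \<oplus> \<kappa> \<otimes> \<theta>"
  shows "\<exists>s'\<in>S. \<theta> = \<mu> \<otimes> s' \<oplus> \<kappa> [^] (N::nat) \<otimes> \<theta>"
proof (induction N)
  case 0
  have "\<theta> = \<mu> \<otimes> \<zero> \<oplus> \<kappa> [^] (0::nat) \<otimes> \<theta>"
    using A_c[OF assms(1)] S_carrier[OF assms(3)] S_carrier[OF assms(4)] by simp
  thus ?case using subringE(2)[OF S_subring] by (rule bexI)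
next
  case (Suc N)
  then obtain s' where s': "s' \<in> S" "\<theta> = \<mu> \<otimes> s' \<oplus> \<kappa> [^] N \<otimes> \<theta>" by (rule bexE)
  have kN: "\<kappa> [^] N \<in> S" using S_pow[OF assms(3)] .
  have car: "\<mu> \<in> carrier R" "s \<in> carrier R" "\<kappa> \<in> carrier R" "\<theta> \<in> carrier R" "s' \<in> carrier R" "\<kappa> [^] N \<in> carrier R"
    using A_c assms S_carrier s' kN by blast+
  have "\<kappa> [^] N \<otimes> \<theta> = \<kappa> [^] N \<otimes> (\<mu> \<otimes> s \<oplus> \<kappa> \<otimes> \<theta>)" using eq by (rule arg_cong)
  also have "\<dots> = \<mu> \<otimes> (\<kappa> [^] N \<otimes> s) \<oplus> (\<kappa> [^] N \<otimes> \<kappa>) \<otimes> \<theta>"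
    using car by algebra
  finally have e2: "\<kappa> [^] N \<otimes> \<theta> = \<mu> \<otimes> (\<kappa> [^] N \<otimes> s) \<oplus> \<kappa> [^] Suc N \<otimes> \<theta>" by simp
  have "\<theta> = \<mu> \<otimes> s' \<oplus> (\<mu> \<otimes> (\<kappa> [^] N \<otimes> s) \<oplus> \<kappa> [^] Suc N \<otimes> \<theta>)" using s'(2) unfolding e2 .
  also have "\<dots> = \<mu> \<otimes> (s' \<oplus> \<kappa> [^] N \<otimes> s) \<oplus> \<kappa> [^] Suc N \<otimes> \<theta>"
    using car nat_pow_closed[OF car(3), of "Suc N"] by algebra
  finally show ?case using S_closed(3)[OF s'(1) S_closed(2)[OF kN assms(2)]] by (rule bexI)
qed

text \<open>Division by the lifted minimal polynomial leaves a remainder of degree below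
  \<open>f\<close> and a multiple of \<open>\<theta>\<close>. The latter is a multiple of
  \<open>\<mu>\<close> up to a negligible error, and recursion on the cofactor of
  \<open>\<mu>\<close> gains \<open>v \<mu>\<close> each time.\<close>

lemma eval_diff_dense:
  assumes "z \<in> S"
  shows "\<exists>p. set p \<subseteq> A \<and> length p \<le> f \<and> z \<oplus> \<ominus> eval p y \<in> vge B"
proof -
  obtain p0 where p0: "monic_rel p0" "length p0 = f" using phi_ex by blast
  define \<theta> where "\<theta> = y [^] f \<oplus> eval p0 y"
  obtain \<mu> s \<kappa> where \<mu>: "\<mu> \<in> A" "\<mu> \<noteq> \<zero>" "0 < v \<mu>" and s: "s \<in> S" "\<kappa> \<in> S" "\<kappa> \<in> vgt 0"
    and eq: "\<theta> = \<mu> \<otimes> s \<oplus> \<kappa> \<otimes> \<theta>" using improve[OF p0 \<theta>_def] by blast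
  have p0A: "set p0 \<subseteq> A" using p0 by (simp add: monic_rel_def)
  have \<theta>S: "\<theta> \<in> S" unfolding \<theta>_def by (rule S_closed(3)[OF S_pow[OF y_S] eval_S[OF p0A]])
  have \<theta>e: "\<theta> = eval (\<one> # p0) y" using \<theta>_def p0(2) y by simp
  have \<mu>c: "\<mu> \<in> carrier R" using A_c[OF \<mu>(1)] .
  have tail: "\<exists>s'\<in>S. \<exists>e. e \<in> vge B \<and> \<theta> = \<mu> \<otimes> s' \<oplus> e" for B
  proof (cases "\<kappa> = \<zero>")
    case True
    have "\<theta> = \<mu> \<otimes> s \<oplus> \<zero>" using eq True S_carrier[OF \<theta>S] by simp
    thus ?thesis using s(1) zero_vge by blast
  next
    case False
    have k: "\<kappa> \<in> carrier R" "0 < v \<kappa>" using s(3) False by (auto simp: vgt_def)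
    obtain N :: nat where N: "B < real N * v \<kappa>" using reals_Archimedean3[OF k(2)] by blast
    obtain s' where s': "s' \<in> S" "\<theta> = \<mu> \<otimes> s' \<oplus> \<kappa> [^] N \<otimes> \<theta>"
      using approx[OF \<mu>(1) s(1,2) \<theta>S eq] by (rule bexE)
    have "\<kappa> [^] N \<in> vge B" using v_pow[OF k(1) False] N k by (simp add: vge_def)
    hence "\<kappa> [^] N \<otimes> \<theta> \<in> vge B" using vge_mult[OF _ S_vge0[OF \<theta>S], of _ B] by simp
    thus ?thesis using s' by blast
  qed
  have main: "\<exists>p. set p \<subseteq> A \<and> length p \<le> f \<and> z \<oplus> \<ominus> eval p y \<in> vge (real n * v \<mu>)" if "z \<in> S" for n z
    using that
  proof (induction n arbitrary: z)
    case 0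
    have "z \<oplus> \<ominus> eval [] y \<in> vge 0" using S_vge0[OF 0] S_carrier[OF 0] by simp
    thus ?case by (intro exI[of _ "[]"]) simp
  next
    case (Suc n)
    obtain P where P: "P \<in> carrier (A[X])" "z = eval P y"
      using Suc.prems unfolding S_def simple_extension_as_eval_img[OF Ac y(1)] by blast
    have "set P \<subseteq> A" using set_univ_poly[OF P(1)] .
    from eval_monic_division[OF A_subring this p0A] obtain Q r where Q: "set Q \<subseteq> A" "set r \<subseteq> A" "length r \<le> length p0"
      and div: "\<forall>x\<in>carrier R. eval P x = eval (\<one> # p0) x \<otimes> eval Q x \<oplus> eval r x" by (elim exE conjE)
    have z: "z = \<theta> \<otimes> eval Q y \<oplus> eval r y" unfolding P(2) \<theta>e by (rule bspec[OF div y(1)])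
    define z1 where "z1 = eval Q y"
    define w0 where "w0 = eval r y"
    have z1: "z1 \<in> S" unfolding z1_def by (rule eval_S[OF Q(1)])
    have w0: "w0 \<in> S" unfolding w0_def by (rule eval_S[OF Q(2)])
    obtain s' e where s': "s' \<in> S" and e: "e \<in> vge (real (Suc n) * v \<mu>)" "\<theta> = \<mu> \<otimes> s' \<oplus> e" using tail by blast
    \<comment> \<open>\<open>\<theta> z1 = \<mu> s' z1 + e z1\<close>, where \<open>s' z1\<close> is
      again in \<open>S\<close> and so falls under the induction hypothesis.\<close>
    obtain p where p: "set p \<subseteq> A" "length p \<le> f" "s' \<otimes> z1 \<oplus> \<ominus> eval p y \<in> vge (real n * v \<mu>)"
      using Suc.IH[OF S_closed(2)[OF s' z1]] by blast
    define p' where "p' = map (\<lambda>a. \<mu> \<otimes> a) p"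
    have pc: "set p \<subseteq> carrier R" "set r \<subseteq> carrier R" using p(1) Q(2) A_c by blast+
    have p'A: "set p' \<subseteq> A" unfolding p'_def set_map using p(1) subringE(6)[OF A_subring \<mu>(1)] by blast
    have p'c: "set p' \<subseteq> carrier R" using p'A A_c by blast
    have ep': "eval p' y = \<mu> \<otimes> eval p y" unfolding p'_def by (rule eval_smult[OF pc(1) \<mu>c y(1)])
    define g where "g = poly_add r p'"
    have gA: "set g \<subseteq> A" unfolding g_def
      by (rule polynomial_incl[OF poly_add_is_polynomial[OF A_subring Q(2) p'A]])
    have gl: "length g \<le> f" using poly_add_length_le[of r p'] Q(3) p(2) p0(2) unfolding g_def p'_def by simp
    have ge: "eval g y = w0 \<oplus> \<mu> \<otimes> eval p y"
      unfolding g_def w0_def ep'[symmetric] by (rule eval_poly_add[OF pc(2) p'c y(1)])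
    define t where "t = eval p y"
    have tS: "t \<in> S" unfolding t_def by (rule eval_S[OF p(1)])
    note car = S_carrier[OF z1] S_carrier[OF w0] S_carrier[OF s'] vge_carrier[OF e(1)] \<mu>c S_carrier[OF tS]
    have "z \<oplus> \<ominus> eval g y = (\<mu> \<otimes> s' \<oplus> e) \<otimes> z1 \<oplus> w0 \<oplus> \<ominus> (w0 \<oplus> \<mu> \<otimes> t)"
      unfolding z ge e(2) z1_def[symmetric] w0_def[symmetric] t_def[symmetric] by (rule refl)
    also have "\<dots> = \<mu> \<otimes> (s' \<otimes> z1 \<oplus> \<ominus> t) \<oplus> e \<otimes> z1" using car by algebra
    finally have zg: "z \<oplus> \<ominus> eval g y = \<mu> \<otimes> (s' \<otimes> z1 \<oplus> \<ominus> t) \<oplus> e \<otimes> z1" .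
    have "\<mu> \<in> vge (v \<mu>)" using \<mu>c by (simp add: vge_def)
    from vge_mult[OF this p(3)] have "\<mu> \<otimes> (s' \<otimes> z1 \<oplus> \<ominus> t) \<in> vge (real (Suc n) * v \<mu>)"
      unfolding t_def by (simp add: algebra_simps)
    moreover have "e \<otimes> z1 \<in> vge (real (Suc n) * v \<mu>)" using vge_mult[OF e(1) S_vge0[OF z1]] by simp
    ultimately have "z \<oplus> \<ominus> eval g y \<in> vge (real (Suc n) * v \<mu>)" unfolding zg by (rule vge_add)
    thus ?case using gA gl by blast
  qed
  obtain n :: nat where "B < real n * v \<mu>" using reals_Archimedean3[OF \<mu>(3)] by blast
  with main[OF assms, of n] show ?thesis using vge_mono by (metis less_imp_le)
qed

text \<open>Approximating \<open>z\<close> more closely than its own value does not change the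
  value. The approximation has degree below \<open>f\<close>; after its content is taken out,
  orthonormality makes the primitive factor a unit, so the value is that of the content, an element
  of \<open>K\<close>.\<close>

lemma S_values:
  assumes z: "z \<in> S" "z \<noteq> \<zero>"
  shows "v z \<in> v ` (K - {\<zero>})"
proof -
  have zc: "z \<in> carrier R" using S_carrier[OF z(1)] .
  obtain p where p: "set p \<subseteq> A" "length p \<le> f" and d: "z \<oplus> \<ominus> eval p y \<in> vge (v z + 1)"
    using eval_diff_dense[OF z(1)] by blast
  define w where "w = eval p y"
  have wc: "w \<in> carrier R" unfolding w_def by (rule S_carrier[OF eval_S[OF p(1)]])
  define \<delta> where "\<delta> = z \<oplus> \<ominus> w"
  have \<delta>: "\<delta> \<in> carrier R" "\<delta> = \<zero> \<or> v z < v \<delta>" using d unfolding \<delta>_def w_def vge_def by auto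
  have m\<delta>: "\<ominus> \<delta> \<in> carrier R" "\<ominus> \<delta> = \<zero> \<or> v z < v (\<ominus> \<delta>)" using \<delta> v_minus[of \<delta>] by (cases "\<delta> = \<zero>"; simp)+
  have "z \<oplus> \<ominus> \<delta> = w" unfolding \<delta>_def using zc wc by algebra
  hence w: "w \<noteq> \<zero>" "v w = v z" using v_add_eq[OF zc z(2) m\<delta>] by simp_all
  have ex: "\<exists>a\<in>set p. a \<noteq> \<zero>" using w(1) eval_all_zero[OF _ y(1), of p] unfolding w_def by blast
  have pK: "set p \<subseteq> K" using p(1) A_K by blast
  obtain c p' where c: "c \<in> K" "c \<noteq> \<zero>" "set p' \<subseteq> K \<inter> vge 0" "length p' = length p" "\<one> \<in> set p'"
    "\<And>x. x \<in> carrier R \<Longrightarrow> eval p x = c \<otimes> eval p' x" using factor_min_value[OF K pK ex] by metis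
  have p'A: "set p' \<subseteq> A" using c(3) unfolding A_def .
  define u where "u = eval p' y"
  have uS: "u \<in> S" unfolding u_def by (rule eval_S[OF p'A])
  have "u \<notin> vgt 0"
  proof
    assume "u \<in> vgt 0"
    from orthonormal[OF p'A _ this[unfolded u_def]] c(4,5) p(2) one_vge(2) show False by auto
  qed
  hence u: "u \<noteq> \<zero>" "v u = 0" "u \<in> carrier R" using S_vge0[OF uS] by (auto simp: vgt_def vge_def)
  have cc: "c \<in> carrier R" using c(1) Kc by blast
  have "w = c \<otimes> u" unfolding w_def u_def by (rule c(6)[OF y(1)])
  hence "v w = v c" using v_mult[OF cc u(3) c(2) u(1)] u(2) by simp
  thus ?thesis using w(2) c(1,2) by (metis DiffI empty_iff image_eqI insert_iff)
qed

end

section \<open>Values in a field generated by a radical\<close>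

context valuation begin

lemma scale_to_integral:
  assumes K: "subfield K R" and p: "set p \<subseteq> K"
  shows "\<exists>c\<in>K. c \<noteq> \<zero> \<and> (\<exists>p'. set p' \<subseteq> K \<inter> vge 0 \<and> (\<forall>x\<in>carrier R. eval p x = c \<otimes> eval p' x))"
proof (cases "\<forall>a\<in>set p. a = \<zero>")
  case True
  have "\<forall>x\<in>carrier R. eval p x = \<one> \<otimes> eval [] x" using eval_all_zero[OF True] by simp
  thus ?thesis using subringE(3)[OF subfieldE(1)[OF K]] by (intro bexI[of _ \<one>] conjI exI[of _ "[]"]) auto
next
  case False
  hence "\<exists>a\<in>set p. a \<noteq> \<zero>" by blast
  from factor_min_value[OF K p this] obtain c p' where "c \<in> K" "c \<noteq> \<zero>" "set p' \<subseteq> K \<inter> vge 0"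
    "\<And>x. x \<in> carrier R \<Longrightarrow> eval p x = c \<otimes> eval p' x" by metis
  thus ?thesis by blast
qed

lemma value_group:
  assumes K: "subfield K R" and a: "a \<in> K" "a \<noteq> \<zero>" and b: "b \<in> K" "b \<noteq> \<zero>"
  shows "\<exists>c\<in>K - {\<zero>}. v c = v a + v b" "\<exists>c\<in>K - {\<zero>}. v c = - v a" "\<exists>c\<in>K - {\<zero>}. v c = real n * v a"
proof -
  note Kr = subfieldE(1)[OF K] note Kc = subringE(1)[OF Kr]
  have c: "a \<in> carrier R" "b \<in> carrier R" using a b Kc by auto
  show "\<exists>c\<in>K - {\<zero>}. v c = v a + v b"
    using v_mult[OF c a(2) b(2)] subringE(6)[OF Kr a(1) b(1)] a b c by (intro bexI[of _ "a \<otimes> b"]) (auto simp: integral_iff)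
  show "\<exists>c\<in>K - {\<zero>}. v c = - v a"
    using v_inv[OF c(1) a(2)] subfield_m_inv(1)[OF K, of a] a by (intro bexI[of _ "inv a"]) auto
  show "\<exists>c\<in>K - {\<zero>}. v c = real n * v a"
    using v_pow[OF c(1) a(2), of n] subring_pow[OF Kr a(1), of n] a c by (intro bexI[of _ "a [^] n"]) auto
qed

text \<open>Dividing \<open>y\<close> by an element of \<open>K\<close> with the same value gives a
  radical of value 0, whose extension contains the given one; taking the content out of a polynomial
  over \<open>K\<close> moves the question into the ring \<open>S\<close> treated before.\<close>

theorem unramified_values:
  assumes K: "subfield K R" and y: "y \<in> carrier R" "y \<noteq> \<zero>" and q: "0 < q" "[q] \<cdot> \<one> \<noteq> \<zero>" "v ([q] \<cdot> \<one>) = 0"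
    and yq: "y [^] (q::nat) \<in> K" and nt: "\<exists>h\<in>K. h \<noteq> \<zero> \<and> v h \<noteq> 0"
    and a: "a \<in> K" "a \<noteq> \<zero>" "v y = v a"
    and z: "z \<in> simple_extension K y" "z \<noteq> \<zero>"
  shows "v z \<in> v ` (K - {\<zero>})"
proof -
  note Kr = subfieldE(1)[OF K] note Kc = subringE(1)[OF Kr]
  have ac: "a \<in> carrier R" using a Kc by blast
  have ia: "inv a \<in> K" "inv a \<in> carrier R" "inv a \<noteq> \<zero>" using subfield_m_inv(1)[OF K, of a] a Kc by auto
  define y0 where "y0 = inv a \<otimes> y"
  have y0c: "y0 \<in> carrier R" "y0 \<noteq> \<zero>" unfolding y0_def using ia y by (auto simp: integral_iff)
  have vy0: "v y0 = 0" unfolding y0_def using v_mult[OF ia(2) y(1) ia(3) y(2)] v_inv[OF ac a(2)] a(3) by simp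
  have y0q: "y0 [^] q \<in> K" unfolding y0_def nat_pow_distrib[OF ia(2) y(1)]
    by (rule subringE(6)[OF Kr subring_pow[OF Kr ia(1)] yq])
  interpret u: unramified R v K y0 q
    by (intro unramified.intro unramified_axioms.intro valuation_axioms K y0c vy0 q y0q nt)
  have yy0: "y = a \<otimes> y0" unfolding y0_def using m_assoc[OF ac ia(2) y(1)] ac a(2) y(1) by simp
  have "simple_extension K y \<subseteq> simple_extension K y0"
  proof (rule simple_extension_subring_incl)
    show sub: "subring (simple_extension K y0) R" by (rule simple_extension_is_subring[OF Kr y0c(1)])
    show KK: "K \<subseteq> simple_extension K y0" by (rule simple_extension_incl[OF Kc y0c(1)])
    show "y \<in> simple_extension K y0" unfolding yy0
      using subringE(6)[OF sub] KK a(1) simple_extension_mem[OF Kr y0c(1)] by blast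
  qed
  with z obtain P where P: "P \<in> carrier (K[X])" "z = eval P y0"
    unfolding simple_extension_as_eval_img[OF Kc y0c(1)] by blast
  have PK: "set P \<subseteq> K" using set_univ_poly[OF P(1)] .
  obtain c p' where c: "c \<in> K" "c \<noteq> \<zero>" "set p' \<subseteq> K \<inter> vge 0" "z = c \<otimes> eval p' y0"
    using scale_to_integral[OF K PK] P(2) y0c(1) by blast
  have eS: "eval p' y0 \<in> u.S" by (rule u.eval_S) (use c(3) in \<open>simp add: u.A_def\<close>)
  have cc: "c \<in> carrier R" using c Kc by blast
  have enz: "eval p' y0 \<noteq> \<zero>" using z(2) c(4) cc by auto
  from u.S_values[OF eS enz] obtain b where b: "b \<in> K" "b \<noteq> \<zero>" "v (eval p' y0) = v b" by blast
  have "v z = v c + v b" unfolding c(4) using v_mult[OF cc u.S_carrier[OF eS] c(2) enz] b(3) by simp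
  with value_group(1)[OF K c(1,2) b(1,2)] show ?thesis by (metis image_eqI)
qed

text \<open>The complementary case, in which the value of \<open>y\<close> is new. As
  \<open>q\<close> is prime and \<open>q v(y)\<close> is an old value, \<open>v y\<close> has order
  \<open>q\<close> modulo the value group of \<open>K\<close>, so terms of different degree below
  \<open>q\<close> cannot have equal values.\<close>

lemma radical_values:
  assumes K: "subfield K R" and y: "y \<in> carrier R" "y \<noteq> \<zero>" and q: "Factorial_Ring.prime q"
    and yq: "y [^] (q::nat) \<in> K"
    and nram: "\<not> (\<exists>a\<in>K. a \<noteq> \<zero> \<and> v y = v a)"
    and z: "z \<in> simple_extension K y" "z \<noteq> \<zero>"
  shows "\<exists>a\<in>K. a \<noteq> \<zero> \<and> (\<exists>i<q. v z = v a + real i * v y)"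
proof -
  note Kr = subfieldE(1)[OF K] note Kc = subringE(1)[OF Kr]
  obtain m where m: "q = Suc m" using gr0_implies_Suc[OF prime_gt_0_nat[OF q]] by blast
  define r where "r = y [^] q"
  have r: "r \<in> K" "r \<noteq> \<zero>" "r \<in> carrier R" "v r = real q * v y"
    using yq y v_pow unfolding r_def by auto
  obtain P where P: "P \<in> carrier (K[X])" "z = eval P y"
    using z(1) unfolding simple_extension_as_eval_img[OF Kc y(1)] by blast
  have PK: "set P \<subseteq> K" using set_univ_poly[OF P(1)] .
  define p0 where "p0 = replicate m \<zero> @ [\<ominus> r]"
  have p0K: "set p0 \<subseteq> K" unfolding p0_def using subringE(2,5)[OF Kr] r(1) by auto
  have e0: "eval (\<one> # p0) y = \<zero>"
    unfolding p0_def eval_pure[OF a_inv_closed[OF r(3)] y(1)] m[symmetric] r_def[symmetric] by (rule r_neg[OF r(3)])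
  from eval_monic_division[OF Kr PK p0K] obtain Q g where g: "set Q \<subseteq> K" "set g \<subseteq> K" "length g \<le> length p0"
    and div: "\<forall>x\<in>carrier R. eval P x = eval (\<one> # p0) x \<otimes> eval Q x \<oplus> eval g x" by (elim exE conjE)
  have g4: "eval P y = eval (\<one> # p0) y \<otimes> eval Q y \<oplus> eval g y" by (rule bspec[OF div y(1)])
  have Qc: "eval Q y \<in> carrier R" "eval g y \<in> carrier R" using eval_in_carrier y(1) g Kc by blast+
  have zg: "z = eval g y" unfolding P(2) g4 e0 using Qc by simp
  have gl: "length g \<le> q" using g(3) unfolding p0_def m by simp
  have ex: "\<exists>a\<in>set g. a \<noteq> \<zero>" using z(2) eval_all_zero[OF _ y(1), of g] unfolding zg by blast
  have dist: "v a + real i * v y \<noteq> v b + real j * v y"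
    if hyp: "a \<in> K" "b \<in> K" "a \<noteq> \<zero>" "b \<noteq> \<zero>" "i < j" "j < length g" for a b i j
  proof
    assume eq: "v a + real i * v y = v b + real j * v y"
    \<comment> \<open>Equal values would make \<open>(j - i) v(y)\<close> an old value, besides
      \<open>q v(y)\<close>; Bezout's identity would then make \<open>v y\<close> itself
      old.\<close>
    have "coprime (j - i) q" using hyp gl q
      using nat_dvd_not_less[of "j - i" q] prime_imp_coprime[of q "j - i"] by (simp add: coprime_commute)
    then obtain x w where xw: "(j - i) * x = q * w + 1"
      using bezout_nat[of "j - i" q] hyp(5) by auto
    have "real (j - i) * v y = v a - v b" using eq hyp(5) by (simp add: algebra_simps of_nat_diff)
    have "v y = (real (j - i) * real x - real q * real w) * v y"
      using arg_cong[OF xw, of real] by simp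
    also have "\<dots> = real x * (real (j - i) * v y) - real w * (real q * v y)" by (simp add: algebra_simps)
    finally have vy: "v y = real x * (v a + - v b) + real w * - v r"
      unfolding \<open>real (j - i) * v y = v a - v b\<close> r(4) by simp
    obtain b' where b': "b' \<in> K - {\<zero>}" "v b' = - v b" using value_group(2)[OF K hyp(2,4,2,4)] by blast
    obtain c where c: "c \<in> K - {\<zero>}" "v c = v a + v b'" using value_group(1)[OF K hyp(1,3), of b'] b' by blast
    obtain r' where r': "r' \<in> K - {\<zero>}" "v r' = - v r" using value_group(2)[OF K r(1,2,1,2)] by blast
    obtain d where d: "d \<in> K - {\<zero>}" "v d = real x * v c" using value_group(3)[OF K _ _ _ , of c c x] c by blast
    obtain e where e: "e \<in> K - {\<zero>}" "v e = real w * v r'" using value_group(3)[OF K _ _ _ , of r' r' w] r' by blast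
    obtain h where "h \<in> K - {\<zero>}" "v h = v d + v e" using value_group(1)[OF K, of d e] d e by blast
    thus False using nram vy d e c r' b' by auto
  qed
  have "eval g y \<noteq> \<zero> \<and> (\<exists>a\<in>K. a \<noteq> \<zero> \<and> (\<exists>i<length g. v (eval g y) = v a + real i * v y))"
    by (rule eval_no_cancellation[OF Kc y g(2) ex]) (rule dist)
  thus ?thesis unfolding zg using gl by (meson less_le_trans)
qed

text \<open>The value group of \<open>K\<close>. Divisibility by \<open>q\<close> has to be
  witnessed inside it, since in the reals everything is divisible.\<close>

definition "vals K = v ` (K - {\<zero>})"

lemma valsI: "a \<in> K \<Longrightarrow> a \<noteq> \<zero> \<Longrightarrow> v a \<in> vals K"
  by (auto simp: vals_def)

lemma valsE: "\<gamma> \<in> vals K \<Longrightarrow> (\<And>a. a \<in> K \<Longrightarrow> a \<noteq> \<zero> \<Longrightarrow> \<gamma> = v a \<Longrightarrow> P) \<Longrightarrow> P"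
  by (auto simp: vals_def)

lemma valsI': "\<exists>c\<in>K - {\<zero>}. v c = \<gamma> \<Longrightarrow> \<gamma> \<in> vals K"
  by (auto simp: vals_def)

lemma vals_add:
  assumes "subfield K R" "\<gamma> \<in> vals K" "\<delta> \<in> vals K" shows "\<gamma> + \<delta> \<in> vals K"
proof -
  obtain a b where "a \<in> K" "a \<noteq> \<zero>" "b \<in> K" "b \<noteq> \<zero>" "\<gamma> = v a" "\<delta> = v b" using assms(2,3) valsE by metis
  thus ?thesis using valsI'[OF value_group(1)[OF assms(1)]] by simp
qed

lemma vals_minus:
  assumes "subfield K R" "\<gamma> \<in> vals K" shows "- \<gamma> \<in> vals K"
proof -
  obtain a where "a \<in> K" "a \<noteq> \<zero>" "\<gamma> = v a" using assms(2) valsE by metis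
  thus ?thesis using valsI'[OF value_group(2)[OF assms(1), of a a]] by simp
qed

lemma vals_nat:
  assumes "subfield K R" "\<gamma> \<in> vals K" shows "real n * \<gamma> \<in> vals K"
proof -
  obtain a where "a \<in> K" "a \<noteq> \<zero>" "\<gamma> = v a" using assms(2) valsE by metis
  thus ?thesis using valsI'[OF value_group(3)[OF assms(1), of a a n]] by simp
qed

lemma vals_int: "subfield K R \<Longrightarrow> \<gamma> \<in> vals K \<Longrightarrow> of_int k * \<gamma> \<in> vals K"
  using vals_nat[of K \<gamma> "nat k"] vals_nat[of K "- \<gamma>" "nat (- k)"] vals_minus[of K \<gamma>] by (cases "0 \<le> k") auto

lemma vals_zero: "subfield K R \<Longrightarrow> 0 \<in> vals K"
  using valsI[of \<one> K] v_one subringE(3)[OF subfieldE(1)] by auto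

lemma vals_divisible:
  assumes K: "subfield K R" and "\<gamma> \<in> vals K" "\<delta> \<in> vals K"
    and "coprime (d::int) (int q)" and "of_int d * \<gamma> = real q * \<delta>"
  shows "\<exists>\<epsilon>\<in>vals K. \<gamma> = real q * \<epsilon>"
proof -
  obtain x w where "x * d + w * int q = 1" using bezout_int[of d "int q"] assms(4) by auto
  hence one: "of_int x * of_int d + of_int w * real q = (1::real)"
    using arg_cong[of _ _ real_of_int] by fastforce
  have "\<gamma> = (of_int x * of_int d + of_int w * real q) * \<gamma>" unfolding one by simp
  also have "\<dots> = of_int x * (of_int d * \<gamma>) + of_int w * real q * \<gamma>" by (simp add: algebra_simps)
  also have "\<dots> = real q * (of_int x * \<delta> + of_int w * \<gamma>)" unfolding assms(5) by (simp add: algebra_simps)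
  finally show ?thesis using vals_add[OF K vals_int[OF K assms(3)] vals_int[OF K assms(2)]] by blast
qed

end

lemma (in field) finite_nth_roots:
  assumes "a \<in> carrier R" "0 < n"
  shows "finite {w \<in> carrier R. w [^] (n::nat) = a}"
proof -
  obtain m where m: "n = Suc m" using assms(2) gr0_implies_Suc by blast
  define p where "p = \<one> # replicate m \<zero> @ [\<ominus> a]"
  have p: "p \<in> carrier (poly_ring R)" "p \<noteq> []"
    using assms(1) by (auto simp: p_def univ_poly_def polynomial_def)
  have "is_root p w" if "w \<in> carrier R" "w [^] n = a" for w
    using that p(2) eval_pure[of "\<ominus> a" w m] assms(1) unfolding is_root_def p_def m
    by (simp only: a_inv_closed r_neg simp_thms)
  hence "{w \<in> carrier R. w [^] n = a} \<subseteq> set_mset (roots p)"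
    using roots_mem_iff_is_root[OF p(1)] by blast
  thus ?thesis using finite_subset finite_set_mset by blast
qed

section \<open>Generic towers of radical extensions\<close>

text \<open>The rational functions enter as pairs of maps \<open>C i\<close>, \<open>B i\<close>
  with just the properties that matter: their zeros lie in \<open>Z i\<close>, and at a point
  equally far from all of \<open>Z i\<close> their values are that distance times the degrees
  \<open>dC i\<close>, \<open>dB i\<close>. \<open>Y i\<close> is the set whose members must not
  become poles of index \<open>i\<close>.\<close>

locale tower = field R for R (structure) +
  fixes F K0 :: "'a set" and Val :: "('a \<Rightarrow> real) set"
    and q :: "nat \<Rightarrow> nat" and C B :: "nat \<Rightarrow> 'a \<Rightarrow> 'a" and Z :: "nat \<Rightarrow> 'a set"
    and dC dB :: "nat \<Rightarrow> nat" and e :: "nat \<Rightarrow> 'a" and Y :: "nat \<Rightarrow> 'a set"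
  assumes F: "subfield F R" "infinite F" and K0: "subfield K0 R" "F \<subseteq> K0"
    and Val: "\<And>v. v \<in> Val \<Longrightarrow> valuation R v" "\<And>v c. v \<in> Val \<Longrightarrow> c \<in> F \<Longrightarrow> c \<noteq> \<zero> \<Longrightarrow> v c = 0"
      "\<And>v c. v \<in> Val \<Longrightarrow> c \<in> K0 \<Longrightarrow> c \<noteq> \<zero> \<Longrightarrow> v c \<in> \<int>"
      "\<And>v. v \<in> Val \<Longrightarrow> \<exists>c\<in>K0. c \<noteq> \<zero> \<and> v c \<noteq> 0" "Val \<noteq> {}"
    and q: "\<And>i. Factorial_Ring.prime (q i)" "inj q" "\<And>i. [q i] \<cdot> \<one> \<noteq> \<zero>"
    and Z: "\<And>i. finite (Z i)" "\<And>i. Z i \<subseteq> F" and e: "\<And>i. e i \<in> F" "\<And>i. e i \<notin> Z i"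
    and CB_closed: "\<And>K i x. subfield K R \<Longrightarrow> F \<subseteq> K \<Longrightarrow> x \<in> K \<Longrightarrow> C i x \<in> K"
      "\<And>K i x. subfield K R \<Longrightarrow> F \<subseteq> K \<Longrightarrow> x \<in> K \<Longrightarrow> B i x \<in> K"
    and CB_v: "\<And>v i x \<mu>. v \<in> Val \<Longrightarrow> x \<in> carrier R \<Longrightarrow> (\<And>c. c \<in> Z i \<Longrightarrow> x \<noteq> c \<and> v (x \<ominus> c) = \<mu>)
        \<Longrightarrow> v (C i x) = real (dC i) * \<mu>"
      "\<And>v i x \<mu>. v \<in> Val \<Longrightarrow> x \<in> carrier R \<Longrightarrow> (\<And>c. c \<in> Z i \<Longrightarrow> x \<noteq> c \<and> v (x \<ominus> c) = \<mu>)
        \<Longrightarrow> v (B i x) = real (dB i) * \<mu>"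
    and CB_nz: "\<And>i x. x \<in> carrier R \<Longrightarrow> x \<notin> Z i \<Longrightarrow> C i x \<noteq> \<zero>" "\<And>i x. x \<in> carrier R \<Longrightarrow> x \<notin> Z i \<Longrightarrow> B i x \<noteq> \<zero>"
    and d: "\<And>i. dB i < dC i" "\<And>i. coprime (int (dC i) - int (dB i)) (int (q i))"
    and roots: "\<And>i x. x \<in> carrier R \<Longrightarrow> B i x \<noteq> \<zero> \<Longrightarrow> \<exists>y\<in>carrier R. y [^] q i \<otimes> B i x = C i x"
    and Y: "\<And>i. Y i \<subseteq> K0"
begin

definition "\<delta> i = int (dC i) - int (dB i)"

text \<open>The equation \<open>z^q = C/B\<close> with its denominator cleared, so that the language
  of rings can express it.\<close>

definition "has_root K i x \<longleftrightarrow> (\<exists>z\<in>K. z [^] q i \<otimes> B i x = C i x)"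

definition "G i s x w = s \<otimes> (x [^] (q i * q i) \<oplus> s [^] q i \<otimes> w [^] (q i * q i)) \<oplus> e i"

definition "Pole K i x \<longleftrightarrow> (\<exists>s\<in>K. has_root K i (s \<oplus> e i) \<and> (\<forall>w\<in>K. \<not> has_root K i (G i s x w)))"

text \<open>The integer \<open>N\<close> is a common bound for the ramification indices of all places over \<open>K0\<close>.\<close>

definition "fld K \<longleftrightarrow> subfield K R \<and> K0 \<subseteq> K \<and> (\<exists>N>0::nat. \<forall>v\<in>Val. \<forall>z\<in>K. z \<noteq> \<zero> \<longrightarrow> real N * v z \<in> \<int>)"

text \<open>A place \<open>v\<close> together with a witness \<open>s\<close> that prevents \<open>x\<close> from ceasing to be a pole in later fields.\<close>

definition "place K i v s x \<longleftrightarrow> v \<in> Val \<and> s \<in> K \<and> s \<noteq> \<zero> \<and> x \<in> K \<and> x \<noteq> \<zero> \<and> 0 < v s \<and> v x \<le> - v s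
  \<and> has_root K i (s \<oplus> e i) \<and> (\<forall>y\<in>Y i. y = \<zero> \<or> 0 \<le> v y) \<and> (\<forall>a\<in>K. a \<noteq> \<zero> \<longrightarrow> v s \<noteq> real (q i) * v a)"

definition "ok K P \<longleftrightarrow> fld K \<and> finite P \<and> (\<forall>(i, v, s, x)\<in>P. place K i v s x)"

text \<open>The condition under which adjoining a \<open>q i\<close>-th root of \<open>C i h / B i h\<close> does not enlarge the value group.\<close>

definition "good K i v h \<longleftrightarrow> (\<exists>a\<in>K. a \<noteq> \<zero> \<and> v (C i h) - v (B i h) = real (q i) * v a)"

lemma q_pos: "0 < q i" using prime_gt_0_nat[OF q(1)] .

lemma F_carrier: "c \<in> F \<Longrightarrow> c \<in> carrier R" using subfieldE(3)[OF F(1)] by blast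

lemma fldD: "fld K \<Longrightarrow> subfield K R" "fld K \<Longrightarrow> K0 \<subseteq> K" "fld K \<Longrightarrow> F \<subseteq> K" "fld K \<Longrightarrow> K \<subseteq> carrier R" "fld K \<Longrightarrow> subring K R"
  using K0(2) subfieldE by (auto simp: fld_def)

lemma fld_e: "fld K \<Longrightarrow> e i \<in> K" using fldD(3) e(1) by blast

lemma has_root_mono: "has_root K i x \<Longrightarrow> K \<subseteq> K' \<Longrightarrow> has_root K' i x"
  unfolding has_root_def by blast

lemma Val_q: "v \<in> Val \<Longrightarrow> v ([q i] \<cdot> \<one>) = 0"
  using Val(2)[OF _ subring_nat_mult[OF subfieldE(1)[OF F(1)]] q(3)] .

lemma G_closed: "fld K \<Longrightarrow> s \<in> K \<Longrightarrow> x \<in> K \<Longrightarrow> w \<in> K \<Longrightarrow> G i s x w \<in> K"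
  unfolding G_def using fldD(5) by (intro subringE(6,7)[OF fldD(5)] subring_pow[OF fldD(5)] fld_e)

text \<open>At each place either the value of the root is old and the value group stays, or the new
  values are old ones plus multiples of \<open>v y\<close>. Since \<open>q i\<close> times
  \<open>v y\<close> is old in both cases, \<open>q i\<close> times the previous ramification bound
  is a bound for the new field.\<close>

lemma adjoin_root:
  assumes K: "fld K" and h: "h \<in> K" "h \<notin> Z i" and np: "\<not> has_root K i h"
  obtains K' y where "fld K'" "K \<subset> K'" "has_root K' i h"
    "y \<in> K'" "y \<noteq> \<zero>" "y [^] q i \<in> K" "y [^] q i \<noteq> \<zero>"
    "\<And>v. v \<in> Val \<Longrightarrow> real (q i) * v y = v (C i h) - v (B i h)"
    "\<And>v a z. v \<in> Val \<Longrightarrow> a \<in> K \<Longrightarrow> a \<noteq> \<zero> \<Longrightarrow> v y = v a \<Longrightarrow> z \<in> K' \<Longrightarrow> z \<noteq> \<zero> \<Longrightarrow> \<exists>b\<in>K. b \<noteq> \<zero> \<and> v z = v b"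
    "\<And>v z. v \<in> Val \<Longrightarrow> \<forall>a\<in>K. a \<noteq> \<zero> \<longrightarrow> v y \<noteq> v a \<Longrightarrow> z \<in> K' \<Longrightarrow> z \<noteq> \<zero> \<Longrightarrow>
       \<exists>b\<in>K. b \<noteq> \<zero> \<and> (\<exists>j::nat. v z = v b + real j * v y)"
proof -
  note Kf = fldD(1)[OF K] note Kr = fldD(5)[OF K] note Kc = fldD(4)[OF K]
  have hc: "h \<in> carrier R" using h Kc by blast
  have CK: "C i h \<in> K" "C i h \<noteq> \<zero>" "C i h \<in> carrier R" and BK: "B i h \<in> K" "B i h \<noteq> \<zero>" "B i h \<in> carrier R"
    using CB_closed[OF Kf fldD(3)[OF K] h(1)] CB_nz[OF hc h(2)] Kc by auto
  obtain y where y: "y \<in> carrier R" "y [^] q i \<otimes> B i h = C i h" using roots[OF hc BK(2)] by blast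
  have ynz: "y \<noteq> \<zero>" using y(2) CK(2) BK(3) q_pos[of i] by (auto simp: nat_pow_zero)
  have yqc: "y [^] q i \<in> carrier R" using y(1) by simp
  have "y [^] q i = C i h \<otimes> inv (B i h)"
    unfolding y(2)[symmetric] m_assoc[OF yqc BK(3) inv_closed[OF BK(3,2)]] using BK yqc by simp
  hence yqK: "y [^] q i \<in> K" using subringE(6)[OF Kr CK(1)] subfield_m_inv(1)[OF Kf, of "B i h"] BK by auto
  have yqnz: "y [^] q i \<noteq> \<zero>" using y(1) ynz by simp
  obtain m where m: "q i = Suc m" using gr0_implies_Suc[OF q_pos] by blast
  define p where "p = \<one> # replicate m \<zero> @ [\<ominus> (y [^] q i)]"
  have "p \<in> carrier (K[X])" "p \<noteq> []"
    using subringE(2,3,5)[OF Kr] yqK by (auto simp: p_def univ_poly_def polynomial_def)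
  moreover have "eval p y = \<zero>"
    unfolding p_def eval_pure[OF a_inv_closed[OF yqc] y(1)] m[symmetric] by (rule r_neg[OF yqc])
  ultimately have alg: "(algebraic over K) y" by (rule algebraicI)
  define K' where "K' = simple_extension K y"
  have K'f: "subfield K' R" unfolding K'_def using simple_extension_is_subfield[OF Kf y(1)] alg by blast
  have KK': "K \<subseteq> K'" unfolding K'_def by (rule simple_extension_incl[OF Kc y(1)])
  have yK': "y \<in> K'" unfolding K'_def by (rule simple_extension_mem[OF Kr y(1)])
  have "y \<notin> K" using np y(2) unfolding has_root_def by blast
  hence sub: "K \<subset> K'" using KK' yK' by blast
  have pow: "has_root K' i h" using y(2) yK' unfolding has_root_def by blast
  have vy: "real (q i) * v y = v (C i h) - v (B i h)" if "v \<in> Val" for v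
  proof -
    interpret valuation R v using Val(1)[OF that] .
    show ?thesis using v_mult[OF yqc BK(3) yqnz BK(2)] v_pow[OF y(1) ynz, of "q i"] y(2) by simp
  qed
  have unram: "\<exists>b\<in>K. b \<noteq> \<zero> \<and> v z = v b" if v: "v \<in> Val" and a: "a \<in> K" "a \<noteq> \<zero>" "v y = v a" and z: "z \<in> K'" "z \<noteq> \<zero>" for v a z
  proof -
    interpret valuation R v using Val(1)[OF v] .
    have "\<exists>h\<in>K. h \<noteq> \<zero> \<and> v h \<noteq> 0" using Val(4)[OF v] fldD(2)[OF K] by blast
    from unramified_values[OF Kf y(1) ynz q_pos q(3) Val_q[OF v] yqK this a z(1)[unfolded K'_def] z(2)]
    show ?thesis by auto
  qed
  have ram: "\<exists>b\<in>K. b \<noteq> \<zero> \<and> (\<exists>j::nat. v z = v b + real j * v y)"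
    if v: "v \<in> Val" and a: "\<forall>a\<in>K. a \<noteq> \<zero> \<longrightarrow> v y \<noteq> v a" and z: "z \<in> K'" "z \<noteq> \<zero>" for v z
  proof -
    interpret valuation R v using Val(1)[OF v] .
    from radical_values[OF Kf y(1) ynz q(1) yqK _ z(1)[unfolded K'_def] z(2)] a show ?thesis by blast
  qed
  have "fld K'"
  proof -
    obtain N :: nat where N: "0 < N" "\<And>v z. v \<in> Val \<Longrightarrow> z \<in> K \<Longrightarrow> z \<noteq> \<zero> \<Longrightarrow> real N * v z \<in> \<int>"
      using K unfolding fld_def by blast
    have "real (N * q i) * v z \<in> \<int>" if v: "v \<in> Val" and z: "z \<in> K'" "z \<noteq> \<zero>" for v z
    proof (cases "\<exists>a\<in>K. a \<noteq> \<zero> \<and> v y = v a")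
      case True
      then obtain b where b: "b \<in> K" "b \<noteq> \<zero>" "v z = v b" using unram[OF v _ _ _ z] by blast
      have "real (N * q i) * v z = of_nat (q i) * (real N * v b)" using b(3) by simp
      thus ?thesis using N(2)[OF v b(1,2)] Ints_mult[OF Ints_of_nat] by metis
    next
      case False
      then obtain b j where b: "b \<in> K" "b \<noteq> \<zero>" "v z = v b + real j * v y" using ram[OF v _ z] by blast
      have e: "real (N * q i) * v z = of_nat (q i) * (real N * v b) + of_nat j * (real N * (v (C i h)) - real N * v (B i h))"
        unfolding b(3) right_diff_distrib[symmetric] vy[OF v, symmetric] by (simp add: algebra_simps)
      show ?thesis unfolding e
        by (intro Ints_add Ints_mult Ints_diff Ints_of_nat N(2)[OF v] b CK BK)
    qed
    moreover have "0 < N * q i" using N(1) q_pos by simp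
    ultimately show ?thesis unfolding fld_def using K'f KK' fldD(2)[OF K] by blast
  qed
  from that[OF this sub pow yK' ynz yqK yqnz vy unram ram] show thesis .
qed

text \<open>Recorded places of index \<open>i\<close> are safe because the value group does not grow
  there. At those of another index \<open>j\<close> it may grow, but only by values whose
  \<open>q i\<close>-fold is old, and these cannot help to divide \<open>v s\<close> by the
  different prime \<open>q j\<close>.\<close>

lemma adjoin:
  assumes ok: "ok K P" and h: "h \<in> K" "h \<notin> Z i"
    and good: "\<forall>v s x. (i, v, s, x) \<in> P \<longrightarrow> good K i v h"
  shows "\<exists>K'. K \<subseteq> K' \<and> ok K' P \<and> has_root K' i h \<and> (\<not> has_root K i h \<longrightarrow> K \<noteq> K')
    \<and> (\<forall>v\<in>Val. good K i v h \<longrightarrow> (\<forall>z\<in>K'. z \<noteq> \<zero> \<longrightarrow> (\<exists>b\<in>K. b \<noteq> \<zero> \<and> v z = v b)))"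
proof (cases "has_root K i h")
  case True
  thus ?thesis using ok by blast
next
  case False
  have K: "fld K" and P: "finite P" "\<And>i v s x. (i, v, s, x) \<in> P \<Longrightarrow> place K i v s x"
    using ok unfolding ok_def by auto
  note Kf = fldD(1)[OF K]
  obtain K' y where K': "fld K'" "K \<subset> K'" "has_root K' i h"
    and y: "y \<in> K'" "y \<noteq> \<zero>" "y [^] q i \<in> K" "y [^] q i \<noteq> \<zero>"
    and vy: "\<And>v. v \<in> Val \<Longrightarrow> real (q i) * v y = v (C i h) - v (B i h)"
    and unram: "\<And>v a z. v \<in> Val \<Longrightarrow> a \<in> K \<Longrightarrow> a \<noteq> \<zero> \<Longrightarrow> v y = v a \<Longrightarrow> z \<in> K' \<Longrightarrow> z \<noteq> \<zero> \<Longrightarrow> \<exists>b\<in>K. b \<noteq> \<zero> \<and> v z = v b"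
    and ram: "\<And>v z. v \<in> Val \<Longrightarrow> \<forall>a\<in>K. a \<noteq> \<zero> \<longrightarrow> v y \<noteq> v a \<Longrightarrow> z \<in> K' \<Longrightarrow> z \<noteq> \<zero> \<Longrightarrow>
       \<exists>b\<in>K. b \<noteq> \<zero> \<and> (\<exists>j::nat. v z = v b + real j * v y)"
  proof (rule adjoin_root[OF K h False], goal_cases)
    case (1 K' y)
    show ?case by (rule 1(1)[OF 1(2-)])
  qed
  have goodD: "\<forall>z\<in>K'. z \<noteq> \<zero> \<longrightarrow> (\<exists>b\<in>K. b \<noteq> \<zero> \<and> v z = v b)" if v: "v \<in> Val" "good K i v h" for v
  proof -
    obtain a where a: "a \<in> K" "a \<noteq> \<zero>" "v (C i h) - v (B i h) = real (q i) * v a" using v(2) unfolding good_def by blast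
    have "v y = v a" using vy[OF v(1)] a(3) q_pos[of i] by simp
    with unram[OF v(1) a(1,2)] show ?thesis by blast
  qed
  have "place K' j v s x" if p: "(j, v, s, x) \<in> P" for j v s x
  proof -
    have pl: "place K j v s x" using P(2)[OF p] .
    hence v: "v \<in> Val" and s: "s \<in> K" "s \<noteq> \<zero>" and nd: "\<forall>a\<in>K. a \<noteq> \<zero> \<longrightarrow> v s \<noteq> real (q j) * v a"
      unfolding place_def by auto
    interpret valuation R v using Val(1)[OF v] .
    have "v s \<noteq> real (q j) * v z" if z: "z \<in> K'" "z \<noteq> \<zero>" for z
    proof (cases "\<exists>a\<in>K. a \<noteq> \<zero> \<and> v y = v a")
      case True
      then obtain b where "b \<in> K" "b \<noteq> \<zero>" "v z = v b" using unram[OF v _ _ _ z] by blast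
      thus ?thesis using nd by simp
    next
      case False
      have "i \<noteq> j"
      proof
        assume "i = j"
        hence "good K i v h" using good p by blast
        then obtain a where a: "a \<in> K" "a \<noteq> \<zero>" "v (C i h) - v (B i h) = real (q i) * v a" unfolding good_def by blast
        have "v y = v a" using vy[OF v(1)] a(3) q_pos[of i] by simp
        thus False using False a by blast
      qed
      hence "q i \<noteq> q j" using q(2) by (meson injD)
      hence cop: "coprime (int (q i)) (int (q j))" using q(1) by (simp add: primes_coprime)
      from False obtain b k where b: "b \<in> K" "b \<noteq> \<zero>" "v z = v b + real k * v y" using ram[OF v _ z] by blast
      show ?thesis
      proof
        assume eq: "v s = real (q j) * v z"
        \<comment> \<open>\<open>\<epsilon>\<close> is \<open>q i\<close> times \<open>v z\<close>,
          expressed through elements of \<open>K\<close>. So \<open>q j\<close> divides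
          \<open>q i\<close> times \<open>v s\<close> in the old value group, and hence divides
          \<open>v s\<close>.\<close>
        define \<epsilon> where "\<epsilon> = real (q i) * v b + real k * v (y [^] q i)"
        have yc: "y \<in> carrier R" using y(1) fldD(4)[OF K'(1)] by blast
        have "\<epsilon> \<in> vals K" unfolding \<epsilon>_def
          by (intro vals_add[OF Kf] vals_nat[OF Kf] valsI b(1,2) y(3,4))
        moreover have "of_int (int (q i)) * v s = real (q j) * \<epsilon>"
          unfolding eq b(3) \<epsilon>_def v_pow[OF yc y(2)] by (simp add: algebra_simps)
        ultimately obtain \<eta> where "\<eta> \<in> vals K" "v s = real (q j) * \<eta>"
          using vals_divisible[OF Kf valsI[OF s] _ cop] by blast
        thus False using nd valsE by metis
      qed
    qed
    thus ?thesis using pl K'(2) has_root_mono[of K j "s \<oplus> e j" K'] unfolding place_def by auto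
  qed
  hence "ok K' P" unfolding ok_def using K'(1) P(1) by auto
  thus ?thesis using K' goodD by blast
qed

lemma v_minus_const:
  assumes v: "v \<in> Val" and g: "g \<in> carrier R" "g \<noteq> \<zero>" "v g < 0" and c: "c \<in> F" "d \<in> F"
  shows "g \<oplus> c \<noteq> d" "v ((g \<oplus> c) \<ominus> d) = v g"
proof -
  interpret valuation R v using Val(1)[OF v] .
  have cF: "c \<ominus> d \<in> F" unfolding a_minus_def using subringE(5,7)[OF subfieldE(1)[OF F(1)]] c by blast
  have cc: "c \<in> carrier R" "d \<in> carrier R" using c F_carrier by auto
  have eq: "(g \<oplus> c) \<ominus> d = g \<oplus> (c \<ominus> d)" using g cc by algebra
  have "c \<ominus> d = \<zero> \<or> v g < v (c \<ominus> d)"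
    using Val(2)[OF v cF] g(3) by (cases "c \<ominus> d = \<zero>") simp_all
  from v_add_eq[OF g(1,2) F_carrier[OF cF] this] show "v ((g \<oplus> c) \<ominus> d) = v g" unfolding eq by blast
  from v_add_eq[OF g(1,2) F_carrier[OF cF] \<open>c \<ominus> d = \<zero> \<or> v g < v (c \<ominus> d)\<close>] show "g \<oplus> c \<noteq> d"
    unfolding eq[symmetric] using g cc by (auto simp: r_right_minus_eq)
qed

text \<open>At a pole of \<open>g\<close> all constants are negligible, so
  \<open>R_i(g + e i)\<close> has \<open>\<delta> i\<close> times the value of \<open>g\<close>. A
  root makes this divisible by \<open>q i\<close>, to which \<open>\<delta> i\<close> is
  prime.\<close>

lemma root_pole_divisible:
  assumes K: "fld K" and v: "v \<in> Val" and g: "g \<in> K" "g \<noteq> \<zero>" "v g < 0" and root: "has_root K i (g \<oplus> e i)"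
  shows "\<exists>\<eta>\<in>valuation.vals R v K. v g = real (q i) * \<eta>"
proof -
  interpret valuation R v using Val(1)[OF v] .
  note Kf = fldD(1)[OF K] note Kc = fldD(4)[OF K] note Kr = fldD(5)[OF K]
  obtain z where z: "z \<in> K" "z [^] q i \<otimes> B i (g \<oplus> e i) = C i (g \<oplus> e i)" using root unfolding has_root_def by blast
  have zc: "z \<in> carrier R" and gc: "g \<in> carrier R" using z(1) g(1) Kc by auto
  have hc: "g \<oplus> e i \<in> carrier R" using gc e(1) F_carrier by auto
  have ZF: "c \<in> Z i \<Longrightarrow> c \<in> F" for c using Z(2) by blast
  have vz: "c \<in> Z i \<Longrightarrow> g \<oplus> e i \<noteq> c \<and> v ((g \<oplus> e i) \<ominus> c) = v g" for c
    using v_minus_const[OF v gc g(2,3) e(1) ZF] by blast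
  have vC: "v (C i (g \<oplus> e i)) = real (dC i) * v g" "v (B i (g \<oplus> e i)) = real (dB i) * v g"
    by (rule CB_v[OF v hc]; erule vz)+
  have nZ: "g \<oplus> e i \<notin> Z i" using vz by blast
  note nz = CB_nz[OF hc nZ]
  have Cc: "B i (g \<oplus> e i) \<in> carrier R"
    using CB_closed(2)[OF Kf fldD(3)[OF K] subringE(7)[OF Kr g(1) fld_e[OF K]]] Kc by blast
  have znz: "z \<noteq> \<zero>" using z(2) nz(1) Cc q_pos[of i] by (auto simp: nat_pow_zero)
  have "v (C i (g \<oplus> e i)) = real (q i) * v z + v (B i (g \<oplus> e i))"
    using v_mult[of "z [^] q i" "B i (g \<oplus> e i)"] v_pow[OF zc znz] nz(2) Cc zc znz z(2) by simp
  hence "of_int (\<delta> i) * v g = real (q i) * v z" unfolding vC \<delta>_def by (simp add: algebra_simps)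
  from vals_divisible[OF Kf valsI[OF g(1,2)] valsI[OF z(1) znz] _ this] d(2)[of i]
  show ?thesis unfolding \<delta>_def by blast
qed

text \<open>With \<open>n = q\<^sup>2\<close>, equal values of \<open>x^n\<close> and \<open>s^q w^n\<close> would make \<open>v s\<close> divisible by \<open>q\<close>.\<close>

lemma place_no_root:
  assumes K: "fld K" and pl: "place K i v s x" and w: "w \<in> K"
  shows "\<not> has_root K i (G i s x w)"
proof
  assume root: "has_root K i (G i s x w)"
  have v: "v \<in> Val" and s: "s \<in> K" "s \<noteq> \<zero>" "0 < v s" and x: "x \<in> K" "x \<noteq> \<zero>" "v x \<le> - v s"
    and nd: "\<And>a. a \<in> K \<Longrightarrow> a \<noteq> \<zero> \<Longrightarrow> v s \<noteq> real (q i) * v a" using pl unfolding place_def by auto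
  interpret valuation R v using Val(1)[OF v] .
  note Kf = fldD(1)[OF K] note Kc = fldD(4)[OF K] note Kr = fldD(5)[OF K]
  define n where "n = q i * q i"
  have car: "s \<in> carrier R" "x \<in> carrier R" "w \<in> carrier R" using s x w Kc by auto
  have nd': "v s \<noteq> real (q i) * \<epsilon>" if "\<epsilon> \<in> vals K" for \<epsilon> using that nd valsE by metis
  define Xn W where "Xn = x [^] n" and "W = s [^] q i \<otimes> w [^] n"
  have Xn: "Xn \<in> carrier R" "Xn \<noteq> \<zero>" "v Xn = real n * v x" "Xn \<in> K"
    unfolding Xn_def using car x v_pow subring_pow[OF Kr x(1)] by auto
  have Wc: "W \<in> carrier R" unfolding W_def using car by simp
  have WK: "W \<in> K" unfolding W_def by (intro subringE(6)[OF Kr] subring_pow[OF Kr] s w)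
  have W: "W \<noteq> \<zero> \<Longrightarrow> w \<noteq> \<zero> \<and> v W = real (q i) * v s + real n * v w"
  proof -
    assume "W \<noteq> \<zero>"
    hence w0: "w \<noteq> \<zero>" unfolding W_def n_def using q_pos[of i] car by (auto simp: nat_pow_zero)
    thus ?thesis unfolding W_def using v_mult[of "s [^] q i" "w [^] n"] v_pow car s by simp
  qed
  have T: "Xn \<oplus> W \<noteq> \<zero> \<and> v (Xn \<oplus> W) \<le> real n * v x \<and> (\<exists>\<epsilon>\<in>vals K. v (Xn \<oplus> W) = real (q i) * \<epsilon>)"
  proof -
    have e1: "v Xn = real (q i) * (real (q i) * v x)" unfolding Xn(3) n_def by simp
    have e1': "real (q i) * v x \<in> vals K" by (intro vals_nat[OF Kf] valsI x)
    show ?thesis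
    proof (cases "W = \<zero> \<or> v Xn < v W")
      case True
      from v_add_eq[OF Xn(1,2) Wc this] have A: "Xn \<oplus> W \<noteq> \<zero>" "v (Xn \<oplus> W) = v Xn" by auto
      show ?thesis by (intro conjI bexI[OF _ e1'] A(1)) (use A(2) Xn(3) e1 in linarith)+
    next
      case False
      hence Wn: "W \<noteq> \<zero>" "v W \<le> v Xn" by auto
      note W' = W[OF Wn(1)]
      have vw: "v w \<in> vals K" "v s \<in> vals K" "v x \<in> vals K" using valsI s x w W' by auto
      have "v W \<noteq> v Xn"
      proof
        assume "v W = v Xn"
        hence "real (q i) * (v s + real (q i) * v w) = real (q i) * (real (q i) * v x)"
          using W' Xn(3) unfolding n_def by (simp add: algebra_simps)
        hence "v s + real (q i) * v w = real (q i) * v x" using q_pos[of i] unfolding mult_cancel_left by simp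
        hence "v s = real (q i) * (v x + - v w)" by (simp add: algebra_simps)
        thus False using nd'[OF vals_add[OF Kf vw(3) vals_minus[OF Kf vw(1)]]] by simp
      qed
      hence lt: "v W < v Xn" using Wn by simp
      have "v W = real (q i) * (v s + real (q i) * v w)" using W' unfolding n_def by (simp add: algebra_simps)
      moreover have "v s + real (q i) * v w \<in> vals K" by (intro vals_add[OF Kf] vals_nat[OF Kf] vw)
      moreover have "W \<oplus> Xn \<noteq> \<zero>" "v (W \<oplus> Xn) = v W" using v_add_eq[OF Wc Wn(1) Xn(1)] lt by auto
      ultimately show ?thesis using lt Xn(3) Wc Xn(1) by (auto simp: add.m_comm)
    qed
  qed
  then obtain \<epsilon> where \<epsilon>: "\<epsilon> \<in> vals K" "v (Xn \<oplus> W) = real (q i) * \<epsilon>" by blast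
  define g where "g = s \<otimes> (Xn \<oplus> W)"
  have gK: "g \<in> K" unfolding g_def by (intro subringE(6,7)[OF Kr] s Xn(4) WK)
  have g: "g \<noteq> \<zero>" "v g = v s + v (Xn \<oplus> W)" unfolding g_def using v_mult[of s "Xn \<oplus> W"] T s car Xn Wc by (auto simp: integral_iff)
  \<comment> \<open>With \<open>n \<ge> 2\<close> one gets
    \<open>v g \<le> v s + 2 v x \<le> - v s\<close>, so \<open>g\<close> has a pole.\<close>
  have "2 \<le> q i" using prime_ge_2_nat[OF q(1)] .
  hence "2 \<le> n" unfolding n_def using mult_le_mono[of 1 "q i" 2 "q i"] by simp
  hence n2: "2 \<le> real n" by simp
  have "real n * v x \<le> 2 * v x" using n2 x(3) s(3) by (intro mult_right_mono_neg) auto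
  hence vg: "v g < 0" using g(2) T x(3) s(3) by linarith
  have Gg: "G i s x w = g \<oplus> e i" unfolding G_def g_def Xn_def W_def n_def ..
  obtain \<eta> where \<eta>: "\<eta> \<in> vals K" "v g = real (q i) * \<eta>"
    using root_pole_divisible[OF K v gK g(1) vg] root unfolding Gg by blast
  have "v s = real (q i) * (\<eta> + - \<epsilon>)" using g(2) \<eta>(2) \<epsilon>(2) by (simp add: algebra_simps)
  thus False using nd'[OF vals_add[OF Kf \<eta>(1) vals_minus[OF Kf \<epsilon>(1)]]] by simp
qed

text \<open>Equal distances from \<open>h\<close> to all zeros and poles of \<open>R_i\<close>
  determine the value of \<open>R_i(h)\<close>. This is used with \<open>\<gamma> = 0\<close> for an
  \<open>h\<close> that stays away from \<open>Z i\<close>, and for an \<open>h\<close> with a pole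
  of divisible order.\<close>

lemma good_uniform:
  assumes K: "fld K" and v: "v \<in> Val" and h: "h \<in> carrier R" "\<And>c. c \<in> Z i \<Longrightarrow> h \<noteq> c \<and> v (h \<ominus> c) = real (q i) * \<gamma>"
    and \<gamma>: "\<gamma> \<in> valuation.vals R v K"
  shows "good K i v h"
proof -
  interpret valuation R v using Val(1)[OF v] .
  have "v (C i h) - v (B i h) = real (q i) * (of_int (\<delta> i) * \<gamma>)"
    using CB_v[OF v h] unfolding \<delta>_def by (simp add: algebra_simps)
  moreover have "of_int (\<delta> i) * \<gamma> \<in> vals K" by (rule vals_int[OF fldD(1)[OF K] \<gamma>])
  ultimately show ?thesis unfolding good_def using valsE by metis
qed

lemma good_unit:
  assumes K: "fld K" and v: "v \<in> Val" and h: "h \<in> carrier R" "\<And>c. c \<in> Z i \<Longrightarrow> h \<noteq> c \<and> v (h \<ominus> c) = 0"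
  shows "good K i v h"
proof -
  interpret valuation R v using Val(1)[OF v] .
  show ?thesis by (rule good_uniform[OF K v h(1) _ vals_zero[OF fldD(1)[OF K]]]) (simp add: h(2))
qed

text \<open>Nonzero elements of \<open>F\<close> have value 0, so \<open>F\<close> embeds in every
  residue field: two different solutions \<open>c\<close>, \<open>d\<close> would put the unit
  \<open>u (c - d)\<close> into the maximal ideal. Hence there is at most one.\<close>

lemma finite_affine:
  assumes u: "u \<in> carrier R" "u \<noteq> \<zero>" and b: "b \<in> carrier R"
  shows "finite {c \<in> F. u \<otimes> c \<oplus> b = \<zero>}"
    and "v \<in> Val \<Longrightarrow> v u = 0 \<Longrightarrow> finite {c \<in> F. u \<otimes> c \<oplus> b \<noteq> \<zero> \<and> 0 < v (u \<otimes> c \<oplus> b)}"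
proof -
  have eq: "u \<otimes> (c \<ominus> d) = (u \<otimes> c \<oplus> b) \<oplus> \<ominus> (u \<otimes> d \<oplus> b)" if "c \<in> F" "d \<in> F" for c d
    using u b F_carrier[OF that(1)] F_carrier[OF that(2)] by algebra
  have *: "finite {c \<in> F. P c}" if "\<And>c d. c \<in> F \<Longrightarrow> d \<in> F \<Longrightarrow> P c \<Longrightarrow> P d \<Longrightarrow> c = d" for P :: "'a \<Rightarrow> bool"
  proof (cases "\<exists>d\<in>F. P d")
    case True
    then obtain d where "d \<in> F" "P d" by blast
    hence "{c \<in> F. P c} \<subseteq> {d}" using that by blast
    thus ?thesis by (rule finite_subset) simp
  next
    case False
    hence "{c \<in> F. P c} \<subseteq> {}" by blast
    thus ?thesis by (rule finite_subset) simp
  qed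
  show "finite {c \<in> F. u \<otimes> c \<oplus> b = \<zero>}"
  proof (rule *)
    fix c d assume c: "c \<in> F" "d \<in> F" "u \<otimes> c \<oplus> b = \<zero>" "u \<otimes> d \<oplus> b = \<zero>"
    have cc: "c \<in> carrier R" "d \<in> carrier R" using c(1,2) F_carrier by blast+
    have "u \<otimes> (c \<ominus> d) = \<zero>" unfolding eq[OF c(1,2)] c(3,4) by simp
    hence "c \<ominus> d = \<zero>" using u cc integral_iff[of u "c \<ominus> d"] by simp
    thus "c = d" using r_right_minus_eq[OF cc] by simp
  qed
  assume v: "v \<in> Val" "v u = 0"
  interpret valuation R v using Val(1)[OF v(1)] .
  show "finite {c \<in> F. u \<otimes> c \<oplus> b \<noteq> \<zero> \<and> 0 < v (u \<otimes> c \<oplus> b)}"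
  proof (rule *, rule ccontr)
    fix c d assume c: "c \<in> F" "d \<in> F" "u \<otimes> c \<oplus> b \<noteq> \<zero> \<and> 0 < v (u \<otimes> c \<oplus> b)" "u \<otimes> d \<oplus> b \<noteq> \<zero> \<and> 0 < v (u \<otimes> d \<oplus> b)" "c \<noteq> d"
    have cc: "c \<in> carrier R" "d \<in> carrier R" using c(1,2) F_carrier by blast+
    have cF: "c \<ominus> d \<in> F" unfolding a_minus_def using subringE(5,7)[OF subfieldE(1)[OF F(1)]] c(1,2) by blast
    have cd: "c \<ominus> d \<noteq> \<zero>" using r_right_minus_eq[OF cc] c(5) by simp
    have "v (u \<otimes> (c \<ominus> d)) = 0" using v_mult[OF u(1) _ u(2) cd] Val(2)[OF v(1) cF cd] v(2) F_carrier[OF cF] by simp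
    moreover have g: "u \<otimes> c \<oplus> b \<in> vgt 0" "u \<otimes> d \<oplus> b \<in> vgt 0" using c cc u b by (simp_all add: vgt_def)
    have "u \<otimes> (c \<ominus> d) \<in> vgt 0" unfolding eq[OF c(1,2)] by (rule vgt_add[OF g(1) vgt_minus[OF g(2)]])
    moreover have "u \<otimes> (c \<ominus> d) \<noteq> \<zero>" using u cd cF F_carrier by (simp add: integral_iff)
    ultimately show False using \<open>u \<otimes> (c \<ominus> d) \<in> vgt 0\<close> by (simp add: vgt_def)
  qed
qed

lemma finite_bad:
  assumes u: "u \<in> carrier R" "u \<noteq> \<zero>" and b: "b \<in> carrier R" and V: "finite V" "V \<subseteq> Val"
  shows "finite {c \<in> F. u \<otimes> c \<oplus> b = \<zero> \<or> (\<exists>v\<in>V. v u = 0 \<and> u \<otimes> c \<oplus> b \<noteq> \<zero> \<and> 0 < v (u \<otimes> c \<oplus> b))}"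
proof -
  have "{c \<in> F. u \<otimes> c \<oplus> b = \<zero> \<or> (\<exists>v\<in>V. v u = 0 \<and> u \<otimes> c \<oplus> b \<noteq> \<zero> \<and> 0 < v (u \<otimes> c \<oplus> b))}
    = {c \<in> F. u \<otimes> c \<oplus> b = \<zero>} \<union> (\<Union>v\<in>{v\<in>V. v u = 0}. {c \<in> F. u \<otimes> c \<oplus> b \<noteq> \<zero> \<and> 0 < v (u \<otimes> c \<oplus> b)})" by blast
  moreover have "finite (\<Union>v\<in>{v\<in>V. v u = 0}. {c \<in> F. u \<otimes> c \<oplus> b \<noteq> \<zero> \<and> 0 < v (u \<otimes> c \<oplus> b)})"
    by (rule finite_UN_I) (use V finite_affine(2)[OF u b] in \<open>auto intro: finite_subset\<close>)
  ultimately show ?thesis using finite_affine(1)[OF u b] by simp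
qed

lemma F_diff: "c \<in> F \<Longrightarrow> d \<in> F \<Longrightarrow> c \<ominus> d \<in> F"
  unfolding a_minus_def using subringE(5,7)[OF subfieldE(1)[OF F(1)]] by blast

lemma e_minus:
  assumes "c \<in> Z i" shows "e i \<ominus> c \<in> F" "e i \<ominus> c \<noteq> \<zero>"
proof -
  have c: "c \<in> F" using Z(2) assms by blast
  show "e i \<ominus> c \<in> F" by (rule F_diff[OF e(1) c])
  show "e i \<ominus> c \<noteq> \<zero>" using r_right_minus_eq[OF F_carrier[OF e(1)] F_carrier[OF c], of i] e(2)[of i] assms by auto
qed

text \<open>The ramification bound puts the value group inside \<open>(1/N) \<int>\<close>, so it is
  cyclic, generated by its least positive element. Only single stages of the chain come with such a
  bound, which is why witnesses are chosen at stages and not in the union.\<close>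

lemma discrete:
  assumes K: "fld K" and v: "v \<in> Val"
  shows "\<exists>s\<in>K. s \<noteq> \<zero> \<and> 0 < v s \<and> (\<forall>z\<in>K. z \<noteq> \<zero> \<longrightarrow> (\<exists>k::int. v z = of_int k * v s))"
proof -
  interpret valuation R v using Val(1)[OF v] .
  note Kf = fldD(1)[OF K]
  obtain N :: nat where N: "0 < N" "\<And>z. z \<in> K \<Longrightarrow> z \<noteq> \<zero> \<Longrightarrow> real N * v z \<in> \<int>"
    using K v unfolding fld_def by blast
  \<comment> \<open>Positive values are encoded by natural numbers \<open>n\<close>, as
    \<open>n / N\<close>, so that a least one exists.\<close>
  define D where "D n \<longleftrightarrow> 0 < n \<and> (\<exists>\<gamma>\<in>vals K. real N * \<gamma> = real n)" for n :: nat
  have pos: "\<exists>n. D n \<and> real n = real N * \<gamma>" if g: "\<gamma> \<in> vals K" "0 < \<gamma>" for \<gamma>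
  proof -
    obtain z where z: "z \<in> K" "z \<noteq> \<zero>" "\<gamma> = v z" using g(1) valsE by blast
    have int: "real N * \<gamma> \<in> \<int>" using N(2) z by simp
    then obtain k :: int where k: "real N * \<gamma> = of_int k" unfolding Ints_def by auto
    have "0 < real N * \<gamma>" using g(2) N(1) by simp
    hence "0 < k" using k by simp
    hence "real (nat k) = real N * \<gamma>" "0 < nat k" using k by auto
    thus ?thesis unfolding D_def using g(1) by (metis (no_types))
  qed
  obtain c where c: "c \<in> K" "c \<noteq> \<zero>" "v c \<noteq> 0" using Val(4)[OF v] fldD(2)[OF K] by blast
  have "\<exists>\<gamma>\<in>vals K. 0 < \<gamma>"
  proof (cases "0 < v c")
    case True thus ?thesis using valsI[OF c(1,2)] by blast
  next
    case False
    hence "0 < - v c" using c(3) by simp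
    thus ?thesis using vals_minus[OF Kf valsI[OF c(1,2)]] by blast
  qed
  hence "\<exists>n. D n" using pos by blast
  then have L: "D (LEAST n. D n)" by (rule LeastI_ex)
  define l where "l = (LEAST n. D n)"
  obtain \<sigma> where \<sigma>: "0 < l" "\<sigma> \<in> vals K" "real N * \<sigma> = real l" using L unfolding l_def D_def by blast
  have l_min: "l \<le> n" if "D n" for n unfolding l_def by (rule Least_le[of D, OF that])
  have \<sigma>pos: "0 < \<sigma>" using \<sigma>(1,3) N(1) zero_less_mult_pos[of "real N" \<sigma>] by simp
  have mult: "\<exists>k::int. \<gamma> = of_int k * \<sigma>" if g: "\<gamma> \<in> vals K" for \<gamma>
  proof -
    define k where "k = \<lfloor>\<gamma> / \<sigma>\<rfloor>"
    define \<rho> where "\<rho> = \<gamma> + of_int (- k) * \<sigma>"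
    have "of_int k \<le> \<gamma> / \<sigma>" "\<gamma> / \<sigma> < of_int k + 1" unfolding k_def by linarith+
    hence r: "0 \<le> \<rho>" "\<rho> < \<sigma>" unfolding \<rho>_def using \<sigma>pos by (simp_all add: field_simps)
    have "\<rho> = 0"
    proof (rule ccontr)
      assume "\<rho> \<noteq> 0"
      hence "0 < \<rho>" using r by simp
      moreover have "\<rho> \<in> vals K" unfolding \<rho>_def by (intro vals_add[OF Kf g] vals_int[OF Kf \<sigma>(2)])
      ultimately obtain n where n: "D n" "real n = real N * \<rho>" using pos by blast
      have "real N * \<rho> < real N * \<sigma>" using r(2) N(1) by simp
      hence "n < l" using n(2) \<sigma>(3) by simp
      thus False using l_min[OF n(1)] by simp
    qed
    thus ?thesis unfolding \<rho>_def by (intro exI[of _ k]) simp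
  qed
  obtain s where s: "s \<in> K" "s \<noteq> \<zero>" "\<sigma> = v s" using \<sigma>(2) valsE by blast
  show ?thesis using s(1,2) \<sigma>pos mult[OF valsI] unfolding s(3) by blast
qed

lemma okD: "ok K P \<Longrightarrow> fld K" "ok K P \<Longrightarrow> finite P" "ok K P \<Longrightarrow> (i, v, s, x) \<in> P \<Longrightarrow> place K i v s x"
  unfolding ok_def by auto

lemma placeD: "place K i v s x \<Longrightarrow> v \<in> Val" "place K i v s x \<Longrightarrow> y \<in> Y i \<Longrightarrow> y \<noteq> \<zero> \<Longrightarrow> 0 \<le> v y"
  unfolding place_def by auto

definition "vset P = (\<lambda>(i, v, s, x). v) ` P"

lemma vset:
  assumes "ok K P" shows "finite (vset P)" "vset P \<subseteq> Val" "(i, v, s, x) \<in> P \<Longrightarrow> v \<in> vset P"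
proof -
  show "finite (vset P)" unfolding vset_def using okD(2)[OF assms] by simp
  show "vset P \<subseteq> Val"
  proof
    fix w assume "w \<in> vset P"
    then obtain i s x where "(i, w, s, x) \<in> P" unfolding vset_def by auto
    from placeD(1)[OF okD(3)[OF assms this]] show "w \<in> Val" .
  qed
  show "(i, v, s, x) \<in> P \<Longrightarrow> v \<in> vset P" unfolding vset_def by force
qed

lemma good_pole:
  assumes K: "fld K" and v: "v \<in> Val" and g: "g \<in> carrier R" "g \<noteq> \<zero>" "v g < 0" "v g = real (q i) * \<gamma>"
    and \<gamma>: "\<gamma> \<in> valuation.vals R v K"
  shows "good K i v (g \<oplus> e i)"
proof (rule good_uniform[OF K v _ _ \<gamma>])
  show "g \<oplus> e i \<in> carrier R" using g(1) F_carrier[OF e(1)] by simp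
  fix c assume "c \<in> Z i"
  hence "c \<in> F" using Z(2) by blast
  from v_minus_const[OF v g(1-3) e(1) this] g(4) show "g \<oplus> e i \<noteq> c \<and> v ((g \<oplus> e i) \<ominus> c) = real (q i) * \<gamma>" by simp
qed

text \<open>Elements of \<open>Y i\<close> are integral at the recorded places of index
  \<open>i\<close>. This leaves enough freedom to choose \<open>w\<close> such that a root for
  \<open>G i s y w\<close> can be adjoined without enlarging the value group at any of them; as only
  finitely many places are recorded, a generic \<open>w\<close> in \<open>F\<close> will do.\<close>

lemma promise:
  assumes ok: "ok K P" and y: "y \<in> Y i" and s: "s \<in> K" and root: "has_root K i (s \<oplus> e i)"
  shows "\<exists>K'. K \<subseteq> K' \<and> ok K' P \<and> (\<exists>w\<in>K'. has_root K' i (G i s y w))"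
proof (cases "s = \<zero>")
  case True
  have K: "fld K" using okD(1)[OF ok] .
  have car: "y \<in> carrier R" "e i \<in> carrier R" using y Y K0(1) subfieldE(3) F_carrier[OF e(1)] by blast+
  \<comment> \<open>For \<open>s = \<zero>\<close> both arguments of \<open>R_i\<close> are
    \<open>e i\<close>, so the given root serves.\<close>
  have "G i s y \<zero> = s \<oplus> e i" unfolding G_def True using car q_pos[of i] by (simp add: nat_pow_zero)
  hence "has_root K i (G i s y \<zero>)" using root by simp
  moreover have "\<zero> \<in> K" using subringE(2)[OF fldD(5)[OF K]] .
  ultimately show ?thesis using ok by blast
next
  case s0: False
  have K: "fld K" using okD(1)[OF ok] .
  note Kf = fldD(1)[OF K] note Kc = fldD(4)[OF K]
  define n where "n = q i * q i"
  have n: "0 < n" unfolding n_def using q_pos by simp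
  have yK: "y \<in> K" using y Y fldD(2)[OF K] by blast
  have car: "s \<in> carrier R" "y \<in> carrier R" "e i \<in> carrier R" using s yK fld_e[OF K] Kc by blast+
  define u where "u = s \<otimes> s [^] q i"
  define b where "b = s \<otimes> y [^] n"
  have uc: "u \<in> carrier R" "u \<noteq> \<zero>" and bc: "b \<in> carrier R" unfolding u_def b_def using car s0 by (simp_all add: integral_iff)
  have Geq: "G i s y w = (u \<otimes> w [^] n \<oplus> b) \<oplus> e i" if "w \<in> carrier R" for w
  proof -
    have "w [^] n \<in> carrier R" "s [^] q i \<in> carrier R" "y [^] n \<in> carrier R" using that car by simp_all
    thus ?thesis unfolding G_def u_def b_def n_def[symmetric] using car by algebra
  qed
  have ZF: "c \<in> F" "c \<in> carrier R" if "c \<in> Z i" for c using that Z(2) F_carrier by blast+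
  \<comment> \<open>The values that \<open>w^n\<close> has to avoid: those that put \<open>h\<close>
    into \<open>Z i\<close> or, at a recorded place where \<open>u\<close> is a unit, into the
    residue class of an element of \<open>Z i\<close>.\<close>
  define bad where "bad = (\<Union>c\<in>Z i. {w \<in> F. u \<otimes> w \<oplus> (b \<oplus> (e i \<ominus> c)) = \<zero> \<or>
    (\<exists>v\<in>vset P. v u = 0 \<and> u \<otimes> w \<oplus> (b \<oplus> (e i \<ominus> c)) \<noteq> \<zero> \<and> 0 < v (u \<otimes> w \<oplus> (b \<oplus> (e i \<ominus> c))))})"
  have "finite bad" unfolding bad_def
    by (intro finite_UN_I Z(1) finite_bad[OF uc] a_closed bc F_carrier[OF e_minus(1)] vset(1,2)[OF ok])
  moreover have "bad \<subseteq> carrier R" unfolding bad_def using F_carrier by blast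
  ultimately have "finite (\<Union>a\<in>insert \<zero> bad. {w \<in> carrier R. w [^] n = a})"
    by (intro finite_UN_I finite_nth_roots n) (simp, blast)
  \<comment> \<open>An excluded power has only finitely many \<open>n\<close>-th roots, so the
    infinite field \<open>F\<close> contains an admissible \<open>w\<close>.\<close>
  hence "\<not> F \<subseteq> (\<Union>a\<in>insert \<zero> bad. {w \<in> carrier R. w [^] n = a})" using F(2) by (meson finite_subset)
  then obtain w where w: "w \<in> F" "w \<notin> (\<Union>a\<in>insert \<zero> bad. {w \<in> carrier R. w [^] n = a})" unfolding subset_eq Ball_def by (meson)
  have wc: "w \<in> carrier R" using F_carrier[OF w(1)] .
  have w0: "w [^] n \<noteq> \<zero>" and wbad: "w [^] n \<notin> bad" using w(2) wc by auto
  have wF: "w [^] n \<in> F" by (rule subring_pow[OF subfieldE(1)[OF F(1)] w(1)])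
  define g where "g = u \<otimes> w [^] n \<oplus> b"
  have gc: "g \<in> carrier R" unfolding g_def using uc bc wc by simp
  define h where "h = g \<oplus> e i"
  have hG: "h = G i s y w" unfolding h_def g_def Geq[OF wc] ..
  have hc: "h \<in> carrier R" unfolding h_def using gc car by simp
  have hK: "h \<in> K" unfolding hG by (rule G_closed[OF K s yK]) (use w(1) fldD(3)[OF K] in blast)
  have hm: "h \<ominus> c = u \<otimes> w [^] n \<oplus> (b \<oplus> (e i \<ominus> c))" if "c \<in> Z i" for c
  proof -
    have "w [^] n \<in> carrier R" using wc by simp
    thus ?thesis unfolding h_def g_def using uc bc car ZF(2)[OF that] by algebra
  qed
  have nz: "h \<ominus> c \<noteq> \<zero>" if "c \<in> Z i" for c
    using wbad wF that unfolding hm[OF that] bad_def by blast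
  have nZ: "h \<noteq> c" if "c \<in> Z i" for c using nz[OF that] r_right_minus_eq[OF hc ZF(2)[OF that]] by simp
  have "good K i v h" if p: "(i, v, s', x) \<in> P" for v s' x
  proof -
    note pl = okD(3)[OF ok p]
    note v = placeD(1)[OF pl]
    interpret valuation R v using Val(1)[OF v] .
    have vu: "v u = real (q i + 1) * v s" unfolding u_def using v_mult[of s "s [^] q i"] v_pow[of s "q i"] car s0
      by (simp add: algebra_simps)
    have vw: "v (w [^] n) = 0" by (rule Val(2)[OF v wF w0])
    have vuw: "u \<otimes> w [^] n \<noteq> \<zero>" "v (u \<otimes> w [^] n) = real (q i + 1) * v s"
      using v_mult[of u "w [^] n"] vu vw uc w0 wc by (simp_all add: integral_iff)
    have "y [^] n \<in> vge 0"
    proof -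
      have "y \<in> vge 0" using placeD(2)[OF pl y] car unfolding vge_def by blast
      thus ?thesis by (rule subring_pow[OF vge_subring])
    qed
    hence "s \<otimes> y [^] n \<in> vge (v s + 0)" by (rule vge_mult[rotated]) (simp add: vge_def car)
    hence bv: "b \<in> vge (v s)" unfolding b_def by simp
    consider "0 < v s" | "v s = 0" | "v s < 0" by linarith
    thus ?thesis
    proof cases
      \<comment> \<open>A zero of \<open>s\<close>: then \<open>g\<close> is small and
        \<open>h\<close> lies in the residue class of \<open>e i\<close>, which differs from those
        of \<open>Z i\<close>.\<close>
      case 1
      have "u \<otimes> w [^] n \<in> vgt 0" unfolding vgt_def using vuw 1 uc wc by simp
      hence g0: "g \<in> vgt 0" unfolding g_def using vgt_add vge_vgt[OF bv 1] by blast
      show ?thesis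
      proof (rule good_unit[OF K v hc])
        fix c assume c: "c \<in> Z i"
        have "h \<ominus> c = (e i \<ominus> c) \<oplus> g" unfolding h_def using gc car ZF(2)[OF c] by algebra
        moreover have "v (e i \<ominus> c) = 0" by (rule Val(2)[OF v e_minus[OF c]])
        moreover have "g = \<zero> \<or> v (e i \<ominus> c) < v g" using g0 \<open>v (e i \<ominus> c) = 0\<close> by (auto simp: vgt_def)
        ultimately show "h \<noteq> c \<and> v (h \<ominus> c) = 0"
          using v_add_eq[OF F_carrier[OF e_minus(1)[OF c]] e_minus(2)[OF c] gc] nZ[OF c] by simp
      qed
    next
      case 2
      hence vu0: "v u = 0" using vu by simp
      show ?thesis
      proof (rule good_unit[OF K v hc])
        fix c assume c: "c \<in> Z i"
        have "v (e i \<ominus> c) = 0" by (rule Val(2)[OF v e_minus[OF c]])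
        hence e0: "e i \<ominus> c \<in> vge 0" using F_carrier[OF e_minus(1)[OF c]] by (simp add: vge_def)
        have "u \<otimes> w [^] n \<in> vge 0" using vuw 2 uc wc by (simp add: vge_def)
        hence "h \<ominus> c \<in> vge 0" unfolding hm[OF c] using vge_add e0 bv 2 by simp
        hence "0 \<le> v (h \<ominus> c)" using nz[OF c] by (simp add: vge_def)
        moreover have "\<not> 0 < v (h \<ominus> c)"
        proof
          assume "0 < v (h \<ominus> c)"
          hence "w [^] n \<in> bad" unfolding bad_def using c wF vset(3)[OF ok p] vu0 nz[OF c] unfolding hm[OF c] by blast
          thus False using wbad by blast
        qed
        ultimately show "h \<noteq> c \<and> v (h \<ominus> c) = 0" using nZ[OF c] by simp
      qed
    next
      \<comment> \<open>A pole of \<open>s\<close>: as \<open>y\<close> is integral,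
        \<open>s^(q+1) w^n\<close> dominates \<open>s y^n\<close>. Its value
        \<open>(q + 1) v(s)\<close> is divisible by \<open>q\<close>, because the root assumed for
        \<open>s + e i\<close> makes \<open>v s\<close> divisible.\<close>
      case 3
      from root_pole_divisible[OF K v s s0 3 root] obtain \<eta> where \<eta>: "\<eta> \<in> vals K" "v s = real (q i) * \<eta>" by blast
      have "real (q i) * v s < 0" using 3 q_pos by (simp add: mult_pos_neg)
      hence "v (u \<otimes> w [^] n) < v s" using vuw(2) by (simp add: algebra_simps)
      hence "b = \<zero> \<or> v (u \<otimes> w [^] n) < v b" using bv by (auto simp: vge_def)
      from v_add_eq[OF _ vuw(1) bc this] have g: "g \<noteq> \<zero>" "v g = real (q i + 1) * v s"
        unfolding g_def using vuw(2) uc wc by auto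
      have "v g < 0" "v g = real (q i) * (real (q i + 1) * \<eta>)" using \<open>v (u \<otimes> w [^] n) < v s\<close> 3 vuw(2) g(2) \<eta>(2) by auto
      from good_pole[OF K v gc g(1) this vals_nat[OF Kf \<eta>(1)]] show ?thesis unfolding h_def .
    qed
  qed
  hence good: "\<forall>v s x. (i, v, s, x) \<in> P \<longrightarrow> good K i v h" by blast
  have hZ: "h \<notin> Z i" using nZ by blast
  from adjoin[OF ok hK hZ good] obtain K' where K': "K \<subseteq> K'" "ok K' P" "has_root K' i h" by blast
  have "w \<in> K'" using w(1) fldD(3)[OF K] K'(1) by blast
  thus ?thesis using K' unfolding hG by blast
qed

text \<open>The witness \<open>s\<close> should generate the value group at \<open>v\<close>, and a
  root for \<open>s + e i\<close> should be available without ramification at \<open>v\<close> and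
  at all recorded places. It suffices that \<open>s\<close> has the same value at \<open>v\<close>
  as a generator \<open>r\<close>, and that \<open>s + e i\<close> stays away from
  \<open>Z i\<close> at all these places.\<close>

lemma demand:
  assumes ok: "ok K P" and x: "x \<in> K" "x \<noteq> \<zero>" and v: "v \<in> Val" "v x < 0" and Yv: "\<forall>y\<in>Y i. y = \<zero> \<or> 0 \<le> v y"
  shows "\<exists>K' s. K \<subseteq> K' \<and> ok K' (insert (i, v, s, x) P)"
proof -
  have K: "fld K" using okD(1)[OF ok] .
  note Kf = fldD(1)[OF K] note Kc = fldD(4)[OF K] note Kr = fldD(5)[OF K]
  obtain r where r: "r \<in> K" "r \<noteq> \<zero>" "0 < v r" and disc: "\<And>z. z \<in> K \<Longrightarrow> z \<noteq> \<zero> \<Longrightarrow> \<exists>k::int. v z = of_int k * v r"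
    using discrete[OF K v(1)] by blast
  have rc: "r \<in> carrier R" using r(1) Kc by blast
  define V where "V = insert v (vset P)"
  have V: "finite V" "V \<subseteq> Val" unfolding V_def using vset[OF ok] v(1) by auto
  \<comment> \<open>The witness will be \<open>s = r / (c + r^2)\<close>: poles of \<open>r\<close>
    become zeros of \<open>s\<close>, and for generic \<open>c\<close> the denominator is a unit
    where \<open>r\<close> is integral. \<open>num (e i \<ominus> d) c\<close> is the numerator of
    \<open>s + e i - d\<close>.\<close>
  define den where "den c = \<one> \<otimes> c \<oplus> r \<otimes> r" for c
  define num where "num a c = a \<otimes> c \<oplus> (r \<oplus> a \<otimes> (r \<otimes> r))" for a c
  define bad where "bad = {c \<in> F. den c = \<zero> \<or> (\<exists>v\<in>V. v \<one> = 0 \<and> den c \<noteq> \<zero> \<and> 0 < v (den c))} \<union>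
    (\<Union>d\<in>Z i. {c \<in> F. num (e i \<ominus> d) c = \<zero> \<or>
       (\<exists>v\<in>V. v (e i \<ominus> d) = 0 \<and> num (e i \<ominus> d) c \<noteq> \<zero> \<and> 0 < v (num (e i \<ominus> d) c))})"
  have "finite bad" unfolding bad_def den_def num_def
    by (intro finite_UnI finite_UN_I Z(1) finite_bad a_closed m_closed rc F_carrier[OF e_minus(1)] e_minus(2) one_closed V) simp_all
  hence "finite (insert \<zero> bad)" by simp
  hence "\<not> F \<subseteq> insert \<zero> bad" using F(2) by (meson finite_subset)
  then obtain c where c: "c \<in> F" "c \<noteq> \<zero>" "c \<notin> bad" by blast
  have cc: "c \<in> carrier R" using F_carrier[OF c(1)] .
  \<comment> \<open>One computation for numerator and denominator, with \<open>b\<close> equal to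
    \<open>r\<close> or to zero. At a pole of \<open>r\<close> the term \<open>a r^2\<close>
    dominates; elsewhere all terms are integral, and the choice of \<open>c\<close> prevents
    cancellation. Both values agree, so the quotient is a unit.\<close>
  have unit: "a \<otimes> c \<oplus> (b \<oplus> a \<otimes> (r \<otimes> r)) \<noteq> \<zero> \<and> w (a \<otimes> c \<oplus> (b \<oplus> a \<otimes> (r \<otimes> r))) = (if w r < 0 then 2 * w r else 0)"
    if w: "w \<in> V" and a: "a \<in> F" "a \<noteq> \<zero>" and b: "b \<in> carrier R" "b = \<zero> \<or> w r \<le> w b"
      and nb: "\<not> (a \<otimes> c \<oplus> (b \<oplus> a \<otimes> (r \<otimes> r)) = \<zero> \<or>
       (\<exists>v\<in>V. v a = 0 \<and> a \<otimes> c \<oplus> (b \<oplus> a \<otimes> (r \<otimes> r)) \<noteq> \<zero> \<and> 0 < v (a \<otimes> c \<oplus> (b \<oplus> a \<otimes> (r \<otimes> r)))))" for w a b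
  proof -
    have wV: "w \<in> Val" using w V(2) by blast
    interpret valuation R w using Val(1)[OF wV] .
    have ac: "a \<in> carrier R" using F_carrier[OF a(1)] .
    have wa: "w a = 0" by (rule Val(2)[OF wV a])
    have wac: "w (a \<otimes> c) = 0" using v_mult[of a c] wa Val(2)[OF wV c(1,2)] ac a(2) cc c(2) by simp
    have rr: "a \<otimes> (r \<otimes> r) \<in> carrier R" "a \<otimes> (r \<otimes> r) \<noteq> \<zero>" "w (a \<otimes> (r \<otimes> r)) = 2 * w r"
      using v_mult[of a "r \<otimes> r"] v_mult[of r r] wa ac a(2) rc r(2) by (simp_all add: integral_iff)
    show ?thesis
    proof (cases "w r < 0")
      case True
      have "a \<otimes> c \<in> vgt (2 * w r)" "b \<in> vgt (2 * w r)" unfolding vgt_def using wac True ac cc b by auto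
      hence "a \<otimes> c \<oplus> b \<in> vgt (2 * w r)" by (rule vgt_add)
      hence "a \<otimes> c \<oplus> b = \<zero> \<or> w (a \<otimes> (r \<otimes> r)) < w (a \<otimes> c \<oplus> b)" unfolding rr(3) by (simp add: vgt_def)
      from v_add_eq[OF rr(1,2) _ this] ac cc b(1) rr(3)
      have *: "a \<otimes> (r \<otimes> r) \<oplus> (a \<otimes> c \<oplus> b) \<noteq> \<zero>" "w (a \<otimes> (r \<otimes> r) \<oplus> (a \<otimes> c \<oplus> b)) = 2 * w r" by auto
      have "a \<otimes> c \<oplus> (b \<oplus> a \<otimes> (r \<otimes> r)) = a \<otimes> (r \<otimes> r) \<oplus> (a \<otimes> c \<oplus> b)" using ac cc rr(1) b(1) rc by algebra
      thus ?thesis using * True by simp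
    next
      case False
      have "a \<otimes> c \<in> vge 0" "b \<in> vge 0" "a \<otimes> (r \<otimes> r) \<in> vge 0" unfolding vge_def using wac False ac cc b rr by auto
      hence "a \<otimes> c \<oplus> (b \<oplus> a \<otimes> (r \<otimes> r)) \<in> vge 0" by (intro vge_add)
      moreover have "a \<otimes> c \<oplus> (b \<oplus> a \<otimes> (r \<otimes> r)) \<noteq> \<zero>" "\<not> 0 < w (a \<otimes> c \<oplus> (b \<oplus> a \<otimes> (r \<otimes> r)))" using nb w wa by blast+
      ultimately show ?thesis using False by (simp add: vge_def)
    qed
  qed
  have denK: "den c \<in> K" unfolding den_def by (intro subringE(6,7,3)[OF Kr] r) (use c(1) fldD(3)[OF K] in blast)
  hence denc: "den c \<in> carrier R" using Kc by blast
  have den1: "den c = \<one> \<otimes> c \<oplus> (\<zero> \<oplus> \<one> \<otimes> (r \<otimes> r))" unfolding den_def using rc cc by simp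
  have den: "den c \<noteq> \<zero> \<and> w (den c) = (if w r < 0 then 2 * w r else 0)" if w: "w \<in> V" for w
    unfolding den1
  proof (rule unit[OF w])
    show "\<one> \<in> F" using subringE(3)[OF subfieldE(1)[OF F(1)]] .
    show "\<not> (\<one> \<otimes> c \<oplus> (\<zero> \<oplus> \<one> \<otimes> (r \<otimes> r)) = \<zero> \<or>
       (\<exists>v\<in>V. v \<one> = 0 \<and> \<one> \<otimes> c \<oplus> (\<zero> \<oplus> \<one> \<otimes> (r \<otimes> r)) \<noteq> \<zero> \<and> 0 < v (\<one> \<otimes> c \<oplus> (\<zero> \<oplus> \<one> \<otimes> (r \<otimes> r)))))"
      using c(1,3) unfolding bad_def den1[symmetric] by blast
  qed simp_all
  have num: "num (e i \<ominus> d) c \<noteq> \<zero> \<and> w (num (e i \<ominus> d) c) = (if w r < 0 then 2 * w r else 0)"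
    if w: "w \<in> V" and d: "d \<in> Z i" for w d
    unfolding num_def
  proof (rule unit[OF w e_minus[OF d] rc])
    show "\<not> ((e i \<ominus> d) \<otimes> c \<oplus> (r \<oplus> (e i \<ominus> d) \<otimes> (r \<otimes> r)) = \<zero> \<or> (\<exists>v\<in>V. v (e i \<ominus> d) = 0 \<and> (e i \<ominus> d) \<otimes> c \<oplus> (r \<oplus> (e i \<ominus> d) \<otimes> (r \<otimes> r)) \<noteq> \<zero>
       \<and> 0 < v ((e i \<ominus> d) \<otimes> c \<oplus> (r \<oplus> (e i \<ominus> d) \<otimes> (r \<otimes> r)))))"
      using c(1,3) d unfolding bad_def num_def[symmetric] by blast
  qed simp
  have vV: "v \<in> V" unfolding V_def by blast
  note dnz = den[OF vV, THEN conjunct1]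
  define s where "s = r \<otimes> inv (den c)"
  have sK: "s \<in> K" unfolding s_def by (intro subringE(6)[OF Kr] r(1)) (use subfield_m_inv(1)[OF Kf, of "den c"] denK dnz in blast)
  have sc: "s \<in> carrier R" using sK Kc by blast
  define h where "h = s \<oplus> e i"
  have hK: "h \<in> K" unfolding h_def by (rule subringE(7)[OF Kr sK fld_e[OF K]])
  have hc: "h \<in> carrier R" using hK Kc by blast
  have hm: "h \<ominus> d = num (e i \<ominus> d) c \<otimes> inv (den c)" if d: "d \<in> Z i" for d
  proof -
    have ic: "inv (den c) \<in> carrier R" and i1: "den c \<otimes> inv (den c) = \<one>" using denc dnz by simp_all
    have ac: "e i \<ominus> d \<in> carrier R" using F_carrier[OF e_minus(1)[OF d]] .
    have dc: "d \<in> carrier R" using F_carrier Z(2) d by blast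
    have "num (e i \<ominus> d) c = r \<oplus> (e i \<ominus> d) \<otimes> den c" unfolding num_def den_def using rc cc ac by algebra
    hence "num (e i \<ominus> d) c \<otimes> inv (den c) = s \<oplus> (e i \<ominus> d) \<otimes> (den c \<otimes> inv (den c))"
      unfolding s_def using rc ac denc ic by algebra
    also have "\<dots> = h \<ominus> d" unfolding h_def i1 using sc dc F_carrier[OF e(1), of i] by algebra
    finally show ?thesis by simp
  qed
  have hunit: "h \<noteq> d \<and> w (h \<ominus> d) = 0" if w: "w \<in> V" and d: "d \<in> Z i" for w d
  proof -
    have wV: "w \<in> Val" using w V(2) by blast
    interpret valuation R w using Val(1)[OF wV] .
    have nc: "num (e i \<ominus> d) c \<in> carrier R" unfolding num_def using rc cc F_carrier[OF e_minus(1)[OF d]] by simp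
    have dc: "d \<in> carrier R" using F_carrier Z(2) d by blast
    have "w (h \<ominus> d) = 0" unfolding hm[OF d] using v_mult[of "num (e i \<ominus> d) c" "inv (den c)"] v_inv[OF denc dnz]
      num[OF w d] den[OF w] nc denc dnz nonzero_imp_inverse_nonzero[OF denc dnz] by simp
    moreover have "h \<ominus> d \<noteq> \<zero>" unfolding hm[OF d] using num[OF w d] nc denc dnz nonzero_imp_inverse_nonzero[OF denc dnz] by (simp add: integral_iff)
    ultimately show ?thesis using r_right_minus_eq[OF hc dc] by simp
  qed
  have hgood: "good K i w h" if w: "w \<in> V" for w
    by (rule good_unit[OF K _ hc hunit[OF w]]) (use w V(2) in blast)+
  have hZ: "h \<notin> Z i" using hunit[OF vV] by blast
  have "good K i w h" if "(i, w, s', x') \<in> P" for w s' x' by (rule hgood) (use vset(3)[OF ok that] in \<open>simp add: V_def\<close>)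
  hence good: "\<forall>w s x. (i, w, s, x) \<in> P \<longrightarrow> good K i w h" by blast
  from adjoin[OF ok hK hZ good] hgood[OF vV] v(1) obtain K' where K': "K \<subseteq> K'" "ok K' P" "has_root K' i h"
    and unram: "\<And>z. z \<in> K' \<Longrightarrow> z \<noteq> \<zero> \<Longrightarrow> \<exists>b\<in>K. b \<noteq> \<zero> \<and> v z = v b" by blast
  interpret valuation R v using Val(1)[OF v(1)] .
  have vs: "s \<noteq> \<zero>" "v s = v r" unfolding s_def using v_mult[of r "inv (den c)"] v_inv[OF denc dnz] den[OF vV] r rc denc dnz nonzero_imp_inverse_nonzero[OF denc dnz]
    by (simp_all add: integral_iff)
  \<comment> \<open>\<open>v x\<close> is a negative multiple of the least positive value, which is
    \<open>v r = v s\<close>.\<close>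
  have "v x \<le> - v s"
  proof -
    obtain k :: int where k: "v x = of_int k * v r" using disc[OF x] by blast
    have "k < 0" using v(2) r(3) unfolding k by (simp add: mult_less_0_iff)
    hence "of_int k * v r \<le> (- 1) * v r" using r(3) by (intro mult_right_mono) simp_all
    thus ?thesis unfolding k vs(2) by simp
  qed
  \<comment> \<open>The value group at \<open>v\<close> has not grown, so \<open>v s\<close> still
    generates it, and a generator is not divisible by a prime.\<close>
  moreover have "v s \<noteq> real (q i) * v a" if a: "a \<in> K'" "a \<noteq> \<zero>" for a
  proof
    assume eq: "v s = real (q i) * v a"
    obtain b where b: "b \<in> K" "b \<noteq> \<zero>" "v a = v b" using unram[OF a] by blast
    obtain k :: int where k: "v b = of_int k * v r" using disc[OF b(1,2)] by blast
    have "1 * v r = of_int (int (q i) * k) * v r" using eq unfolding vs(2) b(3) k by simp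
    hence "real_of_int (int (q i) * k) = 1" using r(3) unfolding mult_cancel_right by simp
    hence "int (q i) * k = 1" by linarith
    hence "int (q i) dvd 1" by (metis dvd_triv_left)
    thus False using prime_gt_1_nat[OF q(1)[of i]] by simp
  qed
  ultimately have "place K' i v s x" unfolding place_def
    using v(1) sK K'(1) vs r(3) x Yv K'(3) unfolding h_def by auto
  hence "ok K' (insert (i, v, s, x) P)" using K'(2) unfolding ok_def by auto
  thus ?thesis using K'(1) by blast
qed

text \<open>An index without recorded places imposes no condition on the adjunction. The inverse of
  an element of least positive value has a pole of indivisible order, so the corresponding root
  cannot exist yet.\<close>

lemma strict:
  assumes ok: "ok K P"
  shows "\<exists>K'. K \<subset> K' \<and> ok K' P"
proof -
  have K: "fld K" using okD(1)[OF ok] .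
  note Kf = fldD(1)[OF K] note Kc = fldD(4)[OF K] note Kr = fldD(5)[OF K]
  have "finite (fst ` P)" using okD(2)[OF ok] by simp
  then obtain i where i: "i \<notin> fst ` P" using ex_new_if_finite[OF infinite_UNIV_nat] by blast
  obtain v where v: "v \<in> Val" using Val(5) by blast
  interpret valuation R v using Val(1)[OF v] .
  obtain r where r: "r \<in> K" "r \<noteq> \<zero>" "0 < v r" and disc: "\<And>z. z \<in> K \<Longrightarrow> z \<noteq> \<zero> \<Longrightarrow> \<exists>k::int. v z = of_int k * v r"
    using discrete[OF K v] by blast
  have rc: "r \<in> carrier R" using r(1) Kc by blast
  define g where "g = inv r"
  have gK: "g \<in> K" unfolding g_def using subfield_m_inv(1)[OF Kf, of r] r by blast
  have gc: "g \<in> carrier R" using gK Kc by blast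
  have g: "g \<noteq> \<zero>" "v g = - v r" unfolding g_def using v_inv[OF rc r(2)] nonzero_imp_inverse_nonzero[OF rc r(2)] by simp_all
  have vg: "v g < 0" using g(2) r(3) by simp
  have hK: "g \<oplus> e i \<in> K" by (rule subringE(7)[OF Kr gK fld_e[OF K]])
  have hZ: "g \<oplus> e i \<notin> Z i" using v_minus_const(1)[OF v gc g(1) vg e(1)] Z(2) by blast
  have "\<not> has_root K i (g \<oplus> e i)"
  proof
    assume "has_root K i (g \<oplus> e i)"
    from root_pole_divisible[OF K v gK g(1) vg this] obtain \<eta> where \<eta>: "\<eta> \<in> vals K" "v g = real (q i) * \<eta>" by blast
    obtain b where b: "b \<in> K" "b \<noteq> \<zero>" "\<eta> = v b" using \<eta>(1) valsE by blast
    obtain k :: int where k: "v b = of_int k * v r" using disc[OF b(1,2)] by blast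
    have "(- 1) * v r = of_int (int (q i) * k) * v r" using \<eta>(2) unfolding g(2) b(3) k by simp
    hence "real_of_int (int (q i) * k) = - 1" using r(3) unfolding mult_cancel_right by simp
    hence "int (q i) * k = - 1" by linarith
    hence "int (q i) dvd - 1" by (metis dvd_triv_left)
    thus False using prime_gt_1_nat[OF q(1)[of i]] by simp
  qed
  moreover have "\<forall>v s x. (i, v, s, x) \<in> P \<longrightarrow> good K i v (g \<oplus> e i)" using i by force
  ultimately show ?thesis using adjoin[OF ok hK hZ] by blast
qed

text \<open>The finite conditions \<open>ok K P\<close> play the role of forcing conditions: at step
  \<open>n\<close> the task \<open>D n\<close> is met if some further condition meets it, and
  otherwise it is out of reach for good. Strict growth is built in for the sake of infinite
  degree.\<close>

lemma generic_chain:
  "\<exists>\<kappa> \<pi>. \<forall>n::nat. ok (\<kappa> n) (\<pi> n) \<and> \<kappa> n \<subset> \<kappa> (Suc n) \<and> \<pi> n \<subseteq> \<pi> (Suc n) \<and>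
    (D n (\<kappa> (Suc n)) (\<pi> (Suc n)) \<or> (\<forall>K P. ok K P \<and> \<kappa> (Suc n) \<subseteq> K \<and> \<pi> (Suc n) \<subseteq> P \<longrightarrow> \<not> D n K P))"
proof -
  define Q where "Q n \<sigma> \<tau> \<longleftrightarrow> fst \<sigma> \<subset> fst \<tau> \<and> snd \<sigma> \<subseteq> snd \<tau> \<and>
    (D n (fst \<tau>) (snd \<tau>) \<or> (\<forall>K P. ok K P \<and> fst \<tau> \<subseteq> K \<and> snd \<tau> \<subseteq> P \<longrightarrow> \<not> D n K P))" for n \<sigma> \<tau>
  have "fld K0" unfolding fld_def using K0(1) Val(3) by (intro conjI exI[of _ 1]) auto
  hence 1: "\<exists>\<sigma>. ok (fst \<sigma>) (snd \<sigma>)" unfolding ok_def by (intro exI[of _ "(K0, {})"]) simp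
  have 2: "\<exists>\<tau>. ok (fst \<tau>) (snd \<tau>) \<and> Q n \<sigma> \<tau>" if ok: "ok (fst \<sigma>) (snd \<sigma>)" for n \<sigma>
  proof -
    obtain K' where K': "fst \<sigma> \<subset> K'" "ok K' (snd \<sigma>)" using strict[OF ok] by blast
    show ?thesis
    proof (cases "\<exists>K P. ok K P \<and> K' \<subseteq> K \<and> snd \<sigma> \<subseteq> P \<and> D n K P")
      case True
      then obtain K P where "ok K P" "K' \<subseteq> K" "snd \<sigma> \<subseteq> P" "D n K P" by blast
      thus ?thesis using K' unfolding Q_def by (intro exI[of _ "(K, P)"]) auto
    next
      case False
      thus ?thesis using K' unfolding Q_def by (intro exI[of _ "(K', snd \<sigma>)"]) auto
    qed
  qed
  obtain f where "\<forall>n. ok (fst (f n)) (snd (f n)) \<and> Q n (f n) (f (Suc n))"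
    using dependent_nat_choice[of "\<lambda>_ \<sigma>. ok (fst \<sigma>) (snd \<sigma>)" Q, OF 1 2] by blast
  thus ?thesis unfolding Q_def by (intro exI[of _ "\<lambda>n. fst (f n)"] exI[of _ "\<lambda>n. snd (f n)"]) blast
qed

text \<open>Since \<open>R\<close> is countable, so are the tasks. Promises and demands can be
  fulfilled from every stage that contains their data, so the chain meets them all. Recorded places
  persist, and a root in the union that contradicts one of them would already exist at some
  stage.\<close>

theorem generic_field:
  assumes "countable (carrier R)"
  shows "\<exists>K. subfield K R \<and> K0 \<subseteq> K \<and> (\<forall>i. \<forall>y\<in>Y i. \<not> Pole K i y) \<and>
    (\<forall>i. \<forall>x\<in>K. x \<noteq> \<zero> \<longrightarrow> (\<exists>v\<in>Val. v x < 0 \<and> (\<forall>y\<in>Y i. y = \<zero> \<or> 0 \<le> v y)) \<longrightarrow> Pole K i x) \<and>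
    (\<forall>S. finite S \<longrightarrow> S \<subseteq> K \<longrightarrow> (\<exists>L. subfield L R \<and> K0 \<subseteq> L \<and> S \<subseteq> L \<and> L \<subset> K))"
proof -
  \<comment> \<open>\<open>True\<close> asks to record a place for \<open>x\<close> at index
    \<open>i\<close> and ignores the last entry; \<open>False\<close> asks for a \<open>w\<close>
    that provides a root for the pair \<open>x\<close>, \<open>s\<close>.\<close>
  define T where "T = (UNIV :: bool set) \<times> (UNIV :: nat set) \<times> carrier R \<times> carrier R"
  have cT: "countable T" unfolding T_def by (intro countable_SIGMA assms countableI_type)
  define E where "E \<tau> K P \<longleftrightarrow> (case \<tau> of (b, i, x, s) \<Rightarrow> if b then \<exists>v s. (i, v, s, x) \<in> P else \<exists>w\<in>K. has_root K i (G i s x w))"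
    for \<tau> :: "bool \<times> nat \<times> 'a \<times> 'a" and K and P :: "(nat \<times> ('a \<Rightarrow> real) \<times> 'a \<times> 'a) set"
  obtain \<kappa> \<pi> where all: "\<forall>n. ok (\<kappa> n) (\<pi> n) \<and> \<kappa> n \<subset> \<kappa> (Suc n) \<and> \<pi> n \<subseteq> \<pi> (Suc n) \<and>
    (E (from_nat_into T n) (\<kappa> (Suc n)) (\<pi> (Suc n)) \<or>
      (\<forall>K P. ok K P \<and> \<kappa> (Suc n) \<subseteq> K \<and> \<pi> (Suc n) \<subseteq> P \<longrightarrow> \<not> E (from_nat_into T n) K P))"
    using generic_chain[of "\<lambda>n. E (from_nat_into T n)"] by (elim exE) (rule that)
  note chain = all[THEN spec, THEN conjunct1] all[THEN spec, THEN conjunct2, THEN conjunct1]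
    all[THEN spec, THEN conjunct2, THEN conjunct2, THEN conjunct1]
  note dense = all[THEN spec, THEN conjunct2, THEN conjunct2, THEN conjunct2]
  have \<kappa>_mono: "\<kappa> m \<subseteq> \<kappa> n" if "m \<le> n" for m n by (rule lift_Suc_mono_le[of \<kappa>, OF _ that]) (use chain(2) in blast)
  have \<pi>_mono: "\<pi> m \<subseteq> \<pi> n" if "m \<le> n" for m n by (rule lift_Suc_mono_le[of \<pi>, OF _ that]) (use chain(3) in blast)
  have fl: "fld (\<kappa> n)" for n using okD(1)[OF chain(1)] .
  \<comment> \<open>The task has its turn at some step \<open>n\<close>. Attainable from all late
    stages, it is attainable from stage \<open>Suc n\<close> as well, because conditions extending a
    later stage extend that one; so it was met there.\<close>
  have met: "\<exists>n. E \<tau> (\<kappa> n) (\<pi> n)"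
    if \<tau>: "\<tau> \<in> T" and ext: "\<exists>m. \<forall>n\<ge>m. \<exists>K P. ok K P \<and> \<kappa> n \<subseteq> K \<and> \<pi> n \<subseteq> P \<and> E \<tau> K P" for \<tau>
  proof -
    obtain n where n: "from_nat_into T n = \<tau>" using from_nat_into_surj[OF cT \<tau>] by blast
    obtain m where m: "\<And>n. n \<ge> m \<Longrightarrow> \<exists>K P. ok K P \<and> \<kappa> n \<subseteq> K \<and> \<pi> n \<subseteq> P \<and> E \<tau> K P" using ext by blast
    obtain K P where "ok K P" "\<kappa> (max m (Suc n)) \<subseteq> K" "\<pi> (max m (Suc n)) \<subseteq> P" "E \<tau> K P"
      using m[of "max m (Suc n)"] by auto
    moreover have "\<kappa> (Suc n) \<subseteq> \<kappa> (max m (Suc n))" "\<pi> (Suc n) \<subseteq> \<pi> (max m (Suc n))" by (rule \<kappa>_mono \<pi>_mono, simp)+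
    ultimately have "E \<tau> (\<kappa> (Suc n)) (\<pi> (Suc n))" using dense[of n] unfolding n by blast
    thus ?thesis by blast
  qed
  define K where "K = (\<Union>n. \<kappa> n)"
  have \<kappa>K: "\<kappa> n \<subseteq> K" for n unfolding K_def by blast
  have fin: "\<exists>n. S \<subseteq> \<kappa> n" if "finite S" "S \<subseteq> K" for S
    using that
  proof (induction S)
    case (insert a S)
    then obtain n m where "S \<subseteq> \<kappa> n" "a \<in> \<kappa> m" unfolding K_def by auto
    hence "insert a S \<subseteq> \<kappa> (max m n)" using \<kappa>_mono[of n "max m n"] \<kappa>_mono[of m "max m n"] by auto
    thus ?case by blast
  qed simp
  have late: "\<exists>m. \<forall>n\<ge>m. S \<subseteq> \<kappa> n" if S: "finite S" "S \<subseteq> K" for S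
    using fin[OF S] \<kappa>_mono by blast
  have K0K: "K0 \<subseteq> K" using fldD(2)[OF fl] \<kappa>K by blast
  have Kc: "K \<subseteq> carrier R" unfolding K_def using fldD(4)[OF fl] by blast
  have sub: "subfield K R"
  proof (rule subfieldI')
    show "subring K R"
    proof (rule subringI[OF Kc])
      show "\<one> \<in> K" using subringE(3)[OF fldD(5)[OF fl]] \<kappa>K by blast
      show "\<ominus> a \<in> K" if a: "a \<in> K" for a
        using a subringE(5)[OF fldD(5)[OF fl]] unfolding K_def by blast
      show "a \<oplus> b \<in> K" "a \<otimes> b \<in> K" if a: "a \<in> K" "b \<in> K" for a b
      proof -
        obtain n where "{a, b} \<subseteq> \<kappa> n" using fin[of "{a, b}"] a by auto
        hence "a \<oplus> b \<in> \<kappa> n" "a \<otimes> b \<in> \<kappa> n" using subringE(6,7)[OF fldD(5)[OF fl]] by auto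
        thus "a \<oplus> b \<in> K" "a \<otimes> b \<in> K" using \<kappa>K by blast+
      qed
    qed
    show "inv a \<in> K" if a: "a \<in> K - {\<zero>}" for a
      using a subfield_m_inv(1)[OF fldD(1)[OF fl]] unfolding K_def by blast
  qed
  have \<alpha>: "\<not> Pole K i y" if y: "y \<in> Y i" for i y
  proof -
    have "\<exists>w\<in>K. has_root K i (G i s y w)" if s: "s \<in> K" "has_root K i (s \<oplus> e i)" for s
    proof -
      obtain z where z: "z \<in> K" "z [^] q i \<otimes> B i (s \<oplus> e i) = C i (s \<oplus> e i)" using s(2) unfolding has_root_def by blast
      obtain m where m: "\<And>n. n \<ge> m \<Longrightarrow> {s, z} \<subseteq> \<kappa> n" using late[of "{s, z}"] s z by auto
      have "\<exists>K' P. ok K' P \<and> \<kappa> n \<subseteq> K' \<and> \<pi> n \<subseteq> P \<and> E (False, i, y, s) K' P" if n: "n \<ge> m" for n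
      proof -
        have "has_root (\<kappa> n) i (s \<oplus> e i)" unfolding has_root_def using m[OF n] z(2) by blast
        from promise[OF chain(1) y _ this] m[OF n] show ?thesis unfolding E_def by auto
      qed
      moreover have "(False, i, y, s) \<in> T" unfolding T_def using y Y K0K Kc s(1) by blast
      ultimately obtain n where "E (False, i, y, s) (\<kappa> n) (\<pi> n)" using met by blast
      then obtain w where "w \<in> \<kappa> n" "has_root (\<kappa> n) i (G i s y w)" unfolding E_def by auto
      thus ?thesis using has_root_mono[OF _ \<kappa>K] \<kappa>K by blast
    qed
    thus ?thesis unfolding Pole_def by blast
  qed
  have \<beta>: "Pole K i x" if x: "x \<in> K" "x \<noteq> \<zero>" and v: "v \<in> Val" "v x < 0" "\<forall>y\<in>Y i. y = \<zero> \<or> 0 \<le> v y" for i x v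
  proof -
    obtain m where m: "\<And>n. n \<ge> m \<Longrightarrow> x \<in> \<kappa> n" using late[of "{x}"] x by auto
    have "\<exists>K' P. ok K' P \<and> \<kappa> n \<subseteq> K' \<and> \<pi> n \<subseteq> P \<and> E (True, i, x, x) K' P" if n: "n \<ge> m" for n
    proof -
      from demand[OF chain(1) m[OF n] x(2) v] obtain K' s where K': "\<kappa> n \<subseteq> K'" "ok K' (insert (i, v, s, x) (\<pi> n))" by blast
      have "E (True, i, x, x) K' (insert (i, v, s, x) (\<pi> n))" unfolding E_def by auto
      thus ?thesis using K' by blast
    qed
    moreover have "(True, i, x, x) \<in> T" unfolding T_def using Kc x(1) by blast
    ultimately obtain n where "E (True, i, x, x) (\<kappa> n) (\<pi> n)" using met by blast
    then obtain v s where p: "(i, v, s, x) \<in> \<pi> n" unfolding E_def by auto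
    have pl: "place (\<kappa> k) i v s x" if "k \<ge> n" for k
      using okD(3)[OF chain(1)[of k]] p \<pi>_mono[OF that] by blast
    have s: "s \<in> K" "has_root K i (s \<oplus> e i)"
      using pl[OF order_refl] has_root_mono[OF _ \<kappa>K] \<kappa>K unfolding place_def by blast+
    have "\<not> has_root K i (G i s x w)" if w: "w \<in> K" for w
    proof
      assume "has_root K i (G i s x w)"
      then obtain z where z: "z \<in> K" "z [^] q i \<otimes> B i (G i s x w) = C i (G i s x w)" unfolding has_root_def by blast
      obtain m where m: "\<And>n. n \<ge> m \<Longrightarrow> {w, z} \<subseteq> \<kappa> n" using late[of "{w, z}"] w z by auto
      have "has_root (\<kappa> (max m n)) i (G i s x w)" unfolding has_root_def using m[of "max m n"] z(2) by auto
      thus False using place_no_root[OF fl pl[of "max m n"], of w] m[of "max m n"] by auto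
    qed
    thus ?thesis using s unfolding Pole_def by blast
  qed
  \<comment> \<open>Each finite set lies in a stage, and every stage is a proper subfield; later
    this yields infinite degree.\<close>
  have \<gamma>: "\<exists>L. subfield L R \<and> K0 \<subseteq> L \<and> S \<subseteq> L \<and> L \<subset> K" if S: "finite S" "S \<subseteq> K" for S
  proof -
    obtain n where n: "S \<subseteq> \<kappa> n" using fin[OF S] by blast
    have "\<kappa> n \<subset> K" using chain(2)[of n] \<kappa>K[of "Suc n"] by blast
    thus ?thesis using n fldD(1,2)[OF fl[of n]] by blast
  qed
  show ?thesis using sub K0K \<alpha> \<beta> \<gamma> by blast
qed

end

section \<open>Existence of places\<close>

locale subring_ideal = field R for R (structure) +
  fixes A I :: "'a set"
  assumes A: "subring A R" and I: "I \<subseteq> A" "\<zero> \<in> I" "\<And>a b. a \<in> I \<Longrightarrow> b \<in> I \<Longrightarrow> a \<oplus> b \<in> I"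
    "\<And>c a. c \<in> A \<Longrightarrow> a \<in> I \<Longrightarrow> c \<otimes> a \<in> I"
begin

text \<open>\<open>comb z k\<close> consists of the polynomials in \<open>z\<close> with coefficients in \<open>I\<close> and degree less than \<open>k\<close>.\<close>

primrec comb :: "'a \<Rightarrow> nat \<Rightarrow> 'a set" where
  "comb z 0 = {\<zero>}"
| "comb z (Suc k) = {a \<oplus> z \<otimes> y | a y. a \<in> I \<and> y \<in> comb z k}"

lemma A_carrier: "a \<in> A \<Longrightarrow> a \<in> carrier R" using subringE(1)[OF A] by blast

lemma I_carrier: "a \<in> I \<Longrightarrow> a \<in> carrier R" using I(1) A_carrier by blast

lemma comb_SucI: "a \<in> I \<Longrightarrow> y \<in> comb z k \<Longrightarrow> a \<oplus> z \<otimes> y \<in> comb z (Suc k)" by auto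

lemma comb_SucE:
  assumes "y \<in> comb z (Suc k)" obtains a y' where "a \<in> I" "y' \<in> comb z k" "y = a \<oplus> z \<otimes> y'"
  using assms by auto

lemma comb_carrier: "z \<in> carrier R \<Longrightarrow> y \<in> comb z k \<Longrightarrow> y \<in> carrier R"
proof (induction k arbitrary: y)
  case (Suc k)
  from Suc.prems(2) obtain a y' where "a \<in> I" "y' \<in> comb z k" "y = a \<oplus> z \<otimes> y'" by (rule comb_SucE)
  thus ?case using Suc.IH Suc.prems(1) I_carrier by simp
qed simp

lemma comb_add: "z \<in> carrier R \<Longrightarrow> y \<in> comb z k \<Longrightarrow> y' \<in> comb z k \<Longrightarrow> y \<oplus> y' \<in> comb z k"
proof (induction k arbitrary: y y')
  case (Suc k)
  from Suc.prems(2) obtain a b where y: "a \<in> I" "b \<in> comb z k" "y = a \<oplus> z \<otimes> b" by (rule comb_SucE)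
  from Suc.prems(3) obtain a' b' where y': "a' \<in> I" "b' \<in> comb z k" "y' = a' \<oplus> z \<otimes> b'" by (rule comb_SucE)
  have "y \<oplus> y' = (a \<oplus> a') \<oplus> z \<otimes> (b \<oplus> b')" unfolding y(3) y'(3)
    using I_carrier[OF y(1)] I_carrier[OF y'(1)] comb_carrier[OF Suc.prems(1) y(2)] comb_carrier[OF Suc.prems(1) y'(2)] Suc.prems(1)
    by algebra
  thus ?case using comb_SucI[OF I(3)[OF y(1) y'(1)] Suc.IH[OF Suc.prems(1) y(2) y'(2)]] by simp
qed simp

lemma comb_mult: "z \<in> carrier R \<Longrightarrow> c \<in> A \<Longrightarrow> y \<in> comb z k \<Longrightarrow> c \<otimes> y \<in> comb z k"
proof (induction k arbitrary: y)
  case 0 thus ?case using A_carrier by simp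
next
  case (Suc k)
  from Suc.prems(3) obtain a b where y: "a \<in> I" "b \<in> comb z k" "y = a \<oplus> z \<otimes> b" by (rule comb_SucE)
  have "c \<otimes> y = c \<otimes> a \<oplus> z \<otimes> (c \<otimes> b)" unfolding y(3)
    using I_carrier[OF y(1)] comb_carrier[OF Suc.prems(1) y(2)] A_carrier[OF Suc.prems(2)] Suc.prems(1) by algebra
  thus ?case using comb_SucI[OF I(4)[OF Suc.prems(2) y(1)] Suc.IH[OF Suc.prems(1,2) y(2)]] by simp
qed

lemma comb_shift: "z \<in> carrier R \<Longrightarrow> y \<in> comb z k \<Longrightarrow> z [^] j \<otimes> y \<in> comb z (j + k)"
proof (induction j)
  case 0 thus ?case using comb_carrier by simp
next
  case (Suc j)
  note yc = comb_carrier[OF Suc.prems]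
  have "z [^] j \<in> carrier R" using Suc.prems by simp
  hence "z [^] Suc j \<otimes> y = \<zero> \<oplus> z \<otimes> (z [^] j \<otimes> y)" unfolding nat_pow_Suc using Suc.prems yc by algebra
  thus ?case using comb_SucI[OF I(2) Suc.IH[OF Suc.prems]] by simp
qed

lemma comb_mono: "z \<in> carrier R \<Longrightarrow> y \<in> comb z k \<Longrightarrow> y \<in> comb z (Suc k)"
proof (induction k arbitrary: y)
  case 0
  hence "y = \<zero> \<oplus> z \<otimes> \<zero>" by simp
  thus ?case using comb_SucI[OF I(2), of \<zero> z 0] by simp
next
  case (Suc k)
  from Suc.prems(2) obtain a b where y: "a \<in> I" "b \<in> comb z k" "y = a \<oplus> z \<otimes> b" by (rule comb_SucE)
  show ?case unfolding y(3) by (rule comb_SucI[OF y(1) Suc.IH[OF Suc.prems(1) y(2)]])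
qed

lemma comb_pow: "z \<in> carrier R \<Longrightarrow> a \<in> I \<Longrightarrow> z [^] k \<otimes> a \<in> comb z (Suc k)"
proof -
  assume z: "z \<in> carrier R" "a \<in> I"
  have "a \<oplus> z \<otimes> \<zero> \<in> comb z (Suc 0)" by (rule comb_SucI[OF z(2)]) simp
  hence "a \<in> comb z (Suc 0)" using z I_carrier by simp
  from comb_shift[OF z(1) this, of k] show ?thesis by simp
qed

lemma comb_top:
  "z \<in> carrier R \<Longrightarrow> y \<in> comb z (Suc k) \<Longrightarrow> \<exists>a\<in>I. \<exists>y'\<in>comb z k. y = y' \<oplus> a \<otimes> z [^] k"
proof (induction k arbitrary: y)
  case 0
  then obtain a where "a \<in> I" "y = a" using I_carrier by auto
  thus ?case using I_carrier by (intro bexI[of _ a] bexI[of _ \<zero>]) simp_all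
next
  case (Suc k)
  from Suc.prems(2) obtain a b where y: "a \<in> I" "b \<in> comb z (Suc k)" "y = a \<oplus> z \<otimes> b" by (rule comb_SucE)
  from Suc.IH[OF Suc.prems(1) y(2)] obtain c b' where b: "c \<in> I" "b' \<in> comb z k" "b = b' \<oplus> c \<otimes> z [^] k" by blast
  have "z [^] k \<in> carrier R" using Suc.prems by simp
  hence "y = (a \<oplus> z \<otimes> b') \<oplus> c \<otimes> z [^] Suc k" unfolding y(3) b(3) nat_pow_Suc
    using I_carrier[OF y(1)] I_carrier[OF b(1)] comb_carrier[OF Suc.prems(1) b(2)] Suc.prems(1) by algebra
  thus ?case using b(1) comb_SucI[OF y(1) b(2)] by blast
qed

text \<open>Multiplication by \<open>z^k\<close> reverses a polynomial of degree at most
  \<open>k\<close> in \<open>z' = 1/z\<close> and keeps its coefficients in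
  \<open>I\<close>.\<close>

lemma comb_rev:
  assumes z: "z \<in> carrier R" "z' \<in> carrier R" "z \<otimes> z' = \<one>"
  shows "y \<in> comb z' (Suc k) \<Longrightarrow> z [^] k \<otimes> y \<in> comb z (Suc k)"
proof (induction k arbitrary: y)
  case 0
  then obtain a where "a \<in> I" "y = a" using I_carrier z by auto
  thus ?case using comb_pow[OF z(1), of a 0] by simp
next
  case (Suc k)
  from Suc.prems obtain a b where y: "a \<in> I" "b \<in> comb z' (Suc k)" "y = a \<oplus> z' \<otimes> b" by (rule comb_SucE)
  have c: "a \<in> carrier R" "b \<in> carrier R" "z [^] k \<in> carrier R" using I_carrier[OF y(1)] comb_carrier[OF z(2) y(2)] z(1) by simp_all
  have "z [^] Suc k \<otimes> y = z [^] Suc k \<otimes> a \<oplus> z [^] k \<otimes> (z \<otimes> z') \<otimes> b" unfolding y(3) nat_pow_Suc using c z(1,2) by algebra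
  also have "\<dots> = z [^] Suc k \<otimes> a \<oplus> z [^] k \<otimes> b" unfolding z(3) using c by simp
  finally show ?case using comb_add[OF z(1) comb_pow[OF z(1) y(1)] comb_mono[OF z(1) Suc.IH[OF y(2)]]] by simp
qed

text \<open>Solving the shorter relation for a power of \<open>z\<close> and substituting it into the longer one shortens the latter.\<close>

lemma comb_descent:
  assumes unit: "\<And>a. a \<in> I \<Longrightarrow> \<exists>b\<in>A. b \<otimes> (\<one> \<ominus> a) = \<one>" and z: "z \<in> carrier R" "z' \<in> carrier R" "z \<otimes> z' = \<one>"
    and m: "\<one> \<in> comb z' m" and n: "\<one> \<in> comb z n" and mn: "m \<le> n"
  shows "\<exists>k<n. \<one> \<in> comb z k"
proof -
  have "m \<noteq> 0" using m by (intro notI) simp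
  then obtain m1 where m1: "m = Suc m1" using not0_implies_Suc by blast
  from m[unfolded m1] obtain b y where b: "b \<in> I" and y: "y \<in> comb z' m1" and eq: "\<one> = b \<oplus> z' \<otimes> y" by (rule comb_SucE)
  have bc: "b \<in> carrier R" and yc: "y \<in> carrier R" using I_carrier[OF b] comb_carrier[OF z(2) y] by simp_all
  have u: "\<one> \<ominus> b = z' \<otimes> y" unfolding eq using bc yc z(2) by algebra
  obtain c where c: "c \<in> A" "c \<otimes> (z' \<otimes> y) = \<one>" using unit[OF b] unfolding u by blast
  have cc: "c \<in> carrier R" using A_carrier[OF c(1)] .
  have "m1 \<noteq> 0" using c(2) y z(2) cc by (intro notI) simp
  then obtain m2 where m2: "m1 = Suc m2" using not0_implies_Suc by blast
  have "z = z \<otimes> (c \<otimes> (z' \<otimes> y))" unfolding c(2) using z(1) by simp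
  also have "\<dots> = (z \<otimes> z') \<otimes> (c \<otimes> y)" using z cc yc by algebra
  also have "\<dots> = c \<otimes> y" unfolding z(3) using cc yc by simp
  finally have zy: "c \<otimes> y = z" by simp
  have "z [^] m2 \<otimes> (c \<otimes> y) \<in> comb z (Suc m2)"
    by (rule comb_rev[OF z]) (use comb_mult[OF z(2) c(1) y] m2 in simp)
  hence zm: "z [^] m1 \<in> comb z m1" unfolding zy m2 by simp
  obtain n1 where n1: "n = Suc n1" "m1 \<le> n1" using mn m1 Suc_le_D by auto
  from comb_top[OF z(1) n[unfolded n1(1)]] obtain a y0 where a: "a \<in> I" and y0: "y0 \<in> comb z n1"
    and eq2: "\<one> = y0 \<oplus> a \<otimes> z [^] n1" by blast
  have "z [^] (n1 - m1) \<otimes> z [^] m1 \<in> comb z ((n1 - m1) + m1)" by (rule comb_shift[OF z(1) zm])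
  hence "z [^] n1 \<in> comb z n1" using n1(2) nat_pow_mult[OF z(1), of "n1 - m1" m1] by simp
  moreover have "a \<in> A" using a I(1) by blast
  ultimately have "\<one> \<in> comb z n1" using comb_add[OF z(1) y0 comb_mult[OF z(1)]] eq2 by simp
  thus ?thesis using n1(1) by blast
qed

end

text \<open>Let \<open>I\<close> be the ideal of \<open>A\<close> generated by \<open>1/x\<close>.
  By maximality, adjoining any \<open>y\<close> outside \<open>A\<close> yields \<open>x\<close>, so
  \<open>1 = (1/x) x\<close> is a polynomial in \<open>y\<close> with coefficients in
  \<open>I\<close>. If \<open>z\<close> and \<open>1/z\<close> were both outside, the longer of
  their shortest relations of this kind could be shortened.\<close>

lemma (in field) chevalley_maximal:
  assumes A: "subring A R" and x: "x \<in> carrier R" "x \<noteq> \<zero>" "inv x \<in> A" "x \<notin> A"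
    and max: "\<And>A'. subring A' R \<Longrightarrow> A \<subseteq> A' \<Longrightarrow> x \<notin> A' \<Longrightarrow> A' = A"
    and z: "z \<in> carrier R" "z \<noteq> \<zero>"
  shows "z \<in> A \<or> inv z \<in> A"
proof (rule ccontr)
  assume "\<not> (z \<in> A \<or> inv z \<in> A)"
  hence zA: "z \<notin> A" "inv z \<notin> A" by auto
  note Ac = subringE(1)[OF A]
  define w where "w = inv x"
  have w: "w \<in> A" "w \<in> carrier R" "x \<otimes> w = \<one>" "w \<otimes> x = \<one>" using x Ac unfolding w_def by auto
  define I where "I = (\<lambda>a. w \<otimes> a) ` A"
  interpret subring_ideal R A I
  proof (intro subring_ideal.intro subring_ideal_axioms.intro)
    show "field R" by (rule field_axioms)
    show "subring A R" by (rule A)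
    show "I \<subseteq> A" unfolding I_def using subringE(6)[OF A w(1)] by blast
    have "w \<otimes> \<zero> \<in> I" unfolding I_def using subringE(2)[OF A] by blast
    thus "\<zero> \<in> I" using w(2) by simp
    show "a \<oplus> b \<in> I" if ab: "a \<in> I" "b \<in> I" for a b
    proof -
      obtain a' b' where ab': "a' \<in> A" "b' \<in> A" "a = w \<otimes> a'" "b = w \<otimes> b'" using ab unfolding I_def by blast
      have "a' \<in> carrier R" "b' \<in> carrier R" using ab' Ac by blast+
      hence "a \<oplus> b = w \<otimes> (a' \<oplus> b')" unfolding ab'(3,4) using w(2) by (simp add: r_distr)
      thus ?thesis unfolding I_def using subringE(7)[OF A ab'(1,2)] by simp
    qed
    show "c \<otimes> a \<in> I" if ca: "c \<in> A" "a \<in> I" for c a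
    proof -
      obtain a' where a: "a' \<in> A" "a = w \<otimes> a'" using ca unfolding I_def by blast
      have "c \<otimes> (w \<otimes> a') = w \<otimes> (c \<otimes> a')" using w(2) Ac ca(1) a(1) m_lcomm by blast
      thus ?thesis unfolding I_def a(2) using subringE(6)[OF A ca(1) a(1)] by simp
    qed
  qed
  have mem: "x \<in> simple_extension A y" if y: "y \<in> carrier R" "y \<notin> A" for y
  proof (rule ccontr)
    assume "x \<notin> simple_extension A y"
    from max[OF simple_extension_is_subring[OF A y(1)] simple_extension_incl[OF Ac y(1)] this]
    show False using simple_extension_mem[OF A y(1)] y(2) by simp
  qed
  \<comment> \<open>If the inverse of \<open>u = 1 - a\<close> were outside \<open>A\<close>, then
    \<open>x\<close> would be a polynomial in it, and clearing denominators would put some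
    \<open>x u^k\<close> into \<open>A\<close>.\<close>
  have unit: "\<exists>b\<in>A. b \<otimes> (\<one> \<ominus> a) = \<one>" if aI: "a \<in> I" for a
  proof -
    obtain a' where a': "a' \<in> A" "a = w \<otimes> a'" using aI unfolding I_def by blast
    have ac: "a \<in> carrier R" "a' \<in> carrier R" using I_carrier[OF aI] a' Ac by auto
    define u where "u = \<one> \<ominus> a"
    have uc: "u \<in> carrier R" unfolding u_def using ac by simp
    have uA: "u \<in> A" unfolding u_def a_minus_def using I(1) aI subringE(3,5,7)[OF A] by blast
    have xu: "x \<otimes> u = x \<ominus> a'"
    proof -
      have "x \<otimes> u = x \<ominus> (x \<otimes> w) \<otimes> a'" unfolding u_def a'(2) using x(1) w(2) ac by algebra
      thus ?thesis unfolding w(3) using ac by simp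
    qed
    have u0: "u \<noteq> \<zero>"
    proof
      assume "u = \<zero>"
      hence "x \<ominus> a' = \<zero>" using xu x(1) by simp
      hence "x = a'" using r_right_minus_eq[OF x(1) ac(2)] by simp
      thus False using x(4) a'(1) by simp
    qed
    \<comment> \<open>From \<open>x u = x - a'\<close> one gets
      \<open>x u^k = x u^(k+1) + u^k a'\<close>, which lowers the exponent.\<close>
    have down: "x \<in> A" if "x \<otimes> u [^] k \<in> A" for k :: nat
      using that
    proof (induction k)
      case 0 thus ?case using x(1) by simp
    next
      case (Suc k)
      have uk: "u [^] k \<in> A" by (rule subring_pow[OF A uA])
      hence ukc: "u [^] k \<in> carrier R" using Ac by blast
      have "x \<otimes> u [^] k = x \<otimes> u [^] Suc k \<oplus> u [^] k \<otimes> a'"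
      proof -
        have "x \<otimes> u [^] Suc k = u [^] k \<otimes> (x \<otimes> u)" unfolding nat_pow_Suc using x(1) ukc uc by algebra
        thus ?thesis unfolding xu using x(1) ac ukc by algebra
      qed
      also have "\<dots> \<in> A" by (intro subringE(7)[OF A Suc.prems] subringE(6)[OF A uk a'(1)])
      finally show ?case by (rule Suc.IH)
    qed
    have uinv: "inv u \<in> carrier R" "inv u \<otimes> u = \<one>" using uc u0 by simp_all
    have "inv u \<in> A"
    proof (rule ccontr)
      assume "inv u \<notin> A"
      hence xe: "x \<in> simple_extension A (inv u)" by (rule mem[OF uinv(1)])
      have "\<exists>k::nat. y \<otimes> u [^] k \<in> A \<and> y \<in> carrier R" if "y \<in> simple_extension A (inv u)" for y
        using that
      proof (induction rule: simple_extension.induct)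
        case zero show ?case using subringE(2)[OF A] by (intro exI[of _ 0]) simp
      next
        case (lin y c)
        then obtain k :: nat where k: "y \<otimes> u [^] k \<in> A" "y \<in> carrier R" by blast
        have cc: "c \<in> carrier R" using lin.hyps Ac by blast
        have ukc: "u [^] k \<in> carrier R" using uc by simp
        have "(y \<otimes> inv u \<oplus> c) \<otimes> u [^] Suc k = y \<otimes> u [^] k \<otimes> (inv u \<otimes> u) \<oplus> c \<otimes> u [^] Suc k"
          unfolding nat_pow_Suc using uc uinv(1) cc k(2) ukc by algebra
        also have "\<dots> = y \<otimes> u [^] k \<oplus> c \<otimes> u [^] Suc k" unfolding uinv(2) using k(2) ukc by simp
        also have "\<dots> \<in> A" by (intro subringE(7)[OF A k(1)] subringE(6)[OF A] lin.hyps(2) subring_pow[OF A uA])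
        finally show ?case using cc k(2) uinv(1) by (intro exI[of _ "Suc k"]) simp
      qed
      from this[OF xe] show False using down x(4) by blast
    qed
    thus ?thesis using uinv(2) unfolding u_def by blast
  qed
  \<comment> \<open>Multiplication by \<open>w = 1/x\<close> moves the coefficients of a polynomial
    over \<open>A\<close> into \<open>I\<close>; it is applied to an expression of \<open>x\<close>
    in \<open>y\<close>.\<close>
  have rep: "\<exists>k. \<one> \<in> comb y k" if y: "y \<in> carrier R" "y \<notin> A" for y
  proof -
    have "\<exists>k. w \<otimes> a \<in> comb y k \<and> a \<in> carrier R" if "a \<in> simple_extension A y" for a
      using that
    proof (induction rule: simple_extension.induct)
      case zero show ?case using w(2) by (intro exI[of _ 0]) simp
    next
      case (lin b c)
      then obtain k where k: "w \<otimes> b \<in> comb y k" "b \<in> carrier R" by blast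
      have cc: "c \<in> carrier R" using lin.hyps Ac by blast
      have "w \<otimes> (b \<otimes> y \<oplus> c) = w \<otimes> c \<oplus> y \<otimes> (w \<otimes> b)" using w(2) cc k(2) y(1) by algebra
      moreover have "w \<otimes> c \<in> I" unfolding I_def using lin.hyps(2) by blast
      ultimately have "w \<otimes> (b \<otimes> y \<oplus> c) \<in> comb y (Suc k)" using comb_SucI[OF _ k(1)] by simp
      thus ?case using cc k(2) y(1) by (intro exI[of _ "Suc k"] conjI) simp_all
    qed
    from this[OF mem[OF y]] show ?thesis unfolding w(4) by blast
  qed
  define n where "n y = (LEAST k. \<one> \<in> comb y k)" for y
  have nI: "\<one> \<in> comb y (n y)" if "y \<in> carrier R" "y \<notin> A" for y
    unfolding n_def using rep[OF that] by (rule LeastI_ex)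
  have n_least: "\<not> (\<exists>k<n y. \<one> \<in> comb y k)" for y
    unfolding n_def using not_less_Least by blast
  have ic: "inv z \<in> carrier R" "z \<otimes> inv z = \<one>" "inv z \<otimes> z = \<one>" using z by simp_all
  show False
  proof (cases "n (inv z) \<le> n z")
    case True
    from comb_descent[OF unit z(1) ic(1,2) nI[OF ic(1) zA(2)] nI[OF z(1) zA(1)] True] n_least show False by blast
  next
    case False
    hence "n z \<le> n (inv z)" by simp
    from comb_descent[OF unit ic(1) z(1) ic(3) nI[OF z(1) zA(1)] nI[OF ic(1) zA(2)] this] n_least show False by blast
  qed
qed

text \<open>Zorn's lemma for the subrings that contain \<open>A\<close> and omit \<open>x\<close>.
  Omitting \<open>x\<close> is what makes the resulting place a pole of \<open>x\<close>.\<close>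

theorem (in field) valuation_ring_exists:
  assumes A: "subring A R" and x: "x \<in> carrier R" "x \<noteq> \<zero>" "inv x \<in> A" "x \<notin> A"
  shows "\<exists>V. subring V R \<and> A \<subseteq> V \<and> x \<notin> V \<and> (\<forall>z\<in>carrier R. z \<noteq> \<zero> \<longrightarrow> z \<in> V \<or> inv z \<in> V)"
proof -
  define \<A> where "\<A> = {V. subring V R \<and> A \<subseteq> V \<and> x \<notin> V}"
  have "\<exists>M\<in>\<A>. \<forall>V\<in>\<A>. M \<subseteq> V \<longrightarrow> V = M"
  proof (rule subset_Zorn_nonempty)
    show "\<A> \<noteq> {}" unfolding \<A>_def using A x(4) by blast
    fix \<C> assume ne: "\<C> \<noteq> {}" and ch: "subset.chain \<A> \<C>"
    have sub: "subring V R" "A \<subseteq> V" "x \<notin> V" if "V \<in> \<C>" for V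
      using ch that unfolding subset.chain_def \<A>_def by blast+
    have "subring (\<Union>\<C>) R"
    proof (rule subringI)
      show "\<Union>\<C> \<subseteq> carrier R" using sub(1) subringE(1) by blast
      show "\<one> \<in> \<Union>\<C>" using ne sub(1) subringE(3) by blast
      show "\<ominus> a \<in> \<Union>\<C>" if aC: "a \<in> \<Union>\<C>" for a
      proof -
        obtain V where V: "V \<in> \<C>" "a \<in> V" using aC by blast
        show ?thesis using subringE(5)[OF sub(1)[OF V(1)] V(2)] V(1) by blast
      qed
      have two: "\<exists>V\<in>\<C>. a \<in> V \<and> b \<in> V" if ab: "a \<in> \<Union>\<C>" "b \<in> \<Union>\<C>" for a b
      proof -
        obtain V W where VW: "V \<in> \<C>" "W \<in> \<C>" "a \<in> V" "b \<in> W" using ab by blast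
        have "V \<subseteq> W \<or> W \<subseteq> V" using ch VW unfolding subset.chain_def by blast
        thus ?thesis using VW by blast
      qed
      show "a \<oplus> b \<in> \<Union>\<C>" "a \<otimes> b \<in> \<Union>\<C>" if ab: "a \<in> \<Union>\<C>" "b \<in> \<Union>\<C>" for a b
      proof -
        obtain V where V: "V \<in> \<C>" "a \<in> V" "b \<in> V" using two[OF ab] by blast
        show "a \<oplus> b \<in> \<Union>\<C>" "a \<otimes> b \<in> \<Union>\<C>" using subringE(6,7)[OF sub(1)[OF V(1)] V(2,3)] V(1) by blast+
      qed
    qed
    moreover have "A \<subseteq> \<Union>\<C>" using ne sub(2) by blast
    ultimately show "\<Union>\<C> \<in> \<A>" unfolding \<A>_def using sub(3) by blast
  qed
  then obtain V where V: "V \<in> \<A>" "\<And>W. W \<in> \<A> \<Longrightarrow> V \<subseteq> W \<Longrightarrow> W = V" by blast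
  have V': "subring V R" "A \<subseteq> V" "x \<notin> V" "inv x \<in> V" using V(1) x(3) unfolding \<A>_def by auto
  have max: "A' = V" if "subring A' R" "V \<subseteq> A'" "x \<notin> A'" for A'
    by (rule V(2)) (use that V'(2) in \<open>auto simp: \<A>_def\<close>)
  from chevalley_maximal[OF V'(1) x(1,2) V'(4,3) max] show ?thesis using V' by blast
qed

section \<open>Real valuations from places of a function field\<close>

locale function_field_place = field R for R (structure) +
  fixes F K0 V :: "'a set" and T :: 'a
  assumes V: "subring V R" "\<And>z. z \<in> carrier R \<Longrightarrow> z \<noteq> \<zero> \<Longrightarrow> z \<in> V \<or> inv z \<in> V"
    and F: "subfield F R" "F \<subseteq> V" and T: "T \<in> V" "(transcendental over F) T"
    and K0: "subfield K0 R" "F \<subseteq> K0" "T \<in> K0"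
      "\<And>c. c \<in> K0 \<Longrightarrow> \<exists>f\<in>simple_extension F T. \<exists>g\<in>simple_extension F T. f \<noteq> \<zero> \<and> c \<otimes> f = g"
    and alg: "\<And>z. z \<in> carrier R \<Longrightarrow> (algebraic over K0) z"
begin

definition "U = {u \<in> V. u \<noteq> \<zero> \<and> inv u \<in> V}"
definition "\<mm> = {a \<in> V. a = \<zero> \<or> inv a \<notin> V}"

lemma V_carrier: "a \<in> V \<Longrightarrow> a \<in> carrier R" using subringE(1)[OF V(1)] by blast

lemma U_V: "u \<in> U \<Longrightarrow> u \<in> V" and U_carrier: "u \<in> U \<Longrightarrow> u \<in> carrier R" and U_nz: "u \<in> U \<Longrightarrow> u \<noteq> \<zero>"
  unfolding U_def using V_carrier by auto

lemma \<mm>_V: "a \<in> \<mm> \<Longrightarrow> a \<in> V" and \<mm>_carrier: "a \<in> \<mm> \<Longrightarrow> a \<in> carrier R"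
  unfolding \<mm>_def using V_carrier by auto

lemma U_or_\<mm>: "a \<in> V \<Longrightarrow> a \<in> U \<or> a \<in> \<mm>" and U_not_\<mm>: "a \<in> U \<Longrightarrow> a \<notin> \<mm>"
  unfolding U_def \<mm>_def by auto

lemma U_one: "\<one> \<in> U" unfolding U_def using subringE(3)[OF V(1)] by simp

lemma inv_inv: "a \<in> carrier R \<Longrightarrow> a \<noteq> \<zero> \<Longrightarrow> inv (inv a) = a"
  using comm_inv_char[of "inv a" a] by simp

lemma U_inv: "u \<in> U \<Longrightarrow> inv u \<in> U"
  unfolding U_def using V_carrier nonzero_imp_inverse_nonzero inv_inv by auto

lemma U_mult: "u \<in> U \<Longrightarrow> u' \<in> U \<Longrightarrow> u \<otimes> u' \<in> U"
proof -
  assume u: "u \<in> U" "u' \<in> U"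
  have "inv (u \<otimes> u') = inv u \<otimes> inv u'" using U_carrier U_nz u comm_inv_char[of "u \<otimes> u'" "inv u \<otimes> inv u'"]
  proof -
    have c: "u \<in> carrier R" "u' \<in> carrier R" "inv u \<in> carrier R" "inv u' \<in> carrier R" "u \<otimes> inv u = \<one>" "u' \<otimes> inv u' = \<one>"
      using U_carrier U_nz u by auto
    have "(u \<otimes> u') \<otimes> (inv u \<otimes> inv u') = (u \<otimes> inv u) \<otimes> (u' \<otimes> inv u')" using c(1-4) by algebra
    thus ?thesis using c comm_inv_char[of "u \<otimes> u'" "inv u \<otimes> inv u'"] by simp
  qed
  thus ?thesis using u U_carrier subringE(6)[OF V(1)] unfolding U_def by (simp add: integral_iff)
qed

lemma U_pow: "u \<in> U \<Longrightarrow> u [^] (n::nat) \<in> U"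
  by (induction n) (simp_all add: U_one U_mult)

lemma \<mm>_mult: "a \<in> \<mm> \<Longrightarrow> b \<in> V \<Longrightarrow> a \<otimes> b \<in> \<mm>"
proof -
  assume a: "a \<in> \<mm>" "b \<in> V"
  note c = \<mm>_carrier[OF a(1)] V_carrier[OF a(2)]
  have ab: "a \<otimes> b \<in> V" using subringE(6)[OF V(1) \<mm>_V[OF a(1)] a(2)] .
  show ?thesis
  proof (rule ccontr)
    assume "a \<otimes> b \<notin> \<mm>"
    hence nz: "a \<otimes> b \<noteq> \<zero>" and i: "inv (a \<otimes> b) \<in> V" using ab unfolding \<mm>_def by auto
    have anz: "a \<noteq> \<zero>" using nz c by auto
    have "a \<otimes> (b \<otimes> inv (a \<otimes> b)) = (a \<otimes> b) \<otimes> inv (a \<otimes> b)" using c V_carrier[OF i] by (simp add: m_assoc)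
    hence "inv a = b \<otimes> inv (a \<otimes> b)" using comm_inv_char[of a "b \<otimes> inv (a \<otimes> b)"] c V_carrier[OF i] nz by simp
    hence "inv a \<in> V" using subringE(6)[OF V(1) a(2) i] by simp
    thus False using a(1) anz unfolding \<mm>_def by simp
  qed
qed

lemma \<mm>_add: "a \<in> \<mm> \<Longrightarrow> b \<in> \<mm> \<Longrightarrow> a \<oplus> b \<in> \<mm>"
proof -
  assume a: "a \<in> \<mm>" "b \<in> \<mm>"
  have *: "a \<oplus> b \<in> \<mm>" if ab: "a \<in> \<mm>" "b \<in> \<mm>" "b \<noteq> \<zero>" "a \<otimes> inv b \<in> V" for a b
  proof -
    have c: "a \<in> carrier R" "b \<in> carrier R" "inv b \<in> carrier R" "inv b \<otimes> b = \<one>" using \<mm>_carrier ab by auto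
    have "b \<otimes> (\<one> \<oplus> a \<otimes> inv b) = b \<oplus> a \<otimes> (inv b \<otimes> b)" using c(1-3) by algebra
    hence "a \<oplus> b = b \<otimes> (\<one> \<oplus> a \<otimes> inv b)" unfolding c(4) using c(1,2) by (simp add: add.m_comm)
    thus ?thesis using \<mm>_mult[OF ab(2) subringE(7)[OF V(1) subringE(3)[OF V(1)] ab(4)]] by simp
  qed
  have c: "a \<in> carrier R" "b \<in> carrier R" using \<mm>_carrier a by auto
  show ?thesis
  proof (cases "a = \<zero> \<or> b = \<zero>")
    case True thus ?thesis using a c by auto
  next
    case False
    hence nz: "a \<noteq> \<zero>" "b \<noteq> \<zero>" by auto
    have ic: "inv a \<in> carrier R" "inv b \<in> carrier R" "inv a \<noteq> \<zero>" "inv b \<noteq> \<zero>" using nz c nonzero_imp_inverse_nonzero by auto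
    have "(a \<otimes> inv b) \<otimes> (b \<otimes> inv a) = (a \<otimes> inv a) \<otimes> (b \<otimes> inv b)" using c ic by algebra
    hence "inv (a \<otimes> inv b) = b \<otimes> inv a" using comm_inv_char[of "a \<otimes> inv b" "b \<otimes> inv a"] c ic nz by simp
    hence "a \<otimes> inv b \<in> V \<or> b \<otimes> inv a \<in> V" using V(2)[of "a \<otimes> inv b"] c ic nz by (simp add: integral_iff)
    thus ?thesis using *[OF a nz(2)] *[OF a(2,1) nz(1)] c by (auto simp: add.m_comm)
  qed
qed

lemma \<mm>_minus: "a \<in> \<mm> \<Longrightarrow> \<ominus> a \<in> \<mm>"
proof -
  assume a: "a \<in> \<mm>"
  have "a \<otimes> (\<ominus> \<one>) \<in> \<mm>" by (rule \<mm>_mult[OF a subringE(5)[OF V(1) subringE(3)[OF V(1)]]])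
  thus ?thesis using \<mm>_carrier[OF a] by (simp add: r_minus)
qed

lemma one_add_\<mm>: "a \<in> \<mm> \<Longrightarrow> \<one> \<oplus> a \<in> U"
proof (rule ccontr)
  assume a: "a \<in> \<mm>" "\<one> \<oplus> a \<notin> U"
  have "\<one> \<oplus> a \<in> V" using subringE(7)[OF V(1) subringE(3)[OF V(1)] \<mm>_V[OF a(1)]] .
  hence "\<one> \<oplus> a \<in> \<mm>" using U_or_\<mm> a(2) by blast
  hence "(\<one> \<oplus> a) \<oplus> \<ominus> a \<in> \<mm>" using \<mm>_add \<mm>_minus a(1) by blast
  hence "\<one> \<in> \<mm>" using \<mm>_carrier[OF a(1)] by (simp add: a_assoc r_neg)
  thus False using U_not_\<mm>[OF U_one] by simp
qed

lemma F_U: "c \<in> F \<Longrightarrow> c \<noteq> \<zero> \<Longrightarrow> c \<in> U"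
  unfolding U_def using F(2) subfield_m_inv(1)[OF F(1), of c] by auto

text \<open>Without a unit of the form \<open>c z^n\<close>, no two terms of a polynomial in \<open>z\<close> can cancel.\<close>

lemma eval_unit_multiple:
  assumes z: "z \<in> carrier R" "z \<noteq> \<zero>" and no: "\<And>n c. 0 < n \<Longrightarrow> c \<in> K0 \<Longrightarrow> c \<noteq> \<zero> \<Longrightarrow> c \<otimes> z [^] (n::nat) \<notin> U"
  shows "set p \<subseteq> K0 \<Longrightarrow> \<not> (\<forall>a\<in>set p. a = \<zero>) \<Longrightarrow>
    \<exists>i<length p. \<exists>c\<in>K0. \<exists>u\<in>U. c \<noteq> \<zero> \<and> eval p z = c \<otimes> z [^] i \<otimes> u"
proof (induction p)
  case (Cons a p)
  note K0c = subfieldE(3)[OF K0(1)]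
  have ac: "a \<in> carrier R" "a \<in> K0" using Cons.prems K0c by auto
  have ev: "eval (a # p) z = a \<otimes> z [^] length p \<oplus> eval p z" by simp
  show ?case
  proof (cases "\<forall>b\<in>set p. b = \<zero>")
    case True
    hence "eval p z = \<zero>" using eval_all_zero z(1) by blast
    moreover have "a \<noteq> \<zero>" using True Cons.prems(2) by auto
    ultimately show ?thesis using ac z(1) U_one unfolding ev by (intro exI[of _ "length p"] conjI bexI[of _ a] bexI[of _ \<one>]) auto
  next
    case False
    have "set p \<subseteq> K0" using Cons.prems by simp
    from Cons.IH[OF this False] obtain i c u where i: "i < length p" and c: "c \<in> K0" "c \<noteq> \<zero>" and u: "u \<in> U"
      and e: "eval p z = c \<otimes> z [^] i \<otimes> u" by blast
    have cc: "c \<in> carrier R" "u \<in> carrier R" "u \<noteq> \<zero>" using c K0c u U_carrier U_nz by auto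
    show ?thesis
    proof (cases "a = \<zero>")
      case True
      hence "eval (a # p) z = c \<otimes> z [^] i \<otimes> u" unfolding ev e using cc z(1) by simp
      thus ?thesis using i c u by (intro exI[of _ i]) auto
    next
      case a0: False
      define hi where "hi = a \<otimes> z [^] length p"
      define lo where "lo = c \<otimes> z [^] i \<otimes> u"
      have hi: "hi \<in> carrier R" "hi \<noteq> \<zero>" and lo: "lo \<in> carrier R" "lo \<noteq> \<zero>"
        unfolding hi_def lo_def using a0 ac z cc c(2) by (simp_all add: integral_iff)
      define r where "r = hi \<otimes> inv lo"
      have iY: "inv lo \<in> carrier R" "inv lo \<noteq> \<zero>" "lo \<otimes> inv lo = \<one>" using lo nonzero_imp_inverse_nonzero by auto
      have r: "r \<in> carrier R" "r \<noteq> \<zero>" unfolding r_def using hi iY by (simp_all add: integral_iff)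
      have ir: "inv r \<in> carrier R" "r \<otimes> inv r = \<one>" using r by simp_all
      have rY: "r \<otimes> lo = hi"
      proof -
        have "r \<otimes> lo = hi \<otimes> (lo \<otimes> inv lo)" unfolding r_def using hi lo iY by algebra
        thus ?thesis using iY(3) hi by simp
      qed
      have Xr: "inv r \<otimes> hi = lo"
      proof -
        have "inv r \<otimes> hi = (r \<otimes> inv r) \<otimes> lo" unfolding rY[symmetric] using r ir lo by algebra
        thus ?thesis using ir lo by simp
      qed
      have rU: "r \<notin> U"
      proof
        assume rU: "r \<in> U"
        define n where "n = length p - i"
        have n: "0 < n" "length p = i + n" unfolding n_def using i by auto
        have ic: "inv c \<in> K0" using subfield_m_inv(1)[OF K0(1), of c] c by blast
        have icc: "inv c \<in> carrier R" "inv c \<otimes> c = \<one>" "inv c \<noteq> \<zero>" using cc c nonzero_imp_inverse_nonzero by auto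
        have zi: "z [^] i \<in> carrier R" "z [^] i \<noteq> \<zero>" "z [^] n \<in> carrier R" using z by simp_all
        have "a \<otimes> (z [^] i \<otimes> z [^] n) = r \<otimes> (c \<otimes> z [^] i \<otimes> u)"
          using rY unfolding hi_def lo_def n(2) by (simp add: nat_pow_mult z(1))
        hence "inv c \<otimes> (a \<otimes> (z [^] i \<otimes> z [^] n)) = inv c \<otimes> (r \<otimes> (c \<otimes> z [^] i \<otimes> u))" by simp
        hence "z [^] i \<otimes> ((inv c \<otimes> a) \<otimes> z [^] n) = z [^] i \<otimes> ((inv c \<otimes> c) \<otimes> (r \<otimes> u))"
          using icc(1) ac zi(1,3) r(1) cc(1,2) by algebra
        hence "(inv c \<otimes> a) \<otimes> z [^] n = (inv c \<otimes> c) \<otimes> (r \<otimes> u)"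
          using m_lcancel[OF zi(2,1), of "(inv c \<otimes> a) \<otimes> z [^] n" "(inv c \<otimes> c) \<otimes> (r \<otimes> u)"] icc ac zi r cc by simp
        hence "(inv c \<otimes> a) \<otimes> z [^] n \<in> U" unfolding icc(2) using U_mult[OF rU u] r cc by simp
        moreover have "inv c \<otimes> a \<in> K0" by (rule subringE(6)[OF subfieldE(1)[OF K0(1)] ic ac(2)])
        moreover have "inv c \<otimes> a \<noteq> \<zero>" using icc ac a0 by (simp add: integral_iff)
        ultimately show False using no[OF n(1)] by blast
      qed
      have evXY: "eval (a # p) z = hi \<oplus> lo" unfolding ev e hi_def lo_def ..
      show ?thesis
      proof (cases "r \<in> V")
        case True
        hence "r \<in> \<mm>" using U_or_\<mm> rU by blast
        hence u': "u \<otimes> (\<one> \<oplus> r) \<in> U" by (intro U_mult u one_add_\<mm>)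
        have zi: "z [^] i \<in> carrier R" using z by simp
        have "eval (a # p) z = r \<otimes> lo \<oplus> lo" unfolding evXY rY ..
        also have "\<dots> = c \<otimes> z [^] i \<otimes> (u \<otimes> (\<one> \<oplus> r))" unfolding lo_def using cc zi r(1) by algebra
        finally show ?thesis using i c u' by (intro exI[of _ i]) auto
      next
        case False
        hence irV: "inv r \<in> V" using V(2) r by blast
        have "inv r \<notin> U" using False r(1) U_inv[of "inv r"] r(2) U_V inv_inv[OF r] by auto
        hence "inv r \<in> \<mm>" using U_or_\<mm> irV by blast
        hence u': "\<one> \<oplus> inv r \<in> U" by (rule one_add_\<mm>)
        have zi: "z [^] length p \<in> carrier R" using z by simp
        have "eval (a # p) z = hi \<oplus> inv r \<otimes> hi" unfolding evXY Xr ..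
        also have "\<dots> = a \<otimes> z [^] length p \<otimes> (\<one> \<oplus> inv r)" unfolding hi_def using ac zi ir(1) by algebra
        finally show ?thesis using ac a0 u' by (intro exI[of _ "length p"]) auto
      qed
    qed
  qed
qed simp

text \<open>Otherwise no nonzero polynomial over \<open>K0\<close> could vanish at \<open>z\<close>,
  although \<open>z\<close> is algebraic. The value group of \<open>V\<close> is thus torsion over
  that of \<open>K0\<close>, and real values can be assigned by dividing exponents.\<close>

lemma K0_multiple:
  assumes z: "z \<in> carrier R" "z \<noteq> \<zero>"
  shows "\<exists>n>0. \<exists>c\<in>K0. c \<noteq> \<zero> \<and> c \<otimes> z [^] (n::nat) \<in> U"
proof (rule ccontr)
  assume no: "\<not> ?thesis"
  obtain p where p: "p \<in> carrier (K0[X])" "p \<noteq> []" "eval p z = \<zero>"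
    by (rule algebraicE[OF subfieldE(1)[OF K0(1)] z(1) alg[OF z(1)]])
  have "\<not> (\<forall>a\<in>set p. a = \<zero>)" using p(1,2) by (auto simp: univ_poly_def polynomial_def)
  from eval_unit_multiple[OF z _ set_univ_poly[OF p(1)] this] no obtain i c u where
    c: "c \<in> K0" "c \<noteq> \<zero>" "u \<in> U" "eval p z = c \<otimes> z [^] (i::nat) \<otimes> u" by blast
  have "c \<otimes> z [^] i \<noteq> \<zero>" "c \<otimes> z [^] i \<in> carrier R" using c(1,2) z subfieldE(3)[OF K0(1)] by (auto simp: integral_iff)
  hence "c \<otimes> z [^] i \<otimes> u \<noteq> \<zero>" using U_nz[OF c(3)] U_carrier[OF c(3)] by (simp add: integral_iff)
  thus False using p(3) c(4) by simp
qed

lemma FT: "simple_extension F T \<subseteq> V" "simple_extension F T \<subseteq> K0" "subring (simple_extension F T) R"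
  using simple_extension_subring_incl[OF V(1) F(2) T(1)] simple_extension_subring_incl[OF subfieldE(1)[OF K0(1)] K0(2,3)]
    simple_extension_is_subring[OF subfieldE(1)[OF F(1)] V_carrier[OF T(1)]] by auto

text \<open>If all nonzero elements of \<open>F[T]\<close> were units, so would be those of
  \<open>K0\<close>, which are their fractions. Then a power of \<open>x\<close> would be a unit,
  although \<open>1/x\<close> lies in the maximal ideal.\<close>

lemma nonunit_exists:
  assumes x: "x \<in> carrier R" "x \<notin> V"
  shows "\<exists>f\<in>simple_extension F T. f \<noteq> \<zero> \<and> f \<in> \<mm>"
proof (rule ccontr)
  assume no: "\<not> ?thesis"
  have FU: "f \<in> U" if "f \<in> simple_extension F T" "f \<noteq> \<zero>" for f using no that FT(1) U_or_\<mm> by blast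
  have KU: "c \<in> U" if c: "c \<in> K0" "c \<noteq> \<zero>" for c
  proof -
    obtain f g where fg: "f \<in> simple_extension F T" "g \<in> simple_extension F T" "f \<noteq> \<zero>" "c \<otimes> f = g" using K0(4)[OF c(1)] by blast
    have cc: "c \<in> carrier R" "f \<in> carrier R" using c subfieldE(3)[OF K0(1)] FT(1) V_carrier fg by auto
    have "g \<noteq> \<zero>" unfolding fg(4)[symmetric] using cc c(2) fg(3) by (simp add: integral_iff)
    hence "g \<otimes> inv f \<in> U" using FU fg U_mult U_inv by blast
    thus ?thesis unfolding fg(4)[symmetric] using cc fg(3) by (simp add: m_assoc)
  qed
  have x0: "x \<noteq> \<zero>" using x(2) subringE(2)[OF V(1)] by auto
  have ix: "inv x \<in> \<mm>" using V(2)[OF x(1) x0] x x0 nonzero_imp_inverse_nonzero[OF x(1) x0] inv_inv[OF x(1) x0] unfolding \<mm>_def by simp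
  obtain n c where n: "0 < n" "c \<in> K0" "c \<noteq> \<zero>" "c \<otimes> x [^] (n::nat) \<in> U" using K0_multiple[OF x(1) x0] by blast
  obtain k where k: "n = Suc k" using n(1) gr0_implies_Suc by blast
  have cc: "c \<in> carrier R" "c \<in> U" "inv c \<in> carrier R" "inv c \<otimes> c = \<one>" using KU[OF n(2,3)] U_carrier U_inv n(3) by auto
  have xc: "x [^] n \<in> carrier R" using x by simp
  have "inv c \<otimes> (c \<otimes> x [^] n) = x [^] n" using cc xc by (simp add: m_assoc[symmetric])
  hence xU: "x [^] n \<in> U" using U_mult[OF U_inv[OF cc(2)] n(4)] by simp
  have ixc: "inv x \<in> carrier R" "x \<otimes> inv x = \<one>" using x x0 by simp_all
  \<comment> \<open>This product equals 1, yet its first factor is in the maximal ideal and the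
    others are integral.\<close>
  have "inv x \<otimes> (inv x [^] k \<otimes> x [^] n) \<in> \<mm>"
    by (rule \<mm>_mult[OF ix]) (intro subringE(6)[OF V(1)] subring_pow[OF V(1)] \<mm>_V[OF ix] U_V[OF xU])
  moreover have "inv x \<otimes> (inv x [^] k \<otimes> x [^] n) = (x \<otimes> inv x) [^] n"
  proof -
    have "inv x [^] k \<in> carrier R" using ixc by simp
    hence "inv x \<otimes> (inv x [^] k \<otimes> x [^] n) = x [^] n \<otimes> inv x [^] n" unfolding k nat_pow_Suc using ixc(1) x(1) xc[unfolded k nat_pow_Suc]
      by algebra
    thus ?thesis using nat_pow_distrib[OF x(1) ixc(1)] by simp
  qed
  ultimately have "\<one> \<in> \<mm>" unfolding ixc(2) by simp
  thus False using U_not_\<mm>[OF U_one] by simp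
qed

text \<open>A nonzero polynomial of least length whose value at \<open>T\<close> is in the maximal
  ideal serves as the prime polynomial of the place; division with remainder splits it off as often
  as possible.\<close>

lemma uniformizer_exists:
  assumes x: "x \<in> carrier R" "x \<notin> V"
  shows "\<exists>\<pi>\<in>simple_extension F T. \<pi> \<noteq> \<zero> \<and> \<pi> \<in> \<mm> \<and>
    (\<forall>f\<in>simple_extension F T. f \<noteq> \<zero> \<longrightarrow> (\<exists>k::nat. \<exists>u\<in>U. f = \<pi> [^] k \<otimes> u))"
proof -
  note Fc = subfieldE(3)[OF F(1)] note Tc = V_carrier[OF T(1)]
  note img = simple_extension_as_eval_img[OF Fc Tc]
  define Q where "Q n \<longleftrightarrow> (\<exists>p\<in>carrier (F[X]). length p = n \<and> p \<noteq> [] \<and> eval p T \<in> \<mm>)" for n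
  obtain f where f: "f \<in> simple_extension F T" "f \<noteq> \<zero>" "f \<in> \<mm>" using nonunit_exists[OF x] by blast
  then obtain p where "p \<in> carrier (F[X])" "eval p T = f" unfolding img by blast
  hence "Q (length p)" unfolding Q_def using f(2,3) by auto
  hence "Q (LEAST n. Q n)" by (rule LeastI)
  then obtain p where p: "p \<in> carrier (F[X])" "length p = (LEAST n. Q n)" "p \<noteq> []" "eval p T \<in> \<mm>" unfolding Q_def by blast
  have min: "length p \<le> length r" if "r \<in> carrier (F[X])" "r \<noteq> []" "eval r T \<in> \<mm>" for r
    unfolding p(2) by (rule Least_le) (use that in \<open>auto simp: Q_def\<close>)
  define \<pi> where "\<pi> = eval p T"
  have \<pi>: "\<pi> \<in> simple_extension F T" "\<pi> \<noteq> \<zero>" "\<pi> \<in> \<mm>"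
    unfolding \<pi>_def img using p(1,4) eval_transcendental[OF T(2) p(1)] p(3) by auto
  have \<pi>c: "\<pi> \<in> carrier R" using \<mm>_carrier[OF \<pi>(3)] .
  \<comment> \<open>Nonzero constants are units, so \<open>p\<close> has positive degree and
    quotients by it are strictly shorter.\<close>
  have len: "2 \<le> length p"
  proof (rule ccontr)
    assume "\<not> 2 \<le> length p"
    moreover have "length p \<noteq> 0" using p(3) by simp
    ultimately have "length p = 1" by linarith
    then obtain a where a: "p = [a]" by (cases p) auto
    hence aF: "a \<in> F" "a \<noteq> \<zero>" using p(1) by (auto simp: univ_poly_def polynomial_def)
    have "eval p T = a" unfolding a using aF(1) Fc Tc by auto
    thus False using F_U[OF aF] U_not_\<mm> p(4) by auto
  qed
  have "\<exists>k::nat. \<exists>u\<in>U. eval P T = \<pi> [^] k \<otimes> u" if "P \<in> carrier (F[X])" "P \<noteq> []" for P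
    using that
  proof (induction "length P" arbitrary: P rule: less_induct)
    case less
    have PT: "eval P T \<in> simple_extension F T" unfolding img using less.prems by blast
    show ?case
    proof (cases "eval P T \<in> \<mm>")
      case False
      hence "eval P T \<in> U" using PT FT(1) U_or_\<mm> by blast
      thus ?thesis using U_carrier by (intro exI[of _ 0] bexI[of _ "eval P T"]) auto
    next
      case True
      have pz: "p \<noteq> \<zero>\<^bsub>F[X]\<^esub>" using p(3) by (simp add: univ_poly_zero)
      from subfield_long_division_theorem_shell[OF F(1) less.prems(1) p(1) pz] obtain S r where
        S: "S \<in> carrier (F[X])" and r: "r \<in> carrier (F[X])" and eq: "P = (p \<otimes>\<^bsub>F[X]\<^esub> S) \<oplus>\<^bsub>F[X]\<^esub> r"
        and deg: "r = \<zero>\<^bsub>F[X]\<^esub> \<or> degree r < degree p" by blast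
      have sets: "set p \<subseteq> carrier R" "set S \<subseteq> carrier R" "set r \<subseteq> carrier R" using set_univ_poly p(1) S r Fc by blast+
      have ev: "eval P T = \<pi> \<otimes> eval S T \<oplus> eval r T"
      proof -
        have "eval P T = eval (poly_mult p S) T \<oplus> eval r T"
          unfolding eq univ_poly_mult univ_poly_add by (rule eval_poly_add[OF poly_mult_in_carrier[OF sets(1,2)] sets(3) Tc])
        thus ?thesis unfolding \<pi>_def eval_poly_mult[OF sets(1,2) Tc] .
      qed
      have ST: "eval S T \<in> V" using S FT(1) unfolding img by blast
      have c: "eval S T \<in> carrier R" "eval r T \<in> carrier R" "eval P T \<in> carrier R" using V_carrier[OF ST] eval_in_carrier sets Tc ev \<pi>c by auto
      \<comment> \<open>The remainder also takes a value in the maximal ideal and is too short, so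
        it vanishes.\<close>
      have "eval r T = eval P T \<oplus> \<ominus> (\<pi> \<otimes> eval S T)" unfolding ev using c \<pi>c by algebra
      hence rm: "eval r T \<in> \<mm>" using \<mm>_add[OF True \<mm>_minus[OF \<mm>_mult[OF \<pi>(3) ST]]] by simp
      have rz: "r = []"
      proof (rule ccontr)
        assume rn: "r \<noteq> []"
        hence "degree r < degree p" using deg by (simp add: univ_poly_zero)
        thus False using min[OF r rn rm] rn by (cases r) auto
      qed
      have Pe: "P = p \<otimes>\<^bsub>F[X]\<^esub> S"
      proof -
        have "p \<otimes>\<^bsub>F[X]\<^esub> S \<in> carrier (F[X])"
          using ring.ring_simprules(5)[OF univ_poly_is_ring[OF subfieldE(1)[OF F(1)]]] p(1) S by blast
        thus ?thesis using eq unfolding rz univ_poly_zero[symmetric, of R F]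
          using ring.ring_simprules(15)[OF univ_poly_is_ring[OF subfieldE(1)[OF F(1)]]] by metis
      qed
      have "poly_mult p S = P" using Pe unfolding univ_poly_mult by simp
      moreover have Sn: "S \<noteq> []" using Pe less.prems(2) unfolding univ_poly_mult by (cases S) (use poly_mult_zero(2)[OF sets(1)] in auto)
      moreover have "degree (poly_mult p S) = degree p + degree S"
        using poly_mult_degree_eq[OF subfieldE(1)[OF F(1)], of p S] p(1,3) S Sn by (simp add: univ_poly_carrier)
      ultimately have "length S < length P" using len less.prems(2) by (cases S; cases P) auto
      from less.hyps[OF this S Sn] obtain k :: nat and u where u: "u \<in> U" "eval S T = \<pi> [^] k \<otimes> u" by blast
      have "eval P T = \<pi> [^] Suc k \<otimes> u"
      proof -
        have "\<pi> [^] k \<in> carrier R" "u \<in> carrier R" using \<pi>c U_carrier[OF u(1)] by simp_all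
        thus ?thesis unfolding ev u(2) rz nat_pow_Suc using \<pi>c by (simp add: m_ac)
      qed
      thus ?thesis using u(1) by blast
    qed
  qed
  hence "\<exists>k::nat. \<exists>u\<in>U. f = \<pi> [^] k \<otimes> u" if f: "f \<in> simple_extension F T" "f \<noteq> \<zero>" for f
  proof -
    obtain P where P: "P \<in> carrier (F[X])" "f = eval P T" using f(1) unfolding img by blast
    hence "P \<noteq> []" using f(2) by auto
    thus ?thesis using \<open>\<And>P. P \<in> carrier (F[X]) \<Longrightarrow> P \<noteq> [] \<Longrightarrow> \<exists>k::nat. \<exists>u\<in>U. eval P T = \<pi> [^] k \<otimes> u\<close>[OF P(1)] P(2) by simp
  qed
  thus ?thesis using \<pi> by blast
qed

text \<open>The value of \<open>z\<close> is read off as \<open>(b - a)/n\<close> from a relation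
  \<open>z^n \<pi>^a = \<pi>^b u\<close> with a unit \<open>u\<close>. Two natural exponents avoid
  negative powers of \<open>\<pi>\<close>, and \<open>n\<close> accounts for ramification over
  \<open>K0\<close>.\<close>

lemma real_valuation:
  assumes x: "x \<in> carrier R" "x \<notin> V"
  shows "\<exists>v. valuation R v \<and> (\<forall>c\<in>F. c \<noteq> \<zero> \<longrightarrow> v c = 0) \<and> (\<forall>c\<in>K0. c \<noteq> \<zero> \<longrightarrow> v c \<in> \<int>)
    \<and> (\<exists>c\<in>K0. c \<noteq> \<zero> \<and> v c \<noteq> 0) \<and> v x < 0"
proof -
  from uniformizer_exists[OF x] obtain \<pi> where \<pi>: "\<pi> \<in> simple_extension F T" "\<pi> \<noteq> \<zero>" "\<pi> \<in> \<mm>"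
    and fac: "\<And>f. f \<in> simple_extension F T \<Longrightarrow> f \<noteq> \<zero> \<Longrightarrow> \<exists>k::nat. \<exists>u\<in>U. f = \<pi> [^] k \<otimes> u" by blast
  have \<pi>c: "\<pi> \<in> carrier R" using \<mm>_carrier[OF \<pi>(3)] .
  have pc: "\<pi> [^] (k::nat) \<in> carrier R" "\<pi> [^] k \<noteq> \<zero>" "\<pi> [^] k \<in> V" for k
    using \<pi>c \<pi>(2) subring_pow[OF V(1) \<mm>_V[OF \<pi>(3)]] by simp_all
  have pm: "\<pi> [^] (k::nat) \<in> \<mm>" if k0: "0 < k" for k
  proof -
    obtain l where l: "k = Suc l" using gr0_implies_Suc[OF k0] by blast
    show ?thesis unfolding l nat_pow_Suc m_comm[OF pc(1) \<pi>c] by (rule \<mm>_mult[OF \<pi>(3) pc(3)])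
  qed
  define W where "W z n a b u \<longleftrightarrow> (0::nat) < n \<and> u \<in> U \<and> z [^] n \<otimes> \<pi> [^] (a::nat) = \<pi> [^] (b::nat) \<otimes> u" for z n a b u
  have not_less: "\<not> i < j" if u: "u \<in> U" "u' \<in> U" and eq: "\<pi> [^] i \<otimes> u = \<pi> [^] j \<otimes> u'" for i j :: nat and u u'
  proof
    assume "i < j"
    then obtain l where l: "j = i + l" "0 < l" using less_imp_add_positive by blast
    have c: "u \<in> carrier R" "u' \<in> carrier R" using U_carrier u by auto
    have "\<pi> [^] i \<otimes> u = \<pi> [^] i \<otimes> (\<pi> [^] l \<otimes> u')" unfolding eq l(1) nat_pow_mult[OF \<pi>c, symmetric] using c pc by (simp add: m_assoc)
    hence "u = \<pi> [^] l \<otimes> u'" using m_lcancel[OF pc(2,1)] c pc by simp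
    hence "u \<in> \<mm>" using \<mm>_mult[OF pm[OF l(2)] U_V[OF u(2)]] by simp
    thus False using U_not_\<mm>[OF u(1)] by simp
  qed
  have exp_eq: "i = j" if u: "u \<in> U" "u' \<in> U" and eq: "\<pi> [^] i \<otimes> u = \<pi> [^] j \<otimes> u'" for i j :: nat and u u'
    using not_less[OF u eq] not_less[OF u(2,1) eq[symmetric]] by simp
  have W_pow: "W z (n * k) (a * k) (b * k) (u [^] k)" if w: "W z n a b u" and k: "0 < k" and z: "z \<in> carrier R" for z n a b u k
  proof -
    have u: "u \<in> U" "u \<in> carrier R" using w U_carrier unfolding W_def by auto
    have zc: "z [^] n \<in> carrier R" using z by simp
    have "(z [^] n \<otimes> \<pi> [^] a) [^] k = (\<pi> [^] b \<otimes> u) [^] k" using w unfolding W_def by simp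
    hence "z [^] (n * k) \<otimes> \<pi> [^] (a * k) = \<pi> [^] (b * k) \<otimes> u [^] k"
      unfolding nat_pow_distrib[OF zc pc(1)] nat_pow_distrib[OF pc(1) u(2)] nat_pow_pow[OF z] nat_pow_pow[OF \<pi>c] .
    thus ?thesis unfolding W_def using w k U_pow[OF u(1)] unfolding W_def by simp
  qed
  have W_mult: "W (y \<otimes> z) n (a + a') (b + b') (u \<otimes> u')" if w: "W y n a b u" "W z n a' b' u'" and c: "y \<in> carrier R" "z \<in> carrier R"
    for y z n a b u a' b' u'
  proof -
    have u: "u \<in> U" "u \<in> carrier R" "u' \<in> U" "u' \<in> carrier R" using w U_carrier unfolding W_def by auto
    have yz: "y [^] n \<in> carrier R" "z [^] n \<in> carrier R" using c by simp_all
    have "(y \<otimes> z) [^] n \<otimes> \<pi> [^] (a + a') = (y [^] n \<otimes> \<pi> [^] a) \<otimes> (z [^] n \<otimes> \<pi> [^] a')"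
      unfolding nat_pow_distrib[OF c] nat_pow_mult[OF \<pi>c, symmetric] using yz pc(1)[of a] pc(1)[of a'] by algebra
    also have "\<dots> = (\<pi> [^] b \<otimes> u) \<otimes> (\<pi> [^] b' \<otimes> u')" using w unfolding W_def by simp
    also have "\<dots> = \<pi> [^] (b + b') \<otimes> (u \<otimes> u')"
      unfolding nat_pow_mult[OF \<pi>c, symmetric] using u(2,4) pc(1)[of b] pc(1)[of b'] by algebra
    finally show ?thesis using w U_mult[OF u(1,3)] unfolding W_def by simp
  qed
  have W_unique1: "b + a' = b' + a" if w: "W z n a b u" "W z n a' b' u'" and z: "z \<in> carrier R" for z n a b u a' b' u'
  proof -
    have u: "u \<in> U" "u \<in> carrier R" "u' \<in> U" "u' \<in> carrier R" using w U_carrier unfolding W_def by auto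
    have zc: "z [^] n \<in> carrier R" using z by simp
    note p = pc(1)[of a] pc(1)[of a'] pc(1)[of b] pc(1)[of b']
    have "\<pi> [^] (b + a') \<otimes> u = (\<pi> [^] b \<otimes> u) \<otimes> \<pi> [^] a'"
      unfolding nat_pow_mult[OF \<pi>c, symmetric] using u(2) p by algebra
    also have "\<dots> = (z [^] n \<otimes> \<pi> [^] a) \<otimes> \<pi> [^] a'" using w(1) unfolding W_def by simp
    also have "\<dots> = (z [^] n \<otimes> \<pi> [^] a') \<otimes> \<pi> [^] a" using zc p by algebra
    also have "\<dots> = (\<pi> [^] b' \<otimes> u') \<otimes> \<pi> [^] a" using w(2) unfolding W_def by simp
    also have "\<dots> = \<pi> [^] (b' + a) \<otimes> u'" unfolding nat_pow_mult[OF \<pi>c, symmetric] using u(4) p by algebra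
    finally show ?thesis using exp_eq[OF u(1,3)] by blast
  qed
  have W_pos: "0 < n" if "W z n a b u" for z n a b u using that unfolding W_def by simp
  \<comment> \<open>Raising each relation to the exponent of the other reduces this to relations
    with a common \<open>n\<close>.\<close>
  have W_unique: "(real b - real a) / real n = (real b' - real a') / real n'"
    if w: "W z n a b u" "W z n' a' b' u'" and z: "z \<in> carrier R" for z n a b u n' a' b' u'
  proof -
    have n: "0 < n" "0 < n'" using W_pos w by auto
    from W_unique1[OF W_pow[OF w(1) n(2) z] W_pow[OF w(2) n(1) z, unfolded mult.commute[of n' n]] z]
    have "real (b * n' + a' * n) = real (b' * n + a * n')" by (rule arg_cong)
    hence "(real b - real a) * real n' = (real b' - real a') * real n" by (simp add: algebra_simps)
    thus ?thesis using n by (simp add: frac_eq_eq)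
  qed
  \<comment> \<open>Fractions of elements of \<open>F[T]\<close> need no power, so the values on
    \<open>K0\<close> are integers.\<close>
  have K0_W: "\<exists>a b u. W c 1 a b u" if c: "c \<in> K0" "c \<noteq> \<zero>" for c
  proof -
    obtain f g where fg: "f \<in> simple_extension F T" "g \<in> simple_extension F T" "f \<noteq> \<zero>" "c \<otimes> f = g" using K0(4)[OF c(1)] by blast
    have cc: "c \<in> carrier R" "f \<in> carrier R" using c subfieldE(3)[OF K0(1)] FT(1) V_carrier fg by auto
    have "g \<noteq> \<zero>" unfolding fg(4)[symmetric] using cc c(2) fg(3) by (simp add: integral_iff)
    then obtain l u' where l: "u' \<in> U" "g = \<pi> [^] (l::nat) \<otimes> u'" using fac[OF fg(2)] by blast
    obtain k u where k: "u \<in> U" "f = \<pi> [^] (k::nat) \<otimes> u" using fac[OF fg(1,3)] by blast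
    have u: "u \<in> carrier R" "u' \<in> carrier R" "inv u \<in> carrier R" "u \<otimes> inv u = \<one>" using U_carrier U_nz k(1) l(1) by auto
    have "(c \<otimes> (\<pi> [^] k \<otimes> u)) \<otimes> inv u = (\<pi> [^] l \<otimes> u') \<otimes> inv u" using fg(4) unfolding k(2) l(2) by simp
    hence "(c \<otimes> \<pi> [^] k) \<otimes> (u \<otimes> inv u) = \<pi> [^] l \<otimes> (u' \<otimes> inv u)" using cc(1) u(1-3) pc(1)[of k] pc(1)[of l] by algebra
    hence "c [^] (1::nat) \<otimes> \<pi> [^] k = \<pi> [^] l \<otimes> (u' \<otimes> inv u)" unfolding u(4) using cc(1) pc(1)[of k] by simp
    moreover have "u' \<otimes> inv u \<in> U" by (rule U_mult[OF l(1) U_inv[OF k(1)]])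
    ultimately show ?thesis unfolding W_def by blast
  qed
  have W_ex: "\<exists>n a b u. W z n a b u" if z: "z \<in> carrier R" "z \<noteq> \<zero>" for z
  proof -
    obtain n c where n: "0 < n" and c: "c \<in> K0" "c \<noteq> \<zero>" "c \<otimes> z [^] (n::nat) \<in> U" using K0_multiple[OF z] by blast
    obtain a b u where w: "W c 1 a b u" using K0_W[OF c(1,2)] by blast
    have cc: "c \<in> carrier R" using c subfieldE(3)[OF K0(1)] by auto
    have u: "u \<in> U" "u \<in> carrier R" "inv u \<in> carrier R" "u \<otimes> inv u = \<one>" using w U_carrier U_nz unfolding W_def by auto
    have zn: "z [^] n \<in> carrier R" using z by simp
    have w': "c \<otimes> \<pi> [^] a = \<pi> [^] b \<otimes> u" using w cc unfolding W_def by simp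
    have "z [^] n \<otimes> \<pi> [^] b = (z [^] n \<otimes> \<pi> [^] b) \<otimes> (u \<otimes> inv u)" unfolding u(4) using zn pc by simp
    also have "\<dots> = (z [^] n \<otimes> (\<pi> [^] b \<otimes> u)) \<otimes> inv u" using zn pc(1)[of b] u(2,3) by algebra
    also have "\<dots> = \<pi> [^] a \<otimes> ((c \<otimes> z [^] n) \<otimes> inv u)" unfolding w'[symmetric] using zn pc(1)[of a] u(2,3) cc by algebra
    finally have "W z n b a ((c \<otimes> z [^] n) \<otimes> inv u)" unfolding W_def using n U_mult[OF c(3) U_inv[OF u(1)]] by blast
    thus ?thesis by blast
  qed
  define v where "v z = (THE r. \<exists>n a b u. W z n a b u \<and> r = (real b - real a) / real n)" for z
  have v_eq: "v z = (real b - real a) / real n" if w: "W z n a b u" and z: "z \<in> carrier R" for z n a b u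
    unfolding v_def
  proof (rule the_equality)
    show "\<exists>n' a' b' u'. W z n' a' b' u' \<and> (real b - real a) / real n = (real b' - real a') / real n'" using w by blast
    fix r assume "\<exists>n a b u. W z n a b u \<and> r = (real b - real a) / real n"
    then obtain n' a' b' u' where "W z n' a' b' u'" "r = (real b' - real a') / real n'" by blast
    thus "r = (real b - real a) / real n" using W_unique[OF w _ z] by simp
  qed
  have v_mult: "v (y \<otimes> z) = v y + v z" if yz: "y \<in> carrier R" "y \<noteq> \<zero>" "z \<in> carrier R" "z \<noteq> \<zero>" for y z
  proof -
    obtain n a b u where w: "W y n a b u" using W_ex[OF yz(1,2)] by blast
    obtain n' a' b' u' where w': "W z n' a' b' u'" using W_ex[OF yz(3,4)] by blast
    have n: "0 < n" "0 < n'" using W_pos w w' by blast+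
    have "W (y \<otimes> z) (n * n') (a * n' + a' * n) (b * n' + b' * n) (u [^] n' \<otimes> u' [^] n)"
      by (rule W_mult[OF W_pow[OF w n(2) yz(1)] W_pow[OF w' n(1) yz(3), unfolded mult.commute[of n' n]] yz(1,3)])
    hence "v (y \<otimes> z) = (real (b * n' + b' * n) - real (a * n' + a' * n)) / real (n * n')" using v_eq yz by simp
    also have "\<dots> = v y + v z" unfolding v_eq[OF w yz(1)] v_eq[OF w' yz(3)] using n by (simp add: field_simps)
    finally show ?thesis .
  qed
  have not_pole: "a \<le> b" if w: "W z n a b u" and z: "z \<in> V" for z n a b u
  proof (rule ccontr)
    assume "\<not> a \<le> b"
    then obtain l where l: "a = b + l" "0 < l" using less_imp_add_positive[of b a] by auto
    have u: "u \<in> U" "u \<in> carrier R" using w U_carrier unfolding W_def by auto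
    have zc: "z [^] n \<in> carrier R" "z [^] n \<in> V" using subring_pow[OF V(1) z] V_carrier by auto
    have "\<pi> [^] b \<otimes> (\<pi> [^] l \<otimes> z [^] n) = \<pi> [^] b \<otimes> u"
    proof -
      have "z [^] n \<otimes> (\<pi> [^] b \<otimes> \<pi> [^] l) = \<pi> [^] b \<otimes> u" using w unfolding W_def l(1) nat_pow_mult[OF \<pi>c] by simp
      thus ?thesis using zc(1) pc(1)[of b] pc(1)[of l] by (simp add: m_ac)
    qed
    hence "\<pi> [^] l \<otimes> z [^] n = u" using m_lcancel[OF pc(2,1)] zc u pc by simp
    thus False using \<mm>_mult[OF pm[OF l(2)] zc(2)] U_not_\<mm>[OF u(1)] by simp
  qed
  have v_V: "0 \<le> v z" if z: "z \<in> V" "z \<noteq> \<zero>" for z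
  proof -
    have zc: "z \<in> carrier R" using V_carrier z by blast
    obtain n a b u where w: "W z n a b u" using W_ex[OF zc z(2)] by blast
    show ?thesis unfolding v_eq[OF w zc] using not_pole[OF w z(1)] by simp
  qed
  have v_\<mm>: "0 < v z" if z: "z \<in> \<mm>" "z \<noteq> \<zero>" for z
  proof -
    note zc = \<mm>_carrier[OF z(1)]
    obtain n a b u where w: "W z n a b u" using W_ex[OF zc z(2)] by blast
    have u: "u \<in> U" "u \<in> carrier R" and n: "0 < n" using w U_carrier unfolding W_def by auto
    have "a \<noteq> b"
    proof
      assume "a = b"
      hence "\<pi> [^] b \<otimes> z [^] n = \<pi> [^] b \<otimes> u" using w zc pc(1)[of b] unfolding W_def by (simp add: m_comm)
      hence zu: "z [^] n = u" using m_lcancel[OF pc(2,1)] zc u by simp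
      obtain k where "n = Suc k" using n gr0_implies_Suc by blast
      hence "z [^] n = z \<otimes> z [^] k" using zc m_comm[of "z [^] k" z] by simp
      hence "z [^] n \<in> \<mm>" using \<mm>_mult[OF z(1) subring_pow[OF V(1) \<mm>_V[OF z(1)]]] by simp
      thus False using U_not_\<mm>[OF u(1)] zu by simp
    qed
    hence "a < b" using not_pole[OF w \<mm>_V[OF z(1)]] by simp
    thus ?thesis unfolding v_eq[OF w zc] using n by simp
  qed
  have v_add: "v z \<le> v (y \<oplus> z)" if yz: "y \<in> carrier R" "z \<in> carrier R" "z \<noteq> \<zero>" "y \<oplus> z \<noteq> \<zero>" "y \<otimes> inv z \<in> V" for y z
  proof -
    have ic: "inv z \<in> carrier R" "inv z \<otimes> z = \<one>" using yz by simp_all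
    have "z \<otimes> (\<one> \<oplus> y \<otimes> inv z) = z \<oplus> y \<otimes> (inv z \<otimes> z)" using yz(1,2) ic(1) by algebra
    hence eq: "y \<oplus> z = z \<otimes> (\<one> \<oplus> y \<otimes> inv z)" unfolding ic(2) using yz by (simp add: add.m_comm)
    have V1: "\<one> \<oplus> y \<otimes> inv z \<in> V" by (rule subringE(7)[OF V(1) subringE(3)[OF V(1)] yz(5)])
    have nz: "\<one> \<oplus> y \<otimes> inv z \<noteq> \<zero>" using yz(2,4) unfolding eq by (intro notI) simp
    show ?thesis unfolding eq v_mult[OF yz(2,3) V_carrier[OF V1] nz] using v_V[OF V1 nz] by simp
  qed
  have val: "valuation R v"
  proof (intro valuation.intro valuation_axioms.intro)
    show "field R" by (rule field_axioms)
    show "v (y \<otimes> z) = v y + v z" if "y \<in> carrier R" "z \<in> carrier R" "y \<noteq> \<zero>" "z \<noteq> \<zero>" for y z using v_mult that by simp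
    show "min (v y) (v z) \<le> v (y \<oplus> z)" if yz: "y \<in> carrier R" "z \<in> carrier R" "y \<noteq> \<zero>" "z \<noteq> \<zero>" "y \<oplus> z \<noteq> \<zero>" for y z
    proof -
      have ic: "inv y \<in> carrier R" "inv z \<in> carrier R" "inv y \<noteq> \<zero>" "inv z \<noteq> \<zero>" using yz nonzero_imp_inverse_nonzero by auto
      have "(y \<otimes> inv z) \<otimes> (z \<otimes> inv y) = (y \<otimes> inv y) \<otimes> (z \<otimes> inv z)" using yz(1,2) ic by algebra
      hence "inv (y \<otimes> inv z) = z \<otimes> inv y" using comm_inv_char[of "y \<otimes> inv z" "z \<otimes> inv y"] yz ic by simp
      hence "y \<otimes> inv z \<in> V \<or> z \<otimes> inv y \<in> V" using V(2)[of "y \<otimes> inv z"] yz ic by (simp add: integral_iff)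
      thus ?thesis using v_add[OF yz(1,2,4,5)] v_add[OF yz(2,1,3)] yz by (auto simp: add.m_comm)
    qed
  qed
  interpret valuation R v by (rule val)
  have vF: "v c = 0" if c: "c \<in> F" "c \<noteq> \<zero>" for c
  proof -
    have "W c 1 0 0 c" unfolding W_def using F_U[OF c] U_carrier by simp
    thus ?thesis using v_eq[of c 1 0 0 c] U_carrier[OF F_U[OF c]] by simp
  qed
  have vK0: "v c \<in> \<int>" if c: "c \<in> K0" "c \<noteq> \<zero>" for c
  proof -
    obtain a b u where w: "W c 1 a b u" using K0_W[OF c] by blast
    have "c \<in> carrier R" using c subfieldE(3)[OF K0(1)] by blast
    from v_eq[OF w this] show ?thesis by simp
  qed
  have "\<pi> \<in> K0" "v \<pi> \<noteq> 0" using \<pi> FT(2) v_\<mm>[OF \<pi>(3,2)] by auto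
  moreover have "v x < 0"
  proof -
    have x0: "x \<noteq> \<zero>" using x(2) subringE(2)[OF V(1)] by auto
    have "inv x \<in> \<mm>" "inv x \<noteq> \<zero>" using V(2)[OF x(1) x0] x x0 nonzero_imp_inverse_nonzero[OF x(1) x0] inv_inv[OF x(1) x0] unfolding \<mm>_def by auto
    from v_\<mm>[OF this] show ?thesis using v_inv[OF x(1) x0] by simp
  qed
  ultimately show ?thesis using val vF vK0 \<pi>(2) by blast
qed

end

lemma (in field) subfield_of_fractions:
  assumes A: "subring A R"
  shows "subfield {c \<in> carrier R. \<exists>f\<in>A. \<exists>g\<in>A. f \<noteq> \<zero> \<and> c \<otimes> f = g} R"
proof (rule subfieldI'[OF subringI])
  let ?Q = "{c \<in> carrier R. \<exists>f\<in>A. \<exists>g\<in>A. f \<noteq> \<zero> \<and> c \<otimes> f = g}"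
  note Ac = subringE(1)[OF A]
  show "?Q \<subseteq> carrier R" by blast
  show "\<one> \<in> ?Q" using subringE(3)[OF A] by (auto intro!: bexI[of _ \<one>])
  show "\<ominus> c \<in> ?Q" if c: "c \<in> ?Q" for c
  proof -
    obtain f where f: "c \<in> carrier R" "f \<in> A" "c \<otimes> f \<in> A" "f \<noteq> \<zero>" using c by auto
    have "\<ominus> c \<otimes> f = \<ominus> (c \<otimes> f)" using f Ac by (intro l_minus) auto
    thus ?thesis using f subringE(5)[OF A f(3)] by auto
  qed
  show "c \<oplus> d \<in> ?Q" "c \<otimes> d \<in> ?Q" if cd: "c \<in> ?Q" "d \<in> ?Q" for c d
  proof -
    obtain f where f: "c \<in> carrier R" "f \<in> A" "c \<otimes> f \<in> A" "f \<noteq> \<zero>" using cd(1) by auto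
    obtain g where g: "d \<in> carrier R" "g \<in> A" "d \<otimes> g \<in> A" "g \<noteq> \<zero>" using cd(2) by auto
    have cc: "f \<in> carrier R" "g \<in> carrier R" using f g Ac by auto
    have fg: "f \<otimes> g \<in> A" "f \<otimes> g \<noteq> \<zero>" using subringE(6)[OF A f(2) g(2)] cc f g by (auto simp: integral_iff)
    have "(c \<oplus> d) \<otimes> (f \<otimes> g) = (c \<otimes> f) \<otimes> g \<oplus> f \<otimes> (d \<otimes> g)" "(c \<otimes> d) \<otimes> (f \<otimes> g) = (c \<otimes> f) \<otimes> (d \<otimes> g)"
      using f(1) g(1) cc by algebra+
    moreover have "(c \<otimes> f) \<otimes> g \<oplus> f \<otimes> (d \<otimes> g) \<in> A" "(c \<otimes> f) \<otimes> (d \<otimes> g) \<in> A"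
      by (intro subringE(6,7)[OF A] f g)+
    ultimately show "c \<oplus> d \<in> ?Q" "c \<otimes> d \<in> ?Q" using fg f(1) g(1) by auto
  qed
  show "inv c \<in> ?Q" if c: "c \<in> ?Q - {\<zero>}" for c
  proof -
    obtain f where f: "c \<in> carrier R" "f \<in> A" "c \<otimes> f \<in> A" "f \<noteq> \<zero>" and c0: "c \<noteq> \<zero>" using c by auto
    have fc: "f \<in> carrier R" and ic: "inv c \<in> carrier R" "inv c \<otimes> c = \<one>" using f Ac c0 by auto
    have "inv c \<otimes> (c \<otimes> f) = f" using f(1) fc ic by (simp add: m_assoc[symmetric])
    moreover have "c \<otimes> f \<noteq> \<zero>" using f fc c0 by (simp add: integral_iff)
    ultimately show ?thesis using ic f(2,3) by blast
  qed
qed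

text \<open>Transcendence keeps \<open>x\<close> out of \<open>F[1/x]\<close>, so a valuation ring
  can contain \<open>F[1/x]\<close> and omit \<open>x\<close>. It is trivial on \<open>F\<close>
  because it contains that field.\<close>

theorem (in field) function_field_valuation_exists:
  assumes F: "subfield F R" and t: "t \<in> carrier R" "(transcendental over F) t"
    and K0: "subfield K0 R" "F \<subseteq> K0" "t \<in> K0" "\<And>L. subfield L R \<Longrightarrow> F \<subseteq> L \<Longrightarrow> t \<in> L \<Longrightarrow> K0 \<subseteq> L"
    and alg: "\<And>z. z \<in> carrier R \<Longrightarrow> (algebraic over K0) z"
    and x: "x \<in> carrier R" "(transcendental over F) x"
  shows "\<exists>v. valuation R v \<and> (\<forall>c\<in>F. c \<noteq> \<zero> \<longrightarrow> v c = 0) \<and> (\<forall>c\<in>K0. c \<noteq> \<zero> \<longrightarrow> v c \<in> \<int>)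
    \<and> (\<exists>c\<in>K0. c \<noteq> \<zero> \<and> v c \<noteq> 0) \<and> v x < 0"
proof -
  note Fr = subfieldE(1)[OF F] note Fc = subfieldE(3)[OF F]
  have algF: "subfield {z \<in> carrier R. (algebraic over F) z} R" by (rule subfield_of_algebraics[OF F])
  have inv_tr: "z \<noteq> \<zero> \<and> (transcendental over F) (inv z)" if z: "z \<in> carrier R" "(transcendental over F) z" for z
  proof -
    have z0: "z \<noteq> \<zero>" using z(2) zero_is_algebraic[OF Fr] unfolding over_def by auto
    have "(transcendental over F) (inv z)"
    proof (rule ccontr)
      assume "\<not> ?thesis"
      hence "inv z \<in> {z \<in> carrier R. (algebraic over F) z} - {\<zero>}"
        using z(1) z0 nonzero_imp_inverse_nonzero[OF z(1) z0] by (simp add: over_def)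
      from subfield_m_inv(1)[OF algF this] have "inv (inv z) \<in> {z \<in> carrier R. (algebraic over F) z}" by blast
      moreover have "inv (inv z) = z" using comm_inv_char[of "inv z" z] z(1) z0 by simp
      ultimately show False using z(2) by (simp add: over_def)
    qed
    thus ?thesis using z0 by blast
  qed
  have x0: "x \<noteq> \<zero>" using inv_tr[OF x] by blast
  have ix: "inv x \<in> carrier R" "inv x \<otimes> x = \<one>" "x \<otimes> inv x = \<one>" using x(1) x0 by simp_all
  define A where "A = simple_extension F (inv x)"
  have A: "subring A R" "inv x \<in> A" "F \<subseteq> A" unfolding A_def
    using simple_extension_is_subring[OF Fr ix(1)] simple_extension_mem[OF Fr ix(1)] simple_extension_incl[OF Fc ix(1)] by auto
  have xA: "x \<notin> A"
  proof
    assume "x \<in> A"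
    then obtain p where p: "p \<in> carrier (F[X])" "x = eval p (inv x)" unfolding A_def simple_extension_as_eval_img[OF Fc ix(1)] by blast
    have pn: "p \<noteq> []" using p(2) x0 by auto
    have m1: "\<ominus> \<one> \<in> F" using subringE(3,5)[OF Fr] by blast
    have pc: "set p \<subseteq> F" using set_univ_poly[OF p(1)] .
    \<comment> \<open>Appending a coefficient shifts all degrees by one: \<open>x = p(1/x)\<close>
      becomes the algebraic relation \<open>(1/x) p(1/x) - 1 = 0\<close>.\<close>
    have "eval (p @ [\<ominus> \<one>]) (inv x) = eval p (inv x) \<otimes> inv x \<oplus> \<ominus> \<one>"
      using eval_append_aux[of p "\<ominus> \<one>" "inv x"] pc Fc ix(1) by auto
    also have "\<dots> = \<zero>" unfolding p(2)[symmetric] ix(3) by (simp add: r_neg)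
    finally have ev: "eval (p @ [\<ominus> \<one>]) (inv x) = \<zero>" .
    have "p @ [\<ominus> \<one>] \<in> carrier (F[X])" using p(1) pn m1 pc by (auto simp: univ_poly_def polynomial_def)
    from algebraicI[OF this _ ev] inv_tr[OF x] show False by (simp add: over_def)
  qed
  from valuation_ring_exists[OF A(1) x(1) x0 A(2) xA] obtain V where
    V: "subring V R" "A \<subseteq> V" "x \<notin> V" "\<And>z. z \<in> carrier R \<Longrightarrow> z \<noteq> \<zero> \<Longrightarrow> z \<in> V \<or> inv z \<in> V" by blast
  have t0: "t \<noteq> \<zero>" using inv_tr[OF t] by blast
  \<comment> \<open>If \<open>t\<close> is not integral at the place, \<open>1/t\<close> replaces it
    as the variable. Either way \<open>t\<close> is a fraction over \<open>F[T]\<close>, so by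
    minimality \<open>K0\<close> consists of such fractions.\<close>
  have "\<exists>T. T \<in> V \<and> (transcendental over F) T \<and> T \<in> K0 \<and> (\<exists>f\<in>simple_extension F T. \<exists>g\<in>simple_extension F T. f \<noteq> \<zero> \<and> t \<otimes> f = g)"
  proof (cases "t \<in> V")
    case True
    have "\<one> \<in> simple_extension F t" "t \<in> simple_extension F t"
      using simple_extension_incl[OF Fc t(1)] subringE(3)[OF Fr] simple_extension_mem[OF Fr t(1)] by auto
    thus ?thesis using True t K0(3) by (intro exI[of _ t]) (auto intro!: bexI[of _ \<one>])
  next
    case False
    have it: "inv t \<in> carrier R" "t \<otimes> inv t = \<one>" "inv t \<noteq> \<zero>" using t(1) t0 nonzero_imp_inverse_nonzero by auto
    have "\<one> \<in> simple_extension F (inv t)" "inv t \<in> simple_extension F (inv t)"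
      using simple_extension_incl[OF Fc it(1)] subringE(3)[OF Fr] simple_extension_mem[OF Fr it(1)] by auto
    moreover have "inv t \<in> V" using False V(4)[OF t(1) t0] by blast
    moreover have "inv t \<in> K0" using subfield_m_inv(1)[OF K0(1), of t] K0(3) t0 by blast
    ultimately show ?thesis using it inv_tr[OF t] by (intro exI[of _ "inv t"]) (auto intro!: bexI[of _ "inv t"])
  qed
  then obtain T where T: "T \<in> V" "(transcendental over F) T" "T \<in> K0"
    and tT: "\<exists>f\<in>simple_extension F T. \<exists>g\<in>simple_extension F T. f \<noteq> \<zero> \<and> t \<otimes> f = g" by blast
  have Tc: "T \<in> carrier R" using T(1) subringE(1)[OF V(1)] by blast
  define Q where "Q = {c \<in> carrier R. \<exists>f\<in>simple_extension F T. \<exists>g\<in>simple_extension F T. f \<noteq> \<zero> \<and> c \<otimes> f = g}"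
  have Q: "subfield Q R" unfolding Q_def by (rule subfield_of_fractions[OF simple_extension_is_subring[OF Fr Tc]])
  have "F \<subseteq> Q"
  proof
    fix c assume c: "c \<in> F"
    have "\<one> \<in> simple_extension F T" "c \<in> simple_extension F T"
      using simple_extension_incl[OF Fc Tc] subringE(3)[OF Fr] c by auto
    thus "c \<in> Q" unfolding Q_def using c Fc by (auto intro!: bexI[of _ \<one>])
  qed
  moreover have "t \<in> Q" unfolding Q_def using t(1) tT by simp
  ultimately have K0Q: "K0 \<subseteq> Q" using K0(4)[OF Q] by blast
  have "function_field_place R F K0 V T"
  proof (intro function_field_place.intro function_field_place_axioms.intro)
    show "field R" by (rule field_axioms)
    show "\<And>c. c \<in> K0 \<Longrightarrow> \<exists>f\<in>simple_extension F T. \<exists>g\<in>simple_extension F T. f \<noteq> \<zero> \<and> c \<otimes> f = g"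
      using K0Q unfolding Q_def by blast
    show "\<And>z. z \<in> carrier R \<Longrightarrow> (algebraic over K0) z" by (rule alg)
    show "F \<subseteq> V" using A(3) V(2) by blast
  qed (use V F T K0 in blast)+
  from function_field_place.real_valuation[OF this x(1) V(3)] show ?thesis .
qed

text \<open>Nonzero coefficients from \<open>F\<close> have value 0. If \<open>v x\<close> were not
  0, the terms of a polynomial in \<open>x\<close> would have different values, and the polynomial
  could not vanish.\<close>

lemma (in valuation) v_algebraic:
  assumes F: "subfield F R" "\<And>c. c \<in> F \<Longrightarrow> c \<noteq> \<zero> \<Longrightarrow> v c = 0" and x: "x \<in> carrier R" "x \<noteq> \<zero>" "(algebraic over F) x"
  shows "v x = 0"
proof (rule ccontr)
  assume nz: "v x \<noteq> 0"
  obtain p where p: "p \<in> carrier (F[X])" "p \<noteq> []" "eval p x = \<zero>"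
    by (rule algebraicE[OF subfieldE(1)[OF F(1)] x(1,3)])
  have "\<exists>a\<in>set p. a \<noteq> \<zero>" using p(1,2) by (auto simp: univ_poly_def polynomial_def intro!: bexI[of _ "hd p"])
  from eval_no_cancellation[OF subfieldE(3)[OF F(1)] x(1,2) set_univ_poly[OF p(1)] this] p(3) F(2) nz
  show False by auto
qed

text \<open>\<open>y\<close> is algebraic over \<open>K(y^n)\<close>, which is finite over
  \<open>K\<close>; finiteness passes through the tower of the two simple extensions.\<close>

lemma (in field) algebraic_root:
  assumes K: "subfield K R" and y: "y \<in> carrier R" "(algebraic over K) (y [^] n)" "0 < (n::nat)"
  shows "(algebraic over K) y"
proof -
  define r where "r = y [^] n"
  have rc: "r \<in> carrier R" unfolding r_def using y(1) by simp
  define L where "L = simple_extension K r"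
  have L: "subfield L R" unfolding L_def using simple_extension_is_subfield[OF K rc] y(2) unfolding r_def by blast
  have rL: "r \<in> L" unfolding L_def by (rule simple_extension_mem[OF subfieldE(1)[OF K] rc])
  obtain m where m: "n = Suc m" using gr0_implies_Suc[OF y(3)] by blast
  define p where "p = \<one> # replicate m \<zero> @ [\<ominus> r]"
  have "p \<in> carrier (L[X])" "p \<noteq> []"
    using subringE(2,3,5)[OF subfieldE(1)[OF L]] rL by (auto simp: p_def univ_poly_def polynomial_def)
  moreover have "eval p y = \<zero>"
    unfolding p_def eval_pure[OF a_inv_closed[OF rc] y(1)] m[symmetric] unfolding r_def by (rule r_neg) (use y(1) in simp)
  ultimately have alg: "(algebraic over L) y" by (rule algebraicI)
  have "finite_dimension K L" unfolding L_def using finite_dimension_simple_extension[OF K rc] y(2) unfolding r_def by blast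
  moreover have "finite_dimension L (simple_extension L y)" using finite_dimension_simple_extension[OF L y(1)] alg by blast
  ultimately have "finite_dimension K (simple_extension L y)" using telescopic_base_dim(1)[OF K L] by blast
  from finite_dimension_imp_algebraic[OF K simple_extension_is_subring[OF subfieldE(1)[OF L] y(1)] this
      simple_extension_mem[OF subfieldE(1)[OF L] y(1)]] show ?thesis .
qed

section \<open>Products of powers of linear factors\<close>

context field begin

lemma factor_carrier: "subfield F R \<Longrightarrow> c \<in> F \<Longrightarrow> [\<one>, \<ominus> c] \<in> carrier (F[X])"
  using subringE(3,5)[OF subfieldE(1)] by (auto simp: univ_poly_def polynomial_def)

text \<open>Membership, nonvanishing and degree are proved together because the degree formula for a
  product needs nonzero factors.\<close>

lemma factor_power:
  assumes F: "subfield F R" and c: "c \<in> F"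
  shows "[\<one>, \<ominus> c] [^]\<^bsub>F[X]\<^esub> (n::nat) \<in> carrier (F[X]) \<and> [\<one>, \<ominus> c] [^]\<^bsub>F[X]\<^esub> n \<noteq> [] \<and>
    degree ([\<one>, \<ominus> c] [^]\<^bsub>F[X]\<^esub> n) = n \<and> (\<forall>x\<in>carrier R. eval ([\<one>, \<ominus> c] [^]\<^bsub>F[X]\<^esub> n) x = (x \<ominus> c) [^] n)"
proof -
  interpret UP: domain "F[X]" by (rule univ_poly_is_domain[OF subfieldE(1)[OF F]])
  note Fc = subfieldE(3)[OF F] note fc = factor_carrier[OF F c]
  show ?thesis
  proof (induction n)
    case 0
    show ?case by (simp add: univ_poly_one UP.one_closed[unfolded univ_poly_one])
  next
    case (Suc n)
    let ?p = "[\<one>, \<ominus> c] [^]\<^bsub>F[X]\<^esub> n"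
    have p: "?p \<in> carrier (F[X])" "?p \<noteq> []" using Suc.IH by auto
    have eq: "[\<one>, \<ominus> c] [^]\<^bsub>F[X]\<^esub> Suc n = poly_mult ?p [\<one>, \<ominus> c]" by (simp add: univ_poly_mult)
    have cl: "[\<one>, \<ominus> c] [^]\<^bsub>F[X]\<^esub> Suc n \<in> carrier (F[X])" by (rule UP.nat_pow_closed[OF fc])
    have nz: "[\<one>, \<ominus> c] [^]\<^bsub>F[X]\<^esub> Suc n \<noteq> []"
      using UP.integral[of ?p "[\<one>, \<ominus> c]"] p fc by (auto simp: univ_poly_zero)
    have "length ?p = Suc n" using Suc.IH length_greater_0_conv[of ?p] by linarith
    hence dg: "degree ([\<one>, \<ominus> c] [^]\<^bsub>F[X]\<^esub> Suc n) = Suc n"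
      unfolding eq using poly_mult_degree_eq[OF subfieldE(1)[OF F], of ?p "[\<one>, \<ominus> c]"] p fc by (simp add: univ_poly_carrier)
    have "eval ([\<one>, \<ominus> c] [^]\<^bsub>F[X]\<^esub> Suc n) x = (x \<ominus> c) [^] Suc n" if x: "x \<in> carrier R" for x
    proof -
      have cc: "c \<in> carrier R" using c Fc by blast
      have "set ?p \<subseteq> carrier R" "set [\<one>, \<ominus> c] \<subseteq> carrier R" using set_univ_poly p(1) Fc cc by auto
      from eval_poly_mult[OF this x] Suc.IH x cc show ?thesis unfolding eq by (simp add: a_minus_def)
    qed
    thus ?case using cl nz dg by blast
  qed
qed

lemma linear_factors_poly_Suc:
  assumes F: "subfield F R" and c: "\<And>i. i \<in> {1..Suc m} \<Longrightarrow> c i \<in> F"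
  shows "linear_factors_poly R F (Suc m) c n = ([\<one>, \<ominus> c (Suc m)] [^]\<^bsub>F[X]\<^esub> n (Suc m)) \<otimes>\<^bsub>F[X]\<^esub> linear_factors_poly R F m c n"
proof -
  interpret UP: domain "F[X]" by (rule univ_poly_is_domain[OF subfieldE(1)[OF F]])
  have "{1..Suc m} = insert (Suc m) {1..m}" by (rule atLeastAtMostSuc_conv) simp
  thus ?thesis unfolding linear_factors_poly_def
    by (simp only:) (rule UP.finprod_insert, use factor_power[OF F c] in \<open>auto\<close>)
qed

lemma linear_factors_poly_props:
  assumes F: "subfield F R"
  shows "(\<And>i. i \<in> {1..m} \<Longrightarrow> c i \<in> F) \<Longrightarrow> linear_factors_poly R F m c n \<in> carrier (F[X]) \<and> linear_factors_poly R F m c n \<noteq> [] \<and>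
    degree (linear_factors_poly R F m c n) = (\<Sum>i\<in>{1..m}. n i)"
proof (induction m)
  case 0
  interpret UP: domain "F[X]" by (rule univ_poly_is_domain[OF subfieldE(1)[OF F]])
  show ?case unfolding linear_factors_poly_def using UP.one_closed by (simp add: univ_poly_one)
next
  case (Suc m)
  interpret UP: domain "F[X]" by (rule univ_poly_is_domain[OF subfieldE(1)[OF F]])
  let ?f = "[\<one>, \<ominus> c (Suc m)] [^]\<^bsub>F[X]\<^esub> n (Suc m)" and ?p = "linear_factors_poly R F m c n"
  have f: "?f \<in> carrier (F[X])" "?f \<noteq> []" "degree ?f = n (Suc m)" using factor_power[OF F Suc.prems[of "Suc m"]] by auto
  have p: "?p \<in> carrier (F[X])" "?p \<noteq> []" "degree ?p = (\<Sum>i\<in>{1..m}. n i)" using Suc.IH Suc.prems by auto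
  have eq: "linear_factors_poly R F (Suc m) c n = ?f \<otimes>\<^bsub>F[X]\<^esub> ?p" by (rule linear_factors_poly_Suc[OF F Suc.prems])
  have "degree (poly_mult ?f ?p) = n (Suc m) + (\<Sum>i\<in>{1..m}. n i)"
    using poly_mult_degree_eq[OF subfieldE(1)[OF F], of ?f ?p] f p by (simp add: univ_poly_carrier)
  moreover have "?f \<otimes>\<^bsub>F[X]\<^esub> ?p \<noteq> []" using UP.integral[of ?f ?p] f p by (auto simp: univ_poly_zero)
  ultimately show ?case unfolding eq using UP.m_closed[OF f(1) p(1)] by (simp add: univ_poly_mult)
qed

lemma eval_linear_factors_poly_0:
  assumes F: "subfield F R" and x: "x \<in> carrier R"
  shows "eval (linear_factors_poly R F 0 c n) x = \<one>"
proof -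
  interpret UP: domain "F[X]" by (rule univ_poly_is_domain[OF subfieldE(1)[OF F]])
  show ?thesis unfolding linear_factors_poly_def using x by (simp add: univ_poly_one)
qed

lemma eval_linear_factors_poly_Suc:
  assumes F: "subfield F R" and c: "\<And>i. i \<in> {1..Suc m} \<Longrightarrow> c i \<in> F" and x: "x \<in> carrier R"
  shows "eval (linear_factors_poly R F (Suc m) c n) x = (x \<ominus> c (Suc m)) [^] n (Suc m) \<otimes> eval (linear_factors_poly R F m c n) x"
proof -
  let ?f = "[\<one>, \<ominus> c (Suc m)] [^]\<^bsub>F[X]\<^esub> n (Suc m)" and ?p = "linear_factors_poly R F m c n"
  have f: "?f \<in> carrier (F[X])" "eval ?f x = (x \<ominus> c (Suc m)) [^] n (Suc m)" using factor_power[OF F c[of "Suc m"]] x by auto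
  have p: "?p \<in> carrier (F[X])" using linear_factors_poly_props[OF F, of m c n] c by simp
  have "set ?f \<subseteq> carrier R" "set ?p \<subseteq> carrier R" using set_univ_poly f(1) p subfieldE(3)[OF F] by blast+
  note ev = eval_poly_mult[OF this x]
  have eq: "linear_factors_poly R F (Suc m) c n = ?f \<otimes>\<^bsub>F[X]\<^esub> ?p" by (rule linear_factors_poly_Suc[OF F c])
  show ?thesis unfolding eq univ_poly_mult ev f(2) ..
qed

lemma eval_linear_factors_poly_closed:
  assumes F: "subfield F R" and c: "\<And>i. i \<in> {1..m} \<Longrightarrow> c i \<in> F" and K: "subfield K R" "F \<subseteq> K" "x \<in> K"
  shows "eval (linear_factors_poly R F m c n) x \<in> K"
proof -
  have xc: "x \<in> carrier R" using subfieldE(3)[OF K(1)] K(3) by blast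
  have "linear_factors_poly R F m c n \<in> carrier (F[X])" using linear_factors_poly_props[OF F, of m c n] c by blast
  hence "eval (linear_factors_poly R F m c n) x \<in> simple_extension F x"
    unfolding simple_extension_as_eval_img[OF subfieldE(3)[OF F] xc] by blast
  thus ?thesis using simple_extension_subring_incl[OF subfieldE(1)[OF K(1)] K(2,3)] by blast
qed

lemma eval_linear_factors_poly_nonzero:
  assumes F: "subfield F R" and x: "x \<in> carrier R"
  shows "(\<And>i. i \<in> {1..m} \<Longrightarrow> c i \<in> F) \<Longrightarrow> (\<And>i. i \<in> {1..m} \<Longrightarrow> x \<noteq> c i) \<Longrightarrow>
    eval (linear_factors_poly R F m c n) x \<noteq> \<zero>"
proof (induction m)
  case 0 thus ?case using eval_linear_factors_poly_0[OF F x] by simp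
next
  case (Suc m)
  have cc: "c (Suc m) \<in> carrier R" using Suc.prems(1)[of "Suc m"] subfieldE(3)[OF F] by auto
  have nz: "x \<ominus> c (Suc m) \<noteq> \<zero>" using r_right_minus_eq[OF x cc] Suc.prems(2)[of "Suc m"] by simp
  have IH: "eval (linear_factors_poly R F m c n) x \<noteq> \<zero>" using Suc.IH Suc.prems by simp
  have ec: "eval (linear_factors_poly R F m c n) x \<in> carrier R"
    using eval_linear_factors_poly_closed[OF F _ carrier_is_subfield subfieldE(3)[OF F] x] Suc.prems(1) by simp
  have ev: "eval (linear_factors_poly R F (Suc m) c n) x = (x \<ominus> c (Suc m)) [^] n (Suc m) \<otimes> eval (linear_factors_poly R F m c n) x"
    by (rule eval_linear_factors_poly_Suc[OF F Suc.prems(1) x])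
  show ?case unfolding ev using ec nz IH x cc by (simp add: integral_iff)
qed

end

lemma (in valuation) v_linear_factors_poly:
  assumes F: "subfield F R" and x: "x \<in> carrier R"
  shows "(\<And>i. i \<in> {1..m} \<Longrightarrow> c i \<in> F) \<Longrightarrow> (\<And>i. i \<in> {1..m} \<Longrightarrow> x \<noteq> c i \<and> v (x \<ominus> c i) = \<mu>) \<Longrightarrow>
    v (eval (linear_factors_poly R F m c n) x) = real (\<Sum>i\<in>{1..m}. n i) * \<mu>"
proof (induction m)
  case 0 thus ?case using eval_linear_factors_poly_0[OF F x] v_one by simp
next
  case (Suc m)
  have cc: "c (Suc m) \<in> carrier R" using Suc.prems(1)[of "Suc m"] subfieldE(3)[OF F] by auto
  have nz: "x \<ominus> c (Suc m) \<noteq> \<zero>" using r_right_minus_eq[OF x cc] Suc.prems(2)[of "Suc m"] by simp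
  have mu: "v (x \<ominus> c (Suc m)) = \<mu>" using Suc.prems(2)[of "Suc m"] by simp
  have IH: "v (eval (linear_factors_poly R F m c n) x) = real (\<Sum>i\<in>{1..m}. n i) * \<mu>" using Suc.IH Suc.prems by simp
  have enz: "eval (linear_factors_poly R F m c n) x \<noteq> \<zero>"
    using eval_linear_factors_poly_nonzero[OF F x, of m c n] Suc.prems by simp
  have ec: "eval (linear_factors_poly R F m c n) x \<in> carrier R"
    using eval_linear_factors_poly_closed[OF F _ carrier_is_subfield subfieldE(3)[OF F] x] Suc.prems(1) by simp
  have dc: "x \<ominus> c (Suc m) \<in> carrier R" using x cc by simp
  have "v ((x \<ominus> c (Suc m)) [^] n (Suc m) \<otimes> eval (linear_factors_poly R F m c n) x)
    = real (n (Suc m)) * \<mu> + real (\<Sum>i\<in>{1..m}. n i) * \<mu>"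
    using v_mult[of "(x \<ominus> c (Suc m)) [^] n (Suc m)" "eval (linear_factors_poly R F m c n) x"] v_pow[OF dc nz, of "n (Suc m)"]
      dc nz enz ec mu IH by simp
  moreover have ev: "eval (linear_factors_poly R F (Suc m) c n) x = (x \<ominus> c (Suc m)) [^] n (Suc m) \<otimes> eval (linear_factors_poly R F m c n) x"
    by (rule eval_linear_factors_poly_Suc[OF F Suc.prems(1) x])
  ultimately show ?case unfolding ev by (simp add: algebra_simps)
qed

section \<open>Definability\<close>

primrec term_pow :: "rterm \<Rightarrow> nat \<Rightarrow> rterm" where
  "term_pow s 0 = One"
| "term_pow s (Suc n) = Times (term_pow s n) s"

text \<open>Over a countable \<open>K\<close>, the variables from 10 on are used to name all elements of \<open>K\<close>.\<close>

definition naming :: "'a set \<Rightarrow> (nat \<Rightarrow> 'a) \<Rightarrow> bool" where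
  "naming K e \<longleftrightarrow> (\<forall>k. e (10 + k) = from_nat_into K k)"

definition name :: "'a set \<Rightarrow> 'a \<Rightarrow> rterm" where
  "name K a = Defs.Var (10 + to_nat_on K a)"

text \<open>\<open>\<nu> a\<close> is meant to name the negative of \<open>a\<close>, so that each
  factor is a sum.\<close>

primrec linear_factors_term :: "('a \<Rightarrow> rterm) \<Rightarrow> nat \<Rightarrow> (nat \<Rightarrow> 'a) \<Rightarrow> (nat \<Rightarrow> nat) \<Rightarrow> rterm \<Rightarrow> rterm" where
  "linear_factors_term \<nu> 0 c n s = One"
| "linear_factors_term \<nu> (Suc m) c n s = Times (term_pow (Plus s (\<nu> (c (Suc m)))) (n (Suc m))) (linear_factors_term \<nu> m c n s)"

lemma val_name: "countable K \<Longrightarrow> a \<in> K \<Longrightarrow> naming K e \<Longrightarrow> rterm_val R e (name K a) = a"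
  unfolding name_def naming_def by (simp del: add.commute)

lemma naming_upd: "i < 10 \<Longrightarrow> naming K (e(i := a)) \<longleftrightarrow> naming K e"
  unfolding naming_def by auto

lemma (in ring) val_term_pow: "rterm_val (R\<lparr>carrier := K\<rparr>) e (term_pow s n) = rterm_val (R\<lparr>carrier := K\<rparr>) e s [^] n"
  by (induction n) simp_all

lemma (in field) val_linear_factors_term:
  assumes F: "subfield F R" and K: "subfield K R" "F \<subseteq> K" "countable K" and e: "naming K e"
    and x: "rterm_val (R\<lparr>carrier := K\<rparr>) e s = x" "x \<in> K"
  shows "(\<And>i. i \<in> {1..m} \<Longrightarrow> c i \<in> F) \<Longrightarrow>
    rterm_val (R\<lparr>carrier := K\<rparr>) e (linear_factors_term (\<lambda>a. name K (\<ominus> a)) m c n s) = eval (linear_factors_poly R F m c n) x"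
proof (induction m)
  case 0
  have "x \<in> carrier R" using subfieldE(3)[OF K(1)] x(2) by blast
  from eval_linear_factors_poly_0[OF F this] show ?case by simp
next
  case (Suc m)
  have xc: "x \<in> carrier R" using subfieldE(3)[OF K(1)] x(2) by blast
  have "\<ominus> c (Suc m) \<in> K" using Suc.prems[of "Suc m"] K(2) subringE(5)[OF subfieldE(1)[OF F]] by auto
  hence nm: "rterm_val (R\<lparr>carrier := K\<rparr>) e (name K (\<ominus> c (Suc m))) = \<ominus> c (Suc m)" by (rule val_name[OF K(3) _ e])
  have IH: "rterm_val (R\<lparr>carrier := K\<rparr>) e (linear_factors_term (\<lambda>a. name K (\<ominus> a)) m c n s) = eval (linear_factors_poly R F m c n) x"
    using Suc.IH Suc.prems by simp
  have ev: "eval (linear_factors_poly R F (Suc m) c n) x = (x \<ominus> c (Suc m)) [^] n (Suc m) \<otimes> eval (linear_factors_poly R F m c n) x"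
    by (rule eval_linear_factors_poly_Suc[OF F Suc.prems xc])
  show ?case unfolding ev
    by (simp add: val_term_pow nm IH x(1) a_minus_def)
qed

context tower begin

text \<open>In the formula, variable 0 is the element tested, 1 stands for \<open>y\<close>, 2 for
  \<open>s\<close>, 3 for \<open>w\<close> and 4 for a root. The equation for \<open>y\<close> says
  \<open>y = 1/(t - x)\<close> without inverse or subtraction.\<close>

lemma definable_by_poles:
  assumes K: "subfield K R" "F \<subseteq> K" "countable K" and t: "t \<in> K"
    and tC: "\<And>i e s. naming K e \<Longrightarrow> rterm_val (R\<lparr>carrier := K\<rparr>) e s \<in> K \<Longrightarrow>
      rterm_val (R\<lparr>carrier := K\<rparr>) e (\<tau>C i s) = C i (rterm_val (R\<lparr>carrier := K\<rparr>) e s)"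
    and tB: "\<And>i e s. naming K e \<Longrightarrow> rterm_val (R\<lparr>carrier := K\<rparr>) e s \<in> K \<Longrightarrow>
      rterm_val (R\<lparr>carrier := K\<rparr>) e (\<tau>B i s) = B i (rterm_val (R\<lparr>carrier := K\<rparr>) e s)"
  shows "definable_over (R\<lparr>carrier := K\<rparr>) {x \<in> K. \<not> Pole K i x \<and> \<not> (\<exists>y\<in>K. y \<otimes> t = \<one> \<oplus> y \<otimes> x \<and> Pole K j y)}"
proof -
  let ?R = "R\<lparr>carrier := K\<rparr>"
  note Kr = subfieldE(1)[OF K(1)]
  define root where "root i s = Defs.Exists 4 (Defs.Equal (Times (term_pow (Defs.Var 4) (q i)) (\<tau>B i s)) (\<tau>C i s))" for i s
  have root: "satisfies ?R e (root i s) \<longleftrightarrow> has_root K i x"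
    if e: "naming K e" and s: "\<And>z. rterm_val ?R (e(4 := z)) s = x" and x: "x \<in> K" for e i s x
  proof -
    have "naming K (e(4 := z))" for z using e by (simp add: naming_upd)
    hence "rterm_val ?R (e(4 := z)) (\<tau>C i s) = C i x" "rterm_val ?R (e(4 := z)) (\<tau>B i s) = B i x" for z
      using tC[of "e(4 := z)" s i] tB[of "e(4 := z)" s i] s[of z] x by auto
    thus ?thesis unfolding root_def has_root_def by (simp add: val_term_pow)
  qed
  define g where "g i l = Plus (Times (Defs.Var 2) (Plus (term_pow (Defs.Var l) (q i * q i))
      (Times (term_pow (Defs.Var 2) (q i)) (term_pow (Defs.Var 3) (q i * q i))))) (name K (e i))" for i l
  define pole where "pole i l = Defs.Exists 2 (Defs.Conj (root i (Plus (Defs.Var 2) (name K (e i))))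
      (Defs.Neg (Defs.Exists 3 (root i (g i l)))))" for i l
  have eK: "e i \<in> K" for i using e(1) K(2) by blast
  have pole: "satisfies ?R a (pole i l) \<longleftrightarrow> Pole K i (a l)" if a: "naming K a" and l: "l < 2" "a l \<in> K" for a i l
  proof -
    have nu: "naming K (a(2 := s))" "naming K (a(2 := s, 4 := z))" "naming K (a(2 := s, 3 := w))" "naming K (a(2 := s, 3 := w, 4 := z))" for s w z
      using a by (simp_all add: naming_upd)
    have r1: "satisfies ?R (a(2 := s)) (root i (Plus (Defs.Var 2) (name K (e i)))) \<longleftrightarrow> has_root K i (s \<oplus> e i)" if s: "s \<in> K" for s
      by (rule root[OF nu(1)]) (simp_all add: val_name[OF K(3) eK nu(2)] subringE(7)[OF Kr s eK])
    have r2: "satisfies ?R (a(2 := s, 3 := w)) (root i (g i l)) \<longleftrightarrow> has_root K i (G i s (a l) w)" if s: "s \<in> K" "w \<in> K" for s w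
    proof (rule root[OF nu(3)])
      show "rterm_val ?R (a(2 := s, 3 := w, 4 := z)) (g i l) = G i s (a l) w" for z
        unfolding g_def G_def using l(1) by (simp add: val_name[OF K(3) eK nu(4)] val_term_pow)
      show "G i s (a l) w \<in> K" unfolding G_def by (intro subringE(6,7)[OF Kr] subring_pow[OF Kr] s l(2) eK)
    qed
    show ?thesis unfolding pole_def Pole_def by (simp add: r1 r2)
  qed
  define \<phi> where "\<phi> = Defs.Conj (Defs.Neg (pole i 0)) (Defs.Neg (Defs.Exists 1 (Defs.Conj
    (Defs.Equal (Times (Defs.Var 1) (name K t)) (Plus One (Times (Defs.Var 1) (Defs.Var 0)))) (pole j 1))))"
  \<comment> \<open>The subtraction truncates, so the first ten variables also get a value in
    \<open>K\<close>; the formula binds or overwrites those among them that it uses.\<close>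
  define p where "p k = from_nat_into K (k - 10)" for k
  have pK: "p k \<in> K" for k unfolding p_def using from_nat_into[of K] t by blast
  have np: "naming K p" unfolding naming_def p_def by simp
  have sat: "satisfies ?R (p(0 := x)) \<phi> \<longleftrightarrow> \<not> Pole K i x \<and> \<not> (\<exists>y\<in>K. y \<otimes> t = \<one> \<oplus> y \<otimes> x \<and> Pole K j y)" if x: "x \<in> K" for x
  proof -
    have nu: "naming K (p(0 := x))" "naming K (p(0 := x, 1 := y))" for y using np by (simp_all add: naming_upd)
    have "satisfies ?R (p(0 := x, 1 := y)) (pole j 1) \<longleftrightarrow> Pole K j y" if "y \<in> K" for y
      using pole[OF nu(2)[of y], of 1 j] that by simp
    moreover have "satisfies ?R (p(0 := x)) (pole i 0) \<longleftrightarrow> Pole K i x" using pole[OF nu(1), of 0 i] x by simp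
    moreover have "rterm_val ?R (p(0 := x, Suc 0 := y)) (name K t) = t" for y using val_name[OF K(3) t nu(2)[of y]] by simp
    ultimately show ?thesis unfolding \<phi>_def by simp
  qed
  show ?thesis unfolding definable_over_def
    by (intro exI[of _ \<phi>] exI[of _ p] conjI allI) (use pK sat in auto)
qed

end

text \<open>Algebraicity over \<open>K0\<close> provides each element transcendental over
  \<open>F\<close> with a pole in \<open>Val\<close>. So what is not a pole of index 0 is algebraic
  over \<open>F\<close>, and for such an \<open>x\<close> a place at which \<open>t - x\<close>
  vanishes separates \<open>x\<close> from all elements of \<open>F\<close> other than
  \<open>x\<close>.\<close>

theorem (in field) definable_in_algebraic_field:
  fixes A :: "nat \<Rightarrow> 'a set" and q m k :: "nat \<Rightarrow> nat" and c b :: "nat \<Rightarrow> nat \<Rightarrow> 'a" and n j :: "nat \<Rightarrow> nat \<Rightarrow> nat"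
    and C B :: "nat \<Rightarrow> 'a list"
  assumes cR: "countable (carrier R)" and F: "subfield F R" "infinite F"
    and K0: "subfield K0 R" "F \<subseteq> K0" "t \<in> K0" "\<And>L. subfield L R \<Longrightarrow> F \<subseteq> L \<Longrightarrow> t \<in> L \<Longrightarrow> K0 \<subseteq> L"
    and alg: "\<And>z. z \<in> carrier R \<Longrightarrow> (algebraic over K0) z"
    and t: "t \<in> carrier R" "(transcendental over F) t"
    and A: "\<And>u. u \<ge> 1 \<Longrightarrow> A u \<subseteq> F"
    and q: "\<And>u. u \<ge> 1 \<Longrightarrow> Factorial_Ring.prime (q u)" "\<And>u. u \<ge> 1 \<Longrightarrow> [q u] \<cdot> \<one> \<noteq> \<zero>" "inj_on q {1..}"
    and C: "\<And>u. u \<ge> 1 \<Longrightarrow> C u = linear_factors_poly R F (m u) (c u) (n u)"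
    and B: "\<And>u. u \<ge> 1 \<Longrightarrow> B u = linear_factors_poly R F (k u) (b u) (j u)"
    and in_F: "\<And>u i. u \<ge> 1 \<Longrightarrow> i \<in> {1..m u} \<Longrightarrow> c u i \<in> F"
      "\<And>u i. u \<ge> 1 \<Longrightarrow> i \<in> {1..k u} \<Longrightarrow> b u i \<in> F"
    and deg: "\<And>u. u \<ge> 1 \<Longrightarrow> 0 < int (degree (C u)) - int (degree (B u))"
      "\<And>u. u \<ge> 1 \<Longrightarrow> \<not> [int (degree (C u)) - int (degree (B u)) = 0] (mod int (q u))"
    and roots: "\<And>u x. u \<ge> 1 \<Longrightarrow> x \<in> carrier R \<Longrightarrow> eval (B u) x \<noteq> \<zero> \<Longrightarrow>
      \<exists>y\<in>carrier R. y [^] q u \<otimes> eval (B u) x = eval (C u) x"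
  shows "\<exists>K. subfield K R \<and> K0 \<subseteq> K \<and>
    (\<forall>S. finite S \<longrightarrow> S \<subseteq> K \<longrightarrow> (\<exists>L. subfield L R \<and> K0 \<subseteq> L \<and> S \<subseteq> L \<and> L \<subset> K)) \<and>
    (\<forall>u\<ge>1. definable_over (R\<lparr>carrier := K\<rparr>) (A u))"
proof -
  note Fc = subfieldE(3)[OF F(1)] note tK0 = K0(3)
  define Val where "Val = {v. valuation R v \<and> (\<forall>c\<in>F. c \<noteq> \<zero> \<longrightarrow> v c = 0) \<and> (\<forall>c\<in>K0. c \<noteq> \<zero> \<longrightarrow> v c \<in> \<int>)
    \<and> (\<exists>c\<in>K0. c \<noteq> \<zero> \<and> v c \<noteq> 0)}"
  have Val_ex: "\<exists>v\<in>Val. v x < 0" if "x \<in> carrier R" "(transcendental over F) x" for x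
    using function_field_valuation_exists[OF F(1) t K0 alg that] unfolding Val_def by blast
  have algF: "subfield {z \<in> carrier R. (algebraic over F) z} R" by (rule subfield_of_algebraics[OF F(1)])
  have F_alg: "(algebraic over F) a" if "a \<in> F" for a using algebraic_self[OF subfieldE(1)[OF F(1)] that] .
  have nz: "x \<noteq> \<zero>" if "(transcendental over F) x" for x
    using that zero_is_algebraic[OF subfieldE(1)[OF F(1)]] by (auto simp: over_def)
  have t_minus: "(transcendental over F) (t \<ominus> x)" if x: "x \<in> carrier R" "(algebraic over F) x" for x
  proof (rule ccontr)
    assume "\<not> ?thesis"
    hence "(t \<ominus> x) \<oplus> x \<in> {z \<in> carrier R. (algebraic over F) z}"
      using subringE(7)[OF subfieldE(1)[OF algF], of "t \<ominus> x" x] x t(1) by (simp add: over_def)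
    moreover have "(t \<ominus> x) \<oplus> x = t" using x(1) t(1) by algebra
    ultimately show False using t(2) by (simp add: over_def)
  qed
  define Z where "Z i = c (Suc i) ` {1..m (Suc i)} \<union> b (Suc i) ` {1..k (Suc i)}" for i
  have Z: "finite (Z i)" "Z i \<subseteq> F" for i unfolding Z_def using in_F[of "Suc i"] by auto
  define e where "e i = (SOME a. a \<in> F - Z i)" for i
  have e: "e i \<in> F - Z i" for i
  proof -
    have "F - Z i \<noteq> {}" using F(2) Z(1)[of i] finite_subset[of F "Z i"] by blast
    thus ?thesis unfolding e_def by (rule some_in_eq[THEN iffD2])
  qed
  \<comment> \<open>Index \<open>i\<close> of the tower uses \<open>q (Suc i)\<close> and the
    rational function of the same number. So \<open>F\<close> is coded with \<open>q 1\<close>, and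
    \<open>A u\<close> with \<open>q (Suc u)\<close>.\<close>
  define Y where "Y i = (if i = 0 then F else (\<lambda>a. inv (t \<ominus> a)) ` A i)" for i
  have ta: "a \<in> carrier R" "t \<ominus> a \<in> K0" "t \<ominus> a \<noteq> \<zero>" if "i \<noteq> 0" "a \<in> A i" for i a
  proof -
    have a: "a \<in> F" using A[of i] that by auto
    thus "a \<in> carrier R" using Fc by blast
    show "t \<ominus> a \<in> K0" unfolding a_minus_def using subringE(5,7)[OF subfieldE(1)[OF K0(1)]] K0(2,3) a by blast
    show "t \<ominus> a \<noteq> \<zero>" using nz[OF t_minus] F_alg a Fc by blast
  qed
  define CC where "CC i x = eval (C (Suc i)) x" for i x
  define BB where "BB i x = eval (B (Suc i)) x" for i x
  have cF: "\<And>i l. l \<in> {1..m (Suc i)} \<Longrightarrow> c (Suc i) l \<in> F" and bF: "\<And>i l. l \<in> {1..k (Suc i)} \<Longrightarrow> b (Suc i) l \<in> F"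
    using in_F by auto
  have CS: "C (Suc i) = linear_factors_poly R F (m (Suc i)) (c (Suc i)) (n (Suc i))"
    and BS: "B (Suc i) = linear_factors_poly R F (k (Suc i)) (b (Suc i)) (j (Suc i))" for i using C B by auto
  define dC where "dC i = (\<Sum>l\<in>{1..m (Suc i)}. n (Suc i) l)" for i
  define dB where "dB i = (\<Sum>l\<in>{1..k (Suc i)}. j (Suc i) l)" for i
  have dC: "degree (C (Suc i)) = dC i" for i unfolding CS dC_def by (rule linear_factors_poly_props[OF F(1), THEN conjunct2, THEN conjunct2]) (erule cF)
  have dB: "degree (B (Suc i)) = dB i" for i unfolding BS dB_def by (rule linear_factors_poly_props[OF F(1), THEN conjunct2, THEN conjunct2]) (erule bF)
  have "tower R F K0 Val (\<lambda>i. q (Suc i)) CC BB Z dC dB e Y"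
  proof (intro tower.intro tower_axioms.intro)
    show "field R" by (rule field_axioms)
    show "subfield F R" "infinite F" "subfield K0 R" "F \<subseteq> K0" by (rule F K0)+
    show "\<And>v. v \<in> Val \<Longrightarrow> valuation R v" "\<And>v c. v \<in> Val \<Longrightarrow> c \<in> F \<Longrightarrow> c \<noteq> \<zero> \<Longrightarrow> v c = 0"
      "\<And>v c. v \<in> Val \<Longrightarrow> c \<in> K0 \<Longrightarrow> c \<noteq> \<zero> \<Longrightarrow> v c \<in> \<int>" "\<And>v. v \<in> Val \<Longrightarrow> \<exists>c\<in>K0. c \<noteq> \<zero> \<and> v c \<noteq> 0"
      unfolding Val_def by blast+
    show "Val \<noteq> {}" using Val_ex[OF t] by blast
    show "\<And>i. Factorial_Ring.prime (q (Suc i))" "\<And>i. [q (Suc i)] \<cdot> \<one> \<noteq> \<zero>" using q(1,2) by auto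
    show "inj (\<lambda>i. q (Suc i))" using q(3) by (auto simp: inj_on_def)
    show "\<And>i. finite (Z i)" "\<And>i. Z i \<subseteq> F" by (rule Z)+
    show "\<And>i. e i \<in> F" "\<And>i. e i \<notin> Z i" using e by blast+
    show "CC i x \<in> K" "BB i x \<in> K" if "subfield K R" "F \<subseteq> K" "x \<in> K" for K i x
      unfolding CC_def BB_def CS BS
      by (rule eval_linear_factors_poly_closed[OF F(1) cF that], assumption)
        (rule eval_linear_factors_poly_closed[OF F(1) bF that], assumption)
    show "v (CC i x) = real (dC i) * \<mu>" if v: "v \<in> Val" "x \<in> carrier R" "\<And>c. c \<in> Z i \<Longrightarrow> x \<noteq> c \<and> v (x \<ominus> c) = \<mu>" for v i x \<mu>
    proof -
      interpret valuation R v using v(1) unfolding Val_def by blast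
      show ?thesis unfolding CC_def CS dC_def
        by (rule v_linear_factors_poly[OF F(1) v(2)]) (use cF v(3) in \<open>auto simp: Z_def\<close>)
    qed
    show "v (BB i x) = real (dB i) * \<mu>" if v: "v \<in> Val" "x \<in> carrier R" "\<And>c. c \<in> Z i \<Longrightarrow> x \<noteq> c \<and> v (x \<ominus> c) = \<mu>" for v i x \<mu>
    proof -
      interpret valuation R v using v(1) unfolding Val_def by blast
      show ?thesis unfolding BB_def BS dB_def
        by (rule v_linear_factors_poly[OF F(1) v(2)]) (use bF v(3) in \<open>auto simp: Z_def\<close>)
    qed
    show "CC i x \<noteq> \<zero>" "BB i x \<noteq> \<zero>" if x: "x \<in> carrier R" "x \<notin> Z i" for i x
    proof -
      show "CC i x \<noteq> \<zero>" unfolding CC_def CS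
        by (rule eval_linear_factors_poly_nonzero[OF F(1) x(1)]) (use cF x(2) in \<open>auto simp: Z_def\<close>)
      show "BB i x \<noteq> \<zero>" unfolding BB_def BS
        by (rule eval_linear_factors_poly_nonzero[OF F(1) x(1)]) (use bF x(2) in \<open>auto simp: Z_def\<close>)
    qed
    show "dB i < dC i" for i using deg(1)[of "Suc i"] unfolding dC dB by simp
    show "coprime (int (dC i) - int (dB i)) (int (q (Suc i)))" for i
    proof -
      have "\<not> int (q (Suc i)) dvd int (dC i) - int (dB i)" using deg(2)[of "Suc i"] unfolding dC dB by (simp add: cong_0_iff)
      moreover have "Factorial_Ring.prime (int (q (Suc i)))" using q(1)[of "Suc i"] by simp
      ultimately show ?thesis using prime_imp_coprime coprime_commute by blast
    qed
    show "\<exists>y\<in>carrier R. y [^] q (Suc i) \<otimes> BB i x = CC i x" if "x \<in> carrier R" "BB i x \<noteq> \<zero>" for i x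
      using roots[of "Suc i" x] that unfolding CC_def BB_def by simp
    show "Y i \<subseteq> K0" for i
    proof (cases "i = 0")
      case True thus ?thesis unfolding Y_def using K0(2) by simp
    next
      case False
      show ?thesis
      proof
        fix y assume "y \<in> Y i"
        then obtain a where a: "a \<in> A i" "y = inv (t \<ominus> a)" unfolding Y_def using False by auto
        thus "y \<in> K0" using subfield_m_inv(1)[OF K0(1), of "t \<ominus> a"] ta(2,3)[OF False a(1)] by blast
      qed
    qed
  qed
  then interpret tower R F K0 Val "\<lambda>i. q (Suc i)" CC BB Z dC dB e Y .
  obtain K where K: "subfield K R" "K0 \<subseteq> K" and \<alpha>: "\<forall>i. \<forall>y\<in>Y i. \<not> Pole K i y"
    and \<beta>: "\<forall>i. \<forall>x\<in>K. x \<noteq> \<zero> \<longrightarrow> (\<exists>v\<in>Val. v x < 0 \<and> (\<forall>y\<in>Y i. y = \<zero> \<or> 0 \<le> v y)) \<longrightarrow> Pole K i x"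
    and large: "\<forall>S. finite S \<longrightarrow> S \<subseteq> K \<longrightarrow> (\<exists>L. subfield L R \<and> K0 \<subseteq> L \<and> S \<subseteq> L \<and> L \<subset> K)"
    using generic_field[OF cR] by (elim exE conjE) (rule that)
  have nopole: "\<not> Pole K i y" if y: "y \<in> Y i" for i y using \<alpha> y by blast
  have haspole: "Pole K i x" if x: "x \<in> K" "x \<noteq> \<zero>" and v: "v \<in> Val" "v x < 0" "\<forall>y\<in>Y i. y = \<zero> \<or> 0 \<le> v y" for i x v
  proof -
    have "\<exists>v\<in>Val. v x < 0 \<and> (\<forall>y\<in>Y i. y = \<zero> \<or> 0 \<le> v y)" using v by (intro bexI[of _ v] conjI)
    thus ?thesis using \<beta>[THEN spec, THEN bspec, OF x(1)] x(2) by simp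
  qed
  note Kc = subfieldE(3)[OF K(1)]
  have FK: "F \<subseteq> K" and tK: "t \<in> K" using K(2) K0(2) tK0 by auto
  have "definable_over (R\<lparr>carrier := K\<rparr>) (A u)" if u: "u \<ge> 1" for u
  proof -
    have def_poles: "definable_over (R\<lparr>carrier := K\<rparr>) {x \<in> K. \<not> Pole K 0 x \<and> \<not> (\<exists>y\<in>K. y \<otimes> t = \<one> \<oplus> y \<otimes> x \<and> Pole K u y)}"
    proof (rule definable_by_poles[OF K(1) FK countable_subset[OF Kc cR] tK])
      show "rterm_val (R\<lparr>carrier := K\<rparr>) \<epsilon> (linear_factors_term (\<lambda>a. name K (\<ominus> a)) (m (Suc i)) (c (Suc i)) (n (Suc i)) s)
          = CC i (rterm_val (R\<lparr>carrier := K\<rparr>) \<epsilon> s)"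
        if "naming K \<epsilon>" "rterm_val (R\<lparr>carrier := K\<rparr>) \<epsilon> s \<in> K" for i \<epsilon> s
        unfolding CC_def CS
        by (rule val_linear_factors_term[OF F(1) K(1) FK countable_subset[OF Kc cR] that(1) refl that(2) cF])
      show "rterm_val (R\<lparr>carrier := K\<rparr>) \<epsilon> (linear_factors_term (\<lambda>a. name K (\<ominus> a)) (k (Suc i)) (b (Suc i)) (j (Suc i)) s)
          = BB i (rterm_val (R\<lparr>carrier := K\<rparr>) \<epsilon> s)"
        if "naming K \<epsilon>" "rterm_val (R\<lparr>carrier := K\<rparr>) \<epsilon> s \<in> K" for i \<epsilon> s
        unfolding BB_def BS
        by (rule val_linear_factors_term[OF F(1) K(1) FK countable_subset[OF Kc cR] that(1) refl that(2) bF])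
    qed
    have inv_iff: "y \<otimes> t = \<one> \<oplus> y \<otimes> x \<longleftrightarrow> y \<otimes> (t \<ominus> x) = \<one>" if c: "y \<in> carrier R" "x \<in> carrier R" for x y
    proof
      assume "y \<otimes> t = \<one> \<oplus> y \<otimes> x"
      moreover have "y \<otimes> (t \<ominus> x) = y \<otimes> t \<ominus> y \<otimes> x" using c t(1) by algebra
      ultimately have "y \<otimes> (t \<ominus> x) = (\<one> \<oplus> y \<otimes> x) \<ominus> y \<otimes> x" by simp
      thus "y \<otimes> (t \<ominus> x) = \<one>" using c by algebra
    next
      assume *: "y \<otimes> (t \<ominus> x) = \<one>"
      have "y \<otimes> t = y \<otimes> (t \<ominus> x) \<oplus> y \<otimes> x" using c t(1) by algebra
      thus "y \<otimes> t = \<one> \<oplus> y \<otimes> x" unfolding * .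
    qed
    have "A u = {x \<in> K. \<not> Pole K 0 x \<and> \<not> (\<exists>y\<in>K. y \<otimes> t = \<one> \<oplus> y \<otimes> x \<and> Pole K u y)}" (is "_ = ?S")
    proof
      show "A u \<subseteq> ?S"
      proof
        fix x assume x: "x \<in> A u"
        have xF: "x \<in> F" using A[OF u] x by blast
        have "\<not> Pole K u y" if y: "y \<in> K" "y \<otimes> t = \<one> \<oplus> y \<otimes> x" for y
        proof -
          have u0: "u \<noteq> 0" using u by simp
          have yc: "y \<in> carrier R" using y(1) Kc by blast
          have c: "t \<ominus> x \<in> carrier R" "t \<ominus> x \<noteq> \<zero>" using ta[OF u0 x] t(1) by simp_all
          have "y \<otimes> (t \<ominus> x) = \<one>" using inv_iff[OF yc ta(1)[OF u0 x]] y(2) by simp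
          hence "inv (t \<ominus> x) = y" using comm_inv_char[of "t \<ominus> x" y] c yc by (simp add: m_comm)
          hence "y \<in> Y u" unfolding Y_def using u0 x by auto
          thus ?thesis by (rule nopole)
        qed
        moreover have "\<not> Pole K 0 x" by (rule nopole) (simp add: Y_def xF)
        ultimately show "x \<in> ?S" using xF FK by blast
      qed
      show "?S \<subseteq> A u"
      proof
        fix x assume x: "x \<in> ?S"
        hence xK: "x \<in> K" and p0: "\<not> Pole K 0 x" and pu: "\<And>y. y \<in> K \<Longrightarrow> y \<otimes> t = \<one> \<oplus> y \<otimes> x \<Longrightarrow> \<not> Pole K u y" by blast+
        have xc: "x \<in> carrier R" using xK Kc by blast
        \<comment> \<open>A transcendental \<open>x\<close> has a pole at some place in
          \<open>Val\<close>. Elements of \<open>Y 0 = F\<close> have none there, so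
          \<open>x\<close> would be a pole of index 0.\<close>
        have xalg: "(algebraic over F) x"
        proof (rule ccontr)
          assume "\<not> ?thesis"
          hence tr: "(transcendental over F) x" by (simp add: over_def)
          obtain v where v: "v \<in> Val" "v x < 0" using Val_ex[OF xc tr] by blast
          have "\<forall>y\<in>Y 0. y = \<zero> \<or> 0 \<le> v y" unfolding Y_def using v(1) by (auto simp: Val_def)
          from haspole[OF xK nz[OF tr] v this] p0 show False by blast
        qed
        show "x \<in> A u"
        proof (rule ccontr)
          assume nA: "x \<notin> A u"
          note tr = t_minus[OF xc xalg]
          have c: "t \<ominus> x \<in> carrier R" "t \<ominus> x \<noteq> \<zero>" using t(1) xc nz[OF tr] by simp_all
          define y where "y = inv (t \<ominus> x)"
          have y: "y \<in> carrier R" "y \<otimes> (t \<ominus> x) = \<one>" "y \<noteq> \<zero>" "inv y = t \<ominus> x"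
            unfolding y_def using c nonzero_imp_inverse_nonzero[OF c] comm_inv_char[of "inv (t \<ominus> x)" "t \<ominus> x"] by simp_all
          have "t \<ominus> x \<in> K" unfolding a_minus_def using subringE(5,7)[OF subfieldE(1)[OF K(1)]] tK xK by blast
          hence yK: "y \<in> K" unfolding y_def using subfield_m_inv(1)[OF K(1), of "t \<ominus> x"] c(2) by blast
          have "(transcendental over F) y"
          proof (rule ccontr)
            assume "\<not> ?thesis"
            hence "y \<in> {z \<in> carrier R. (algebraic over F) z} - {\<zero>}" using y by (simp add: over_def)
            from subfield_m_inv(1)[OF algF this] show False unfolding y(4) using tr by (simp add: over_def)
          qed
          \<comment> \<open>A pole of \<open>y\<close> is a zero of \<open>t - x\<close>. For
            \<open>a\<close> in \<open>A u\<close> the difference \<open>x - a\<close> is nonzero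
            and algebraic over \<open>F\<close>, hence of value 0; so \<open>t - a\<close> is a unit
            at \<open>v\<close>, and all of \<open>Y u\<close> is integral there.\<close>
          then obtain v where v: "v \<in> Val" "v y < 0" using Val_ex[OF y(1)] by blast
          interpret valuation R v using v(1) unfolding Val_def by blast
          have vF: "\<And>c. c \<in> F \<Longrightarrow> c \<noteq> \<zero> \<Longrightarrow> v c = 0" using v(1) unfolding Val_def by blast
          have vt: "0 < v (t \<ominus> x)" using v_inv[OF c] v(2) unfolding y_def by simp
          have "y' = \<zero> \<or> 0 \<le> v y'" if "y' \<in> Y u" for y'
          proof -
            have u0: "u \<noteq> 0" using u by simp
            obtain a where a: "a \<in> A u" "y' = inv (t \<ominus> a)" using \<open>y' \<in> Y u\<close> u0 unfolding Y_def by auto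
            have ac: "a \<in> carrier R" "t \<ominus> a \<noteq> \<zero>" "a \<in> F" using ta[OF u0 a(1)] A[OF u] a(1) by auto
            have xa: "x \<ominus> a \<in> carrier R" "x \<ominus> a \<noteq> \<zero>" using xc ac(1) nA a(1) r_right_minus_eq[OF xc ac(1)] by auto
            have "x \<ominus> a \<in> {z \<in> carrier R. (algebraic over F) z}" unfolding a_minus_def
              using subringE(5,7)[OF subfieldE(1)[OF algF]] xc xalg ac F_alg by blast
            hence v0: "v (x \<ominus> a) = 0" using v_algebraic[OF F(1) vF xa] by blast
            have "t \<ominus> a = (x \<ominus> a) \<oplus> (t \<ominus> x)" using xc ac(1) t(1) by algebra
            hence "v (t \<ominus> a) = 0" using v_add_eq[OF xa c(1)] v0 vt by simp
            thus ?thesis unfolding a(2) using v_inv[of "t \<ominus> a"] ac t(1) by simp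
          qed
          hence "Pole K u y" using haspole[OF yK y(3) v] by blast
          moreover have "y \<otimes> t = \<one> \<oplus> y \<otimes> x" using inv_iff[OF y(1) xc] y(2) by simp
          ultimately show False using pu[OF yK] by blast
        qed
      qed
    qed
    thus ?thesis using def_poles by simp
  qed
  thus ?thesis using K large by blast
qed

text \<open>A finite basis would lie in a proper subfield containing \<open>L\<close>, and so would
  its span.\<close>

lemma (in field) infinite_dimension_of_chain:
  assumes L: "subfield L R" and K: "subfield K R" "L \<subseteq> K"
    and chain: "\<forall>S. finite S \<longrightarrow> S \<subseteq> K \<longrightarrow> (\<exists>L'. subfield L' R \<and> L \<subseteq> L' \<and> S \<subseteq> L' \<and> L' \<subset> K)"
  shows "infinite_dimension L K"
proof
  assume "finite_dimension L K"
  then obtain n where "dimension n L K" by blast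
  from exists_base[OF L this] obtain Us where Us: "set Us \<subseteq> carrier R" "Span L Us = K" by blast
  have "set Us \<subseteq> K" using Span_base_incl[OF L Us(1)] Us(2) by simp
  then obtain L' where L': "subfield L' R" "L \<subseteq> L'" "set Us \<subseteq> L'" "L' \<subset> K" using chain by blast
  have "subalgebra L L' R"
    by (intro subalgebra.intro subalgebra_axioms.intro subring.axioms(1)[OF subfieldE(1)[OF L'(1)]])
      (use L'(2) subringE(6)[OF subfieldE(1)[OF L'(1)]] in blast)
  from subalgebra_Span_incl[OF L this L'(3)] L'(4) Us(2) show False by blast
qed

text \<open>The least positive \<open>l\<close> with \<open>l\<close> times 1 equal to 0 divides
  every other such number, in particular \<open>p\<close>. It is not 1, so it would be
  \<open>p\<close>.\<close>

lemma (in field) add_pow_field_char_nonzero: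
  assumes "Factorial_Ring.prime (p::nat)" "p \<noteq> field_char R"
  shows "[p] \<cdot> \<one> \<noteq> \<zero>"
proof
  assume z: "[p] \<cdot> \<one> = \<zero>"
  define Q where "Q n \<longleftrightarrow> n > 0 \<and> [n] \<cdot> \<one> = \<zero>" for n :: nat
  have Qp: "Q p" unfolding Q_def using z prime_gt_0_nat[OF assms(1)] by simp
  define l where "l = (LEAST n. Q n)"
  have Ql: "Q l" unfolding l_def by (rule LeastI[of Q, OF Qp])
  have "\<exists>n. Q n" using Qp by blast
  hence l: "field_char R = l" unfolding field_char_def l_def Q_def by (rule if_P)
  have mult: "[(k * l)] \<cdot> \<one> = \<zero>" for k :: nat
    using Ql unfolding Q_def by (induction k) (simp_all add: add.nat_pow_mult[symmetric])
  have "[(p mod l)] \<cdot> \<one> = [(p div l * l)] \<cdot> \<one> \<oplus> [(p mod l)] \<cdot> \<one>" unfolding mult by simp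
  also have "\<dots> = [p] \<cdot> \<one>" unfolding add.nat_pow_mult[OF one_closed] by simp
  finally have pm: "[(p mod l)] \<cdot> \<one> = \<zero>" using z by simp
  have "p mod l = 0"
  proof (rule ccontr)
    assume "p mod l \<noteq> 0"
    hence "Q (p mod l)" unfolding Q_def using pm by simp
    hence "l \<le> p mod l" unfolding l_def by (rule Least_le)
    moreover have "p mod l < l" using Ql unfolding Q_def by simp
    ultimately show False by simp
  qed
  hence "l dvd p" by presburger
  hence "l = 1 \<or> l = p" using assms(1) by (simp add: prime_nat_iff)
  thus False using Ql assms(2) l unfolding Q_def by auto
qed

theorem theorem3p3:
  fixes M :: "('a, 'b) ring_scheme" (structure)
    and F :: "'a set"
    and A :: "nat \<Rightarrow> 'a set"
    and t :: 'a
    and q m k :: "nat \<Rightarrow> nat"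
    and c b :: "nat \<Rightarrow> nat \<Rightarrow> 'a"
    and n j :: "nat \<Rightarrow> nat \<Rightarrow> nat"
    and C B :: "nat \<Rightarrow> 'a list"
  assumes M: "field M" "countable (carrier M)"
    and F: "subfield F M" "countable F"
    and A: "\<And>u. u \<ge> 1 \<Longrightarrow> A u \<subseteq> F" "\<And>u. u \<ge> 1 \<Longrightarrow> countable (A u)"
    and t: "t \<in> carrier M" "ring.transcendental M F t"
    and q: "\<And>u. u \<ge> 1 \<Longrightarrow> Factorial_Ring.prime (q u)"
      "\<And>u. u \<ge> 1 \<Longrightarrow> q u \<noteq> field_char M"
      "inj_on q {1..}"
    and C: "\<And>u. u \<ge> 1 \<Longrightarrow> C u = linear_factors_poly M F (m u) (c u) (n u)"
    and B: "\<And>u. u \<ge> 1 \<Longrightarrow> B u = linear_factors_poly M F (k u) (b u) (j u)"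
    and in_F: "\<And>u i. u \<ge> 1 \<Longrightarrow> i \<in> {1..m u} \<Longrightarrow> c u i \<in> F"
      "\<And>u i. u \<ge> 1 \<Longrightarrow> i \<in> {1..k u} \<Longrightarrow> b u i \<in> F"
    and distinct: "\<And>u. u \<ge> 1 \<Longrightarrow> inj_on (c u) {1..m u}"
      "\<And>u. u \<ge> 1 \<Longrightarrow> inj_on (b u) {1..k u}"
      "\<And>u. u \<ge> 1 \<Longrightarrow> c u ` {1..m u} \<inter> b u ` {1..k u} = {}"
    and pos: "\<And>u i. u \<ge> 1 \<Longrightarrow> i \<in> {1..m u} \<Longrightarrow> n u i > 0"
      "\<And>u i. u \<ge> 1 \<Longrightarrow> i \<in> {1..k u} \<Longrightarrow> j u i > 0"
    and n1: "\<And>u. u \<ge> 1 \<Longrightarrow> m u \<ge> 1" "\<And>u. u \<ge> 1 \<Longrightarrow> \<not> [n u 1 = 0] (mod q u)"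
    and deg: "\<And>u. u \<ge> 1 \<Longrightarrow> 0 < int (degree (C u)) - int (degree (B u))"
      "\<And>u. u \<ge> 1 \<Longrightarrow> \<not> [int (degree (C u)) - int (degree (B u)) = 0] (mod int (q u))"
    and roots: "\<And>u x. u \<ge> 1 \<Longrightarrow> x \<in> carrier M \<Longrightarrow> ring.eval M (B u) x \<noteq> \<zero> \<Longrightarrow>
      \<exists>y\<in>carrier M. y [^] q u = ring.eval M (C u) x \<otimes> inv (ring.eval M (B u) x)"
    and compl: "\<And>u E. u \<ge> 1 \<Longrightarrow> finite E \<Longrightarrow> E \<subseteq> F \<Longrightarrow>
      infinite (F - {x \<in> F. \<exists>a\<in>A u. \<exists>e\<in>E. x = a \<oplus> e})"
  shows "\<exists>K. subfield K M \<and>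
    infinite_algebraic_extension M (generate_field M (insert t F)) K \<and>
    (\<forall>u\<ge>1. definable_over (M\<lparr>carrier := K\<rparr>) (A u))"
proof -
  interpret M: field M by (rule M(1))
  note Fc = subfieldE(3)[OF F(1)]
  have tF: "insert t F \<subseteq> carrier M" using t(1) Fc by blast
  define K0 where "K0 = generate_field M (insert t F)"
  have K0: "subfield K0 M" "F \<subseteq> K0" "t \<in> K0"
    unfolding K0_def using M.generate_field_is_subfield[OF tF] generate_field.incl[of _ "insert t F" M] by blast+
  have K0_min: "K0 \<subseteq> L" if "subfield L M" "F \<subseteq> L" "t \<in> L" for L
    unfolding K0_def using M.generate_field_min_subfield1[OF tF that(1)] that(2,3) by blast
  \<comment> \<open>The construction takes place in the algebraic closure \<open>E\<close> of
    \<open>F(t)\<close> inside \<open>M\<close>, regarded as a field \<open>N\<close> of its own.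
    The hypothesis on roots passes to it, since a root of an element of \<open>E\<close> is again in
    \<open>E\<close>.\<close>
  define E where "E = {z \<in> carrier M. (M.algebraic over K0) z}"
  have E: "subfield E M" unfolding E_def by (rule M.subfield_of_algebraics[OF K0(1)])
  note Er = subfieldE(1)[OF E] note Ec = subfieldE(3)[OF E]
  have K0E: "K0 \<subseteq> E" unfolding E_def using subfieldE(3)[OF K0(1)] M.algebraic_self[OF subfieldE(1)[OF K0(1)]] by blast
  define N where "N = M\<lparr>carrier := E\<rparr>"
  interpret N: field N unfolding N_def by (rule M.subfield_iff(2)[OF E])
  have N_simps: "carrier N = E" "\<And>x y. x \<otimes>\<^bsub>N\<^esub> y = x \<otimes> y" "\<one>\<^bsub>N\<^esub> = \<one>" "\<zero>\<^bsub>N\<^esub> = \<zero>"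
    "\<And>L. N\<lparr>carrier := L\<rparr> = M\<lparr>carrier := L\<rparr>" unfolding N_def by simp_all
  have sub_N: "subfield L N" if "subfield L M" "L \<subseteq> E" for L
    by (rule N.subfield_iff(1)) (use M.subfield_iff(2)[OF that(1)] that(2) in \<open>simp_all add: N_simps\<close>)
  have sub_M: "subfield L M" "L \<subseteq> E" if "subfield L N" for L
  proof -
    show "L \<subseteq> E" using subfieldE(3)[OF that] by (simp add: N_simps)
    thus "subfield L M" using M.subfield_iff(1)[of L] N.subfield_iff(2)[OF that] Ec by (auto simp: N_simps)
  qed
  have FE: "F \<subseteq> E" and tE: "t \<in> E" using K0 K0E by auto
  have trans_N: "ring.transcendental N = ring.transcendental M" unfolding N_def using M.transcendental_consistent[OF Er] by simp
  have eval_N: "ring.eval N = ring.eval M" unfolding N_def by (rule M.eval_consistent[OF Er])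
  have pow_N: "x [^]\<^bsub>N\<^esub> (l::nat) = x [^] l" for x l unfolding N_def by (rule M.nat_pow_consistent[symmetric])
  have add_pow_N: "[(l::nat)] \<cdot>\<^bsub>N\<^esub> \<one>\<^bsub>N\<^esub> = [l] \<cdot> \<one>" for l unfolding N_def by (simp add: add_pow_def nat_pow_def)
  have poly_N: "univ_poly N = univ_poly M" unfolding N_def by (rule M.univ_poly_consistent[OF Er])
  have minus_N: "\<ominus>\<^bsub>N\<^esub> a = \<ominus> a" if a: "a \<in> E" for a
  proof -
    have "a \<oplus>\<^bsub>N\<^esub> \<ominus> a = \<zero>\<^bsub>N\<^esub>" "\<ominus> a \<in> carrier N" using a Ec subringE(5)[OF Er a] M.r_neg[of a] by (auto simp: N_def)
    thus ?thesis using N.minus_equality[of "\<ominus> a" a] a N.add.m_comm[of a "\<ominus> a"] by (simp add: N_simps)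
  qed
  have lfp_N: "linear_factors_poly N F d a r = linear_factors_poly M F d a r" if a: "\<And>i. i \<in> {1..d} \<Longrightarrow> a i \<in> F" for d a r
  proof -
    interpret UP: domain "univ_poly M F" by (rule M.univ_poly_is_domain[OF subfieldE(1)[OF F(1)]])
    have "[\<one>\<^bsub>N\<^esub>, \<ominus>\<^bsub>N\<^esub> a i] = [\<one>, \<ominus> a i]" if "i \<in> {1..d}" for i using minus_N[of "a i"] a[OF that] FE by (auto simp: N_simps)
    thus ?thesis unfolding linear_factors_poly_def poly_N
      by (intro UP.finprod_cong') (use M.factor_power[OF F(1) a] in auto)
  qed
  \<comment> \<open>With an empty set of translates nothing is removed, and the complement is
    \<open>F\<close> itself.\<close>
  have infF: "infinite F" using compl[of 1 "{}"] by simp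
  have "\<exists>K. subfield K N \<and> K0 \<subseteq> K \<and>
    (\<forall>S. finite S \<longrightarrow> S \<subseteq> K \<longrightarrow> (\<exists>L. subfield L N \<and> K0 \<subseteq> L \<and> S \<subseteq> L \<and> L \<subset> K)) \<and>
    (\<forall>u\<ge>1. definable_over (N\<lparr>carrier := K\<rparr>) (A u))"
  proof (rule N.definable_in_algebraic_field[of F K0 t A q C m c n B k b j])
    show "countable (carrier N)" using countable_subset[OF Ec M(2)] by (simp add: N_simps)
    show "subfield F N" "subfield K0 N" by (intro sub_N F K0 FE K0E)+
    show "infinite F" "F \<subseteq> K0" "t \<in> K0" by (rule infF K0)+
    show "K0 \<subseteq> L" if "subfield L N" "F \<subseteq> L" "t \<in> L" for L by (rule K0_min[OF sub_M(1)[OF that(1)] that(2,3)])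
    show "(N.algebraic over K0) z" if "z \<in> carrier N" for z using that unfolding over_def trans_N by (simp add: N_simps E_def over_def)
    show "t \<in> carrier N" using tE by (simp add: N_simps)
    show "(ring.transcendental N over F) t" using t(2) by (simp add: over_def trans_N)
    show "A u \<subseteq> F" if "u \<ge> 1" for u by (rule A(1)[OF that])
    show "Factorial_Ring.prime (q u)" if "u \<ge> 1" for u by (rule q(1)[OF that])
    show "[q u] \<cdot>\<^bsub>N\<^esub> \<one>\<^bsub>N\<^esub> \<noteq> \<zero>\<^bsub>N\<^esub>" if "u \<ge> 1" for u
      unfolding add_pow_N unfolding N_simps by (rule M.add_pow_field_char_nonzero[OF q(1,2)[OF that]])
    show "inj_on q {1..}" by (rule q(3))
    show "C u = linear_factors_poly N F (m u) (c u) (n u)" if "u \<ge> 1" for u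
      using lfp_N[of "m u" "c u" "n u"] in_F(1)[OF that] C[OF that] by simp
    show "B u = linear_factors_poly N F (k u) (b u) (j u)" if "u \<ge> 1" for u
      using lfp_N[of "k u" "b u" "j u"] in_F(2)[OF that] B[OF that] by simp
    show "c u i \<in> F" if "u \<ge> 1" "i \<in> {1..m u}" for u i by (rule in_F(1)[OF that])
    show "b u i \<in> F" if "u \<ge> 1" "i \<in> {1..k u}" for u i by (rule in_F(2)[OF that])
    show "0 < int (degree (C u)) - int (degree (B u))" if "u \<ge> 1" for u by (rule deg(1)[OF that])
    show "\<not> [int (degree (C u)) - int (degree (B u)) = 0] (mod int (q u))" if "u \<ge> 1" for u by (rule deg(2)[OF that])
    show "\<exists>y\<in>carrier N. y [^]\<^bsub>N\<^esub> q u \<otimes>\<^bsub>N\<^esub> N.eval (B u) x = N.eval (C u) x"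
      if u: "u \<ge> 1" and x: "x \<in> carrier N" "N.eval (B u) x \<noteq> \<zero>\<^bsub>N\<^esub>" for u x
    proof -
      have xE: "x \<in> E" "x \<in> carrier M" using x(1) Ec by (auto simp: N_simps)
      have nz: "M.eval (B u) x \<noteq> \<zero>" using x(2) by (simp add: eval_N N_simps)
      have CE: "M.eval (C u) x \<in> E" "M.eval (B u) x \<in> E" unfolding C[OF u] B[OF u]
        by (rule M.eval_linear_factors_poly_closed[OF F(1) _ E FE xE(1)], erule in_F[OF u])+
      obtain y where y: "y \<in> carrier M" "y [^] q u = M.eval (C u) x \<otimes> inv (M.eval (B u) x)" using roots[OF u xE(2) nz] by blast
      have "inv (M.eval (B u) x) \<in> E" using M.subfield_m_inv(1)[OF E, of "M.eval (B u) x"] CE(2) nz by blast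
      hence "y [^] q u \<in> E" unfolding y(2) by (rule subringE(6)[OF Er CE(1)])
      hence "(M.algebraic over K0) y" using M.algebraic_root[OF K0(1) y(1) _ prime_gt_0_nat[OF q(1)[OF u]]] by (simp add: E_def)
      hence "y \<in> E" unfolding E_def using y(1) by simp
      moreover have "M.eval (C u) x \<in> carrier M" "M.eval (B u) x \<in> carrier M" using CE Ec by blast+
      hence "y [^] q u \<otimes> M.eval (B u) x = M.eval (C u) x" unfolding y(2) using nz by (simp add: M.m_assoc)
      ultimately show ?thesis by (auto simp: N_simps pow_N eval_N)
    qed
  qed
  then obtain K where K: "subfield K N" "K0 \<subseteq> K"
    and chain: "\<forall>S. finite S \<longrightarrow> S \<subseteq> K \<longrightarrow> (\<exists>L. subfield L N \<and> K0 \<subseteq> L \<and> S \<subseteq> L \<and> L \<subset> K)"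
    and def_A: "\<forall>u\<ge>1. definable_over (M\<lparr>carrier := K\<rparr>) (A u)" unfolding N_simps by (elim exE conjE) (rule that)
  note KM = sub_M[OF K(1)]
  have "M.infinite_dimension K0 K"
  proof (rule M.infinite_dimension_of_chain[OF K0(1) KM(1) K(2)], intro allI impI)
    fix S assume S: "finite S" "S \<subseteq> K"
    obtain L where L: "subfield L N" "K0 \<subseteq> L" "S \<subseteq> L" "L \<subset> K"
      using chain[THEN spec, THEN mp, OF S(1), THEN mp, OF S(2)] by (elim exE conjE) (rule that)
    show "\<exists>L. subfield L M \<and> K0 \<subseteq> L \<and> S \<subseteq> L \<and> L \<subset> K"
      using sub_M(1)[OF L(1)] L(2-4) by (intro exI[of _ L] conjI)
  qed
  moreover have "\<forall>x\<in>K. M.algebraic K0 x" using KM(2) unfolding E_def over_def by blast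
  ultimately have "infinite_algebraic_extension M K0 K"
    unfolding infinite_algebraic_extension_def using K0(1) KM(1) K(2) by (intro conjI)
  thus ?thesis using KM(1) def_A unfolding K0_def by (intro exI[of _ K] conjI)
qed

end
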